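(* Fix $i\in I$. The functor $\mathrm{ad}_{E_i}:\mathcal H[i]\to\mathcal H[i]$ is locally nilpotent: for every $M\in\mathcal H[i]$ there is $n\ge0$ with $\mathrm{ad}_{E_i}^n(M)=0$.
   Context: Let $I$ be a nonempty set and $\cdot:\mathbb{Z}I\otimes\mathbb{Z}I\to\mathbb{Z}$ a symmetric bilinear form with $i\cdot i\in 2\mathbb{Z}_{>0}$ for all $i\in I$ and $c_{i,j}:=2(i\cdot j)/(i\cdot i)\in\mathbb{Z}_{\le 0}$ for $i\neq j$ (and $c_{i,i}=2$). Put $d_i=(i\cdot i)/2$, $Q=\bigoplus_{i\in I}\mathbb{Z}i$, $Q^+=\bigoplus_{i\in I}\mathbb{Z}_{\ge 0}i$. The height of $\beta=\sum n_i i\in Q^+$ is $|\beta|=\sum n_i$, and $I^\beta=\{\nu\in I^{|\beta|}:\sum_k\nu_k=\beta\}$. Components of tuples are numbered from right to left, $\nu=(\nu_n,\dots,\nu_1)$, and $s_k$ exchanges $\nu_k$ and $\nu_{k+1}$. $K$ is a commutative ring, $\otimes=\otimes_K$. For $i,j\in I$ fix $Q_{i,j}(u,v)\in K[u,v]$ with $Q_{i,i}=0$, $Q_{i,j}(u,v)=Q_{j,i}(v,u)$, and for $i\ne j$: if $c_{i,j}<0$, $Q_{i,j}(u,v)\in t_{i,j}u^{-c_{i,j}}+t_{j,i}v^{-c_{j,i}}+\sum_{s,t>0,\ d_is+d_jt=-i\cdot j}Ku^sv^t$ with $t_{i,j},t_{j,i}\in K^\times$; if $c_{i,j}=0$, $Q_{i,j}$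 is an invertible constant. KLR algebra. For $\beta\in Q^+$ of height $n$, $H_\beta$ is the unital $K$-algebra generated by $1_\nu$ ($\nu\in I^\beta$), $x_1,\dots,x_n$, $\tau_1,\dots,\tau_{n-1}$ with relations: $1_\nu1_{\nu'}=\delta_{\nu,\nu'}1_\nu$, $\sum_\nu1_\nu=1_\beta$ (the unit); $x_k1_\nu=1_\nu x_k$; $\tau_k1_\nu=1_{s_k(\nu)}\tau_k$; $x_kx_\ell=x_\ell x_k$; $\tau_k^21_\nu=Q_{\nu_k,\nu_{k+1}}(x_k,x_{k+1})1_\nu$; $(\tau_kx_\ell-x_{s_k(\ell)}\tau_k)1_\nu$ equals $1_\nu$ if $\ell=k+1,\nu_k=\nu_{k+1}$, equals $-1_\nu$ if $\ell=k,\nu_k=\nu_{k+1}$, and is $0$ otherwise; $\tau_k\tau_\ell=\tau_\ell\tau_k$ if $|k-\ell|>1$; $(\tau_{k+1}\tau_k\tau_{k+1}-\tau_k\tau_{k+1}\tau_k)1_\nu=\delta_{\nu_k,\nu_{k+2}}\frac{Q_{\nu_k,\nu_{k+1}}(x_{k+2},x_{k+1})-Q_{\nu_k,\nu_{k+1}}(x_k,x_{k+1})}{x_{k+2}-x_k}1_\nu$. Grading: $\deg 1_\nu=0$, $\deg x_k1_\nu=\nu_k\cdot\nu_k$, $\deg\tau_k1_\nu=-\nu_k\cdot\nu_{k+1}$. Monoidal structure. For $|\beta|=m$, $|\gamma|=n$ there is a non-unital morphism $H_\beta\otimes H_\gamma\to H_{\beta+\gamma}$, $y\otimes z\mapsto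 y\diamond z$, where $1_\mu\diamond1_\nu=1_{\mu\nu}$ (concatenation), generators $x_k,\tau_\ell$ of the left factor $H_\beta$ are sent to $x_{n+k},\tau_{n+\ell}$ and those of the right factor $H_\gamma$ to $x_k,\tau_\ell$. Put $1_{\beta,\gamma}=1_\beta\diamond1_\gamma$; set $1_{\beta-i,i}=0$ if $\beta-i\notin Q^+$. $E_i$ is the free $H_i$-module of rank one and, for a finitely generated graded $H_\beta$-module $M$, $E_iM=H_{\beta+i}1_{i,\beta}\otimes_{H_i\otimes H_\beta}(E_i\otimes M)\simeq H_{\beta+i}1_{i,\beta}\otimes_{H_\beta}M$. $H_\beta^i=H_\beta/(1_{\beta-i,i})$ (quotient by the two-sided ideal), $\mathcal H[i]=\bigoplus_{\beta\in Q^+}H_\beta^i\text{-mod}$ (finitely generated graded modules, degree preserving morphisms). For an $H_\beta$-module $M$, $\pi_i(M)=M/H_\beta1_{\beta-i,i}M$. For $M\in\mathcal H[i]$, $\mathrm{ad}_{E_i}(M)=\pi_i(E_iM)$. *)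

theory Defs
  imports "HOL-Library.Multiset" "HOL-Library.Poly_Mapping" "HOL-Algebra.Free_Abelian_Groups"
    "HOL-Algebra.Generated_Groups" "HOL-Algebra.QuotRing" "HOL-Algebra.Module"
begin

section \<open>The datum\<close>

text \<open>
  The index set \<open>I\<close> is the type \<^typ>\<open>'i\<close>; the bilinear form on \<open>\<int>I\<close> is given by its values
  \<open>ip i j\<close> on basis elements. \<open>Q\<^sup>+\<close> is \<^typ>\<open>'i multiset\<close> with height \<^const>\<open>size\<close>.
  An element of \<open>K[u,v]\<close> is a finitely supported family of coefficients,
  the key \<open>(s, t)\<close> standing for \<open>u\<^sup>s v\<^sup>t\<close>.
\<close>

type_synonym 'k poly2 = "(nat \<times> nat) \<Rightarrow>\<^sub>0 'k"

definition cartan :: "('i \<Rightarrow> 'i \<Rightarrow> int) \<Rightarrow> 'i \<Rightarrow> 'i \<Rightarrow> int" where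
  "cartan ip i j = (2 * ip i j) div ip i i"

locale klr_datum =
  fixes ip :: "'i \<Rightarrow> 'i \<Rightarrow> int"
    and t :: "'i \<Rightarrow> 'i \<Rightarrow> 'k::comm_ring_1"
    and Q :: "'i \<Rightarrow> 'i \<Rightarrow> 'k poly2"
  assumes ip_sym: "ip i j = ip j i"
    and ip_pos: "0 < ip i i"
    and ip_even: "even (ip i i)"
    and cartan_integral: "ip i i dvd 2 * ip i j"
    and cartan_nonpos: "i \<noteq> j \<Longrightarrow> cartan ip i j \<le> 0"
    and Q_diag: "Q i i = 0"
    and Q_sym: "Poly_Mapping.lookup (Q i j) (a, b) = Poly_Mapping.lookup (Q j i) (b, a)"
    and t_unit: "i \<noteq> j \<Longrightarrow> cartan ip i j < 0 \<Longrightarrow> t i j dvd 1"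
    and Q_neg: "i \<noteq> j \<Longrightarrow> cartan ip i j < 0 \<Longrightarrow>
      \<exists>R. Q i j = Poly_Mapping.single (nat (- cartan ip i j), 0) (t i j)
                + Poly_Mapping.single (0, nat (- cartan ip j i)) (t j i) + R
        \<and> Poly_Mapping.keys R \<subseteq> {(a, b). 0 < a \<and> 0 < b
            \<and> (ip i i div 2) * int a + (ip j j div 2) * int b = - ip i j}"
    and Q_zero: "i \<noteq> j \<Longrightarrow> cartan ip i j = 0 \<Longrightarrow>
      \<exists>c. c dvd 1 \<and> Q i j = Poly_Mapping.single (0, 0) c"


section \<open>Free algebras\<close>

text \<open>
  The free \<open>K\<close>-algebra on a set of generators is the monoid algebra of the free monoid of words;
  the newtype makes words an instance of \<^class>\<open>monoid_add\<close>, as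
  \<^theory>\<open>HOL-Library.Poly_Mapping\<close> requires for convolution.
\<close>

datatype 'g fword = FWord (letters: "'g list")

instantiation fword :: (type) monoid_add
begin
definition zero_fword :: "'a fword" where "zero_fword = FWord []"
definition plus_fword :: "'a fword \<Rightarrow> 'a fword \<Rightarrow> 'a fword" where
  "plus_fword v w = FWord (letters v @ letters w)"
instance
  by standard (simp_all add: zero_fword_def plus_fword_def)
end

definition scal :: "'k \<Rightarrow> 'g fword \<Rightarrow>\<^sub>0 'k::comm_ring_1" where
  "scal c = Poly_Mapping.single 0 c"

definition var :: "'g \<Rightarrow> 'g fword \<Rightarrow>\<^sub>0 'k::comm_ring_1" where
  "var g = Poly_Mapping.single (FWord [g]) 1"

definition free_alg :: "'g set \<Rightarrow> ('g fword \<Rightarrow>\<^sub>0 'k::comm_ring_1) ring" where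
  "free_alg G = \<lparr>carrier = {f. \<forall>w \<in> Poly_Mapping.keys f. set (letters w) \<subseteq> G},
     monoid.mult = (*), one = 1, zero = 0, add = (+)\<rparr>"

lemma free_alg_simps:
 "carrier (free_alg G) = {f. \<forall>w \<in> Poly_Mapping.keys f. set (letters w) \<subseteq> G}"
 "f \<otimes>\<^bsub>free_alg G\<^esub> g = f * g" "f \<oplus>\<^bsub>free_alg G\<^esub> g = f + g" "\<zero>\<^bsub>free_alg G\<^esub> = 0" "\<one>\<^bsub>free_alg G\<^esub> = 1"
  by (simp_all add: free_alg_def)

lemma fa_add: "f \<in> carrier (free_alg G) \<Longrightarrow> g \<in> carrier (free_alg G) \<Longrightarrow> f + g \<in> carrier (free_alg G)"
  unfolding free_alg_simps using keys_add[of f g] by blast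
lemma fa_minus: "f \<in> carrier (free_alg G) \<Longrightarrow> - f \<in> carrier (free_alg G)"
  unfolding free_alg_simps by simp
lemma fa_diff: "f \<in> carrier (free_alg G) \<Longrightarrow> g \<in> carrier (free_alg G) \<Longrightarrow> f - g \<in> carrier (free_alg G)"
  using fa_add[OF _ fa_minus, of f G g] by simp
lemma fa_mult: "f \<in> carrier (free_alg G) \<Longrightarrow> g \<in> carrier (free_alg G) \<Longrightarrow> f * g \<in> carrier (free_alg G)"
  unfolding free_alg_simps using keys_mult[of f g] by (fastforce simp: plus_fword_def)
lemma fa_0: "0 \<in> carrier (free_alg G)" and fa_1: "1 \<in> carrier (free_alg G)" and fa_scal: "scal c \<in> carrier (free_alg G)"
  by (auto simp: free_alg_simps scal_def zero_fword_def  split: if_splits)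
lemma fa_var: "g \<in> G \<Longrightarrow> var g \<in> carrier (free_alg G)"
  by (auto simp: free_alg_simps var_def)
lemma fa_sum: "(\<And>x. x \<in> A \<Longrightarrow> f x \<in> carrier (free_alg G)) \<Longrightarrow> sum f A \<in> carrier (free_alg G)"
  by (induction A rule: infinite_finite_induct) (auto intro: fa_0 fa_add)
lemma fa_pow: "f \<in> carrier (free_alg G) \<Longrightarrow> f ^ n \<in> carrier (free_alg G)"
  by (induction n) (auto intro: fa_1 fa_mult)

lemma ring_free_alg: "ring (free_alg G)"
proof (rule ringI)
  show "abelian_group (free_alg G)"
    by (rule abelian_groupI) (use fa_add fa_0 fa_minus in \<open>auto simp: free_alg_simps(2-) add_ac intro!: bexI[of _ "- _"]\<close>)
  show "Group.monoid (free_alg G)"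
    by standard (use fa_mult fa_1 in \<open>auto simp: free_alg_simps(2-) mult.assoc\<close>)
qed (auto simp: free_alg_simps(2-) algebra_simps)

definition word_subst :: "('g \<Rightarrow> 'h fword \<Rightarrow>\<^sub>0 'k) \<Rightarrow> ('g fword \<Rightarrow>\<^sub>0 'k::comm_ring_1) \<Rightarrow> 'h fword \<Rightarrow>\<^sub>0 'k" where
  "word_subst \<phi> f = (\<Sum>w \<in> Poly_Mapping.keys f.
     scal (Poly_Mapping.lookup f w) * prod_list (map \<phi> (letters w)))"


section \<open>KLR algebras\<close>

text \<open>
  \<open>eval2 \<kappa> q a b = q(a,b)\<close>, and \<open>dquot2 \<kappa> q a c b\<close> is the polynomial
  \<open>(q(a,b) - q(c,b)) / (a - c)\<close>; \<open>\<kappa>\<close> is the structure map of the \<open>K\<close>-algebra.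
\<close>

definition eval2 :: "('k::zero \<Rightarrow> 'r) \<Rightarrow> 'k poly2 \<Rightarrow> 'r \<Rightarrow> 'r \<Rightarrow> 'r::ring_1" where
  "eval2 \<kappa> q a b = (\<Sum>(s, t) \<in> Poly_Mapping.keys q. \<kappa> (Poly_Mapping.lookup q (s, t)) * a ^ s * b ^ t)"

definition dquot2 :: "('k::zero \<Rightarrow> 'r) \<Rightarrow> 'k poly2 \<Rightarrow> 'r \<Rightarrow> 'r \<Rightarrow> 'r \<Rightarrow> 'r::ring_1" where
  "dquot2 \<kappa> q a c b = (\<Sum>(s, t) \<in> Poly_Mapping.keys q.
     \<kappa> (Poly_Mapping.lookup q (s, t)) * (\<Sum>p<s. a ^ p * c ^ (s - Suc p)) * b ^ t)"

lemma dquot2_is_quotient: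
  fixes a b c :: "'r::comm_ring_1"
  shows "(a - c) * dquot2 \<kappa> q a c b = eval2 \<kappa> q a b - eval2 \<kappa> q c b"
proof -
  have "(a - c) * (\<Sum>p<s. a ^ p * c ^ (s - Suc p)) = a ^ s - c ^ s" for s
    by (subst power_diff_sumr2) (simp add: mult.commute)
  then have *: "(a - c) * (k * (\<Sum>p<s. a ^ p * c ^ (s - Suc p)) * d) = k * a ^ s * d - k * c ^ s * d"
    for k d s by (metis (no_types, lifting) left_diff_distrib mult.assoc mult.left_commute right_diff_distrib)
  show ?thesis
    unfolding dquot2_def eval2_def
    by (subst sum_distrib_left) (simp only: * sum_subtractf split_def)
qed

text \<open>
  A tuple \<open>\<nu> = (\<nu>\<^sub>n, \<dots>, \<nu>\<^sub>1)\<close> is the list of its components in the written order,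
  so that component \<open>k\<close> is counted from the right, starting at 1.
\<close>

definition entry :: "'i list \<Rightarrow> nat \<Rightarrow> 'i" where
  "entry \<nu> k = rev \<nu> ! (k - 1)"

definition swap_at :: "nat \<Rightarrow> 'i list \<Rightarrow> 'i list" where
  "swap_at k \<nu> = rev ((rev \<nu>)[k - 1 := entry \<nu> (k + 1), k := entry \<nu> k])"

definition seqs :: "'i multiset \<Rightarrow> 'i list set" where
  "seqs \<beta> = {\<nu>. mset \<nu> = \<beta>}"

datatype 'i klr_gen = EGen "'i list" | XGen nat | Tau nat

type_synonym ('i, 'k) klr_word_alg = "'i klr_gen fword \<Rightarrow>\<^sub>0 'k"
type_synonym ('i, 'k) klr_elem = "('i, 'k) klr_word_alg set"
type_synonym ('i, 'k) cyc_elem = "('i, 'k) klr_elem set"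

abbreviation egen :: "'i list \<Rightarrow> ('i, 'k::comm_ring_1) klr_word_alg" where "egen \<nu> \<equiv> var (EGen \<nu>)"
abbreviation xgen :: "nat \<Rightarrow> ('i, 'k::comm_ring_1) klr_word_alg" where "xgen k \<equiv> var (XGen k)"
abbreviation tau :: "nat \<Rightarrow> ('i, 'k::comm_ring_1) klr_word_alg" where "tau k \<equiv> var (Tau k)"

definition klr_gens :: "'i multiset \<Rightarrow> 'i klr_gen set" where
  "klr_gens \<beta> = EGen ` seqs \<beta> \<union> XGen ` {1..size \<beta>} \<union> Tau ` {1..<size \<beta>}"

abbreviation klr_free :: "'i multiset \<Rightarrow> ('i, 'k::comm_ring_1) klr_word_alg ring" where
  "klr_free \<beta> \<equiv> free_alg (klr_gens \<beta>)"

inductive_set klr_rels :: "('i \<Rightarrow> 'i \<Rightarrow> 'k::comm_ring_1 poly2) \<Rightarrow> 'i multiset \<Rightarrow> ('i, 'k) klr_word_alg set"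
  for Q :: "'i \<Rightarrow> 'i \<Rightarrow> 'k poly2" and \<beta> :: "'i multiset" where
  idem_orth: "\<lbrakk>\<nu> \<in> seqs \<beta>; \<nu>' \<in> seqs \<beta>\<rbrakk> \<Longrightarrow>
    egen \<nu> * egen \<nu>' - (if \<nu> = \<nu>' then egen \<nu> else 0) \<in> klr_rels Q \<beta>"
| idem_sum: "(\<Sum>\<nu> \<in> seqs \<beta>. egen \<nu>) - 1 \<in> klr_rels Q \<beta>"
| x_idem: "\<lbrakk>k \<in> {1..size \<beta>}; \<nu> \<in> seqs \<beta>\<rbrakk> \<Longrightarrow>
    xgen k * egen \<nu> - egen \<nu> * xgen k \<in> klr_rels Q \<beta>"
| tau_idem: "\<lbrakk>k \<in> {1..<size \<beta>}; \<nu> \<in> seqs \<beta>\<rbrakk> \<Longrightarrow>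
    tau k * egen \<nu> - egen (swap_at k \<nu>) * tau k \<in> klr_rels Q \<beta>"
| x_comm: "\<lbrakk>k \<in> {1..size \<beta>}; l \<in> {1..size \<beta>}\<rbrakk> \<Longrightarrow>
    xgen k * xgen l - xgen l * xgen k \<in> klr_rels Q \<beta>"
| tau_square: "\<lbrakk>k \<in> {1..<size \<beta>}; \<nu> \<in> seqs \<beta>\<rbrakk> \<Longrightarrow>
    tau k * tau k * egen \<nu>
      - eval2 scal (Q (entry \<nu> k) (entry \<nu> (k + 1))) (xgen k) (xgen (k + 1)) * egen \<nu> \<in> klr_rels Q \<beta>"
| tau_x: "\<lbrakk>k \<in> {1..<size \<beta>}; l \<in> {1..size \<beta>}; \<nu> \<in> seqs \<beta>\<rbrakk> \<Longrightarrow>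
    (tau k * xgen l - xgen (if l = k then k + 1 else if l = k + 1 then k else l) * tau k) * egen \<nu>
      - (if l = k + 1 \<and> entry \<nu> k = entry \<nu> (k + 1) then egen \<nu>
         else if l = k \<and> entry \<nu> k = entry \<nu> (k + 1) then - egen \<nu> else 0) \<in> klr_rels Q \<beta>"
| tau_comm: "\<lbrakk>k \<in> {1..<size \<beta>}; l \<in> {1..<size \<beta>}; \<bar>int k - int l\<bar> > 1\<rbrakk> \<Longrightarrow>
    tau k * tau l - tau l * tau k \<in> klr_rels Q \<beta>"
| braid: "\<lbrakk>k \<in> {1..<size \<beta>}; k + 1 \<in> {1..<size \<beta>}; \<nu> \<in> seqs \<beta>\<rbrakk> \<Longrightarrow>
    (tau (k + 1) * tau k * tau (k + 1) - tau k * tau (k + 1) * tau k) * egen \<nu>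
      - (if entry \<nu> k = entry \<nu> (k + 2)
         then dquot2 scal (Q (entry \<nu> k) (entry \<nu> (k + 1))) (xgen (k + 2)) (xgen k) (xgen (k + 1)) * egen \<nu>
         else 0) \<in> klr_rels Q \<beta>"

definition klr_ideal :: "('i \<Rightarrow> 'i \<Rightarrow> 'k::comm_ring_1 poly2) \<Rightarrow> 'i multiset \<Rightarrow> ('i, 'k) klr_elem" where
  "klr_ideal Q \<beta> = Idl\<^bsub>klr_free \<beta>\<^esub> (klr_rels Q \<beta>)"

definition klr :: "('i \<Rightarrow> 'i \<Rightarrow> 'k::comm_ring_1 poly2) \<Rightarrow> 'i multiset \<Rightarrow> ('i, 'k) klr_elem ring" where
  "klr Q \<beta> = klr_free \<beta> Quot klr_ideal Q \<beta>"

text \<open>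
  The relations lie in the free algebra, so \<^const>\<open>genideal\<close> yields a genuine ideal.
\<close>

lemma seqs_size: "\<nu> \<in> seqs \<beta> \<Longrightarrow> length \<nu> = size \<beta>" by (auto simp: seqs_def)
lemma swap_seqs: assumes "\<nu> \<in> seqs \<beta>" "k \<in> {1..<size \<beta>}" shows "swap_at k \<nu> \<in> seqs \<beta>"
proof -
  have l: "k < length (rev \<nu>)" "k - 1 < length (rev \<nu>)" using assms seqs_size[OF assms(1)] by auto
  have "mset ((rev \<nu>)[k - 1 := rev \<nu> ! k, k := rev \<nu> ! (k - 1)]) = mset (rev \<nu>)"
    using mset_swap[OF l(1) l(2)] mset_swap[OF l(2) l(1)] by simp
  then show ?thesis using assms by (simp add: seqs_def swap_at_def entry_def)
qed

lemma klr_rels_sub: "klr_rels Q \<beta> \<subseteq> carrier (klr_free \<beta>)"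
proof
  fix r assume "r \<in> klr_rels Q \<beta>"
  then show "r \<in> carrier (klr_free \<beta>)"
    by (induction rule: klr_rels.induct)
      (auto intro!: fa_diff fa_add fa_mult fa_0 fa_1 fa_var fa_sum fa_pow fa_minus fa_scal swap_seqs
        simp: klr_gens_def eval2_def dquot2_def split_def)
qed

lemma ideal_klr: "ideal (klr_ideal Q \<beta>) (klr_free \<beta>)"
  unfolding klr_ideal_def by (rule ring.genideal_ideal[OF ring_free_alg klr_rels_sub])
lemma ring_klr: "ring (klr Q \<beta>)" unfolding klr_def by (rule ideal.quotient_is_ring[OF ideal_klr])

definition klr_class :: "('i \<Rightarrow> 'i \<Rightarrow> 'k::comm_ring_1 poly2) \<Rightarrow> 'i multiset \<Rightarrow>
    ('i, 'k) klr_word_alg \<Rightarrow> ('i, 'k) klr_elem" where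
  "klr_class Q \<beta> f = klr_ideal Q \<beta> +>\<^bsub>klr_free \<beta>\<^esub> f"

text \<open>
  \<open>klr_homog ip Q \<beta> d\<close> is the degree \<open>d\<close> component of \<open>H\<^sub>\<beta>\<close>: the smallest multiplicative family of
  \<open>K\<close>-submodules in which the generators have the prescribed degrees.
\<close>

inductive_set klr_homog_rel ::
  "('i \<Rightarrow> 'i \<Rightarrow> int) \<Rightarrow> ('i \<Rightarrow> 'i \<Rightarrow> 'k::comm_ring_1 poly2) \<Rightarrow> 'i multiset \<Rightarrow> (int \<times> ('i, 'k) klr_elem) set"
  for ip :: "'i \<Rightarrow> 'i \<Rightarrow> int" and Q :: "'i \<Rightarrow> 'i \<Rightarrow> 'k poly2" and \<beta> :: "'i multiset" where
  "\<nu> \<in> seqs \<beta> \<Longrightarrow> (0, klr_class Q \<beta> (egen \<nu>)) \<in> klr_homog_rel ip Q \<beta>"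
| "\<lbrakk>k \<in> {1..size \<beta>}; \<nu> \<in> seqs \<beta>\<rbrakk> \<Longrightarrow>
    (ip (entry \<nu> k) (entry \<nu> k), klr_class Q \<beta> (xgen k * egen \<nu>)) \<in> klr_homog_rel ip Q \<beta>"
| "\<lbrakk>k \<in> {1..<size \<beta>}; \<nu> \<in> seqs \<beta>\<rbrakk> \<Longrightarrow>
    (- ip (entry \<nu> k) (entry \<nu> (k + 1)), klr_class Q \<beta> (tau k * egen \<nu>)) \<in> klr_homog_rel ip Q \<beta>"
| "(d, \<zero>\<^bsub>klr Q \<beta>\<^esub>) \<in> klr_homog_rel ip Q \<beta>"
| "\<lbrakk>(d, g) \<in> klr_homog_rel ip Q \<beta>; (d, h) \<in> klr_homog_rel ip Q \<beta>\<rbrakk> \<Longrightarrow>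
    (d, g \<oplus>\<^bsub>klr Q \<beta>\<^esub> h) \<in> klr_homog_rel ip Q \<beta>"
| "(d, h) \<in> klr_homog_rel ip Q \<beta> \<Longrightarrow>
    (d, klr_class Q \<beta> (scal c) \<otimes>\<^bsub>klr Q \<beta>\<^esub> h) \<in> klr_homog_rel ip Q \<beta>"
| "\<lbrakk>(d, g) \<in> klr_homog_rel ip Q \<beta>; (d', h) \<in> klr_homog_rel ip Q \<beta>\<rbrakk> \<Longrightarrow>
    (d + d', g \<otimes>\<^bsub>klr Q \<beta>\<^esub> h) \<in> klr_homog_rel ip Q \<beta>"

definition klr_homog ::
  "('i \<Rightarrow> 'i \<Rightarrow> int) \<Rightarrow> ('i \<Rightarrow> 'i \<Rightarrow> 'k::comm_ring_1 poly2) \<Rightarrow> 'i multiset \<Rightarrow> int \<Rightarrow> ('i, 'k) klr_elem set" where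
  "klr_homog ip Q \<beta> d = {h. (d, h) \<in> klr_homog_rel ip Q \<beta>}"


subsection \<open>The non-unital morphism \<open>H\<^sub>\<beta> \<otimes> H\<^sub>\<gamma> \<rightarrow> H\<^bsub>\<beta>+\<gamma>\<^esub>\<close>\<close>

definition idem_pair :: "'i multiset \<Rightarrow> 'i multiset \<Rightarrow> ('i, 'k::comm_ring_1) klr_word_alg" where
  "idem_pair \<beta> \<gamma> = (\<Sum>\<mu> \<in> seqs \<beta>. \<Sum>\<nu> \<in> seqs \<gamma>. egen (\<mu> @ \<nu>))"

text \<open>
  The letterwise images in \<open>H\<^bsub>\<beta>+\<gamma>\<^esub>\<close> of the generators of \<open>H\<^sub>\<beta>\<close> and \<open>H\<^sub>\<gamma>\<close>. They are
  multiplied by \<open>1\<^bsub>\<beta>,\<gamma>\<^esub>\<close> afterwards: \<open>y \<diamond> z = 1\<^bsub>\<beta>,\<gamma>\<^esub> (y \<diamond> 1) (1 \<diamond> z)\<close>.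
\<close>

fun left_img :: "'i multiset \<Rightarrow> 'i klr_gen \<Rightarrow> ('i, 'k::comm_ring_1) klr_word_alg" where
  "left_img \<gamma> (EGen \<mu>) = (\<Sum>\<nu> \<in> seqs \<gamma>. egen (\<mu> @ \<nu>))"
| "left_img \<gamma> (XGen k) = xgen (size \<gamma> + k)"
| "left_img \<gamma> (Tau k) = tau (size \<gamma> + k)"

fun right_img :: "'i multiset \<Rightarrow> 'i klr_gen \<Rightarrow> ('i, 'k::comm_ring_1) klr_word_alg" where
  "right_img \<beta> (EGen \<nu>) = (\<Sum>\<mu> \<in> seqs \<beta>. egen (\<mu> @ \<nu>))"
| "right_img \<beta> (XGen k) = xgen k"
| "right_img \<beta> (Tau k) = tau k"

definition klr_diamond :: "('i \<Rightarrow> 'i \<Rightarrow> 'k::comm_ring_1 poly2) \<Rightarrow> 'i multiset \<Rightarrow> 'i multiset \<Rightarrow>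
    ('i, 'k) klr_elem \<Rightarrow> ('i, 'k) klr_elem \<Rightarrow> ('i, 'k) klr_elem" where
  "klr_diamond Q \<beta> \<gamma> y z = the_elem ((\<lambda>(f, g). klr_class Q (\<beta> + \<gamma>)
     (idem_pair \<beta> \<gamma> * word_subst (left_img \<gamma>) f * word_subst (right_img \<beta>) g)) ` (y \<times> z))"

text \<open>\<open>last_idem Q i \<beta>\<close> is \<open>1\<^bsub>\<beta>-i,i\<^esub>\<close>; it is 0 if \<open>\<beta> - i \<notin> Q\<^sup>+\<close>.\<close>

definition last_idem :: "('i \<Rightarrow> 'i \<Rightarrow> 'k::comm_ring_1 poly2) \<Rightarrow> 'i \<Rightarrow> 'i multiset \<Rightarrow> ('i, 'k) klr_elem" where
  "last_idem Q i \<beta> = (if i \<in># \<beta>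
     then klr_diamond Q (\<beta> - {#i#}) {#i#} \<one>\<^bsub>klr Q (\<beta> - {#i#})\<^esub> \<one>\<^bsub>klr Q {#i#}\<^esub>
     else \<zero>\<^bsub>klr Q \<beta>\<^esub>)"

definition cyc_ideal :: "('i \<Rightarrow> 'i \<Rightarrow> 'k::comm_ring_1 poly2) \<Rightarrow> 'i \<Rightarrow> 'i multiset \<Rightarrow> ('i, 'k) cyc_elem" where
  "cyc_ideal Q i \<beta> = Idl\<^bsub>klr Q \<beta>\<^esub> {last_idem Q i \<beta>}"

definition cyc_klr :: "('i \<Rightarrow> 'i \<Rightarrow> 'k::comm_ring_1 poly2) \<Rightarrow> 'i \<Rightarrow> 'i multiset \<Rightarrow> ('i, 'k) cyc_elem ring" where
  "cyc_klr Q i \<beta> = klr Q \<beta> Quot cyc_ideal Q i \<beta>"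

definition cyc_class :: "('i \<Rightarrow> 'i \<Rightarrow> 'k::comm_ring_1 poly2) \<Rightarrow> 'i \<Rightarrow> 'i multiset \<Rightarrow>
    ('i, 'k) klr_elem \<Rightarrow> ('i, 'k) cyc_elem" where
  "cyc_class Q i \<beta> h = cyc_ideal Q i \<beta> +>\<^bsub>klr Q \<beta>\<^esub> h"

definition cyc_homog :: "('i \<Rightarrow> 'i \<Rightarrow> int) \<Rightarrow> ('i \<Rightarrow> 'i \<Rightarrow> 'k::comm_ring_1 poly2) \<Rightarrow> 'i \<Rightarrow> 'i multiset \<Rightarrow>
    int \<Rightarrow> ('i, 'k) cyc_elem set" where
  "cyc_homog ip Q i \<beta> d = cyc_class Q i \<beta> ` klr_homog ip Q \<beta> d"


section \<open>Graded modules over noncommutative rings\<close>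

text \<open>
  The record \<^typ>\<open>('a, 'm) module\<close> is reused without the locale \<^locale>\<open>module\<close>, which
  asks for a commutative ring of scalars; its fields \<^const>\<open>mult\<close> and \<^const>\<open>one\<close> are irrelevant.
\<close>

record ('a, 'm) gmodule = "('a, 'm) module" +
  homog :: "int \<Rightarrow> 'm set"

locale left_module = R?: ring R + M?: abelian_group M for R (structure) and M (structure) +
  assumes smult_closed: "\<lbrakk>a \<in> carrier R; x \<in> carrier M\<rbrakk> \<Longrightarrow> a \<odot>\<^bsub>M\<^esub> x \<in> carrier M"
    and smult_l_distr: "\<lbrakk>a \<in> carrier R; b \<in> carrier R; x \<in> carrier M\<rbrakk> \<Longrightarrow>
      (a \<oplus>\<^bsub>R\<^esub> b) \<odot>\<^bsub>M\<^esub> x = a \<odot>\<^bsub>M\<^esub> x \<oplus>\<^bsub>M\<^esub> b \<odot>\<^bsub>M\<^esub> x"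
    and smult_r_distr: "\<lbrakk>a \<in> carrier R; x \<in> carrier M; y \<in> carrier M\<rbrakk> \<Longrightarrow>
      a \<odot>\<^bsub>M\<^esub> (x \<oplus>\<^bsub>M\<^esub> y) = a \<odot>\<^bsub>M\<^esub> x \<oplus>\<^bsub>M\<^esub> a \<odot>\<^bsub>M\<^esub> y"
    and smult_assoc: "\<lbrakk>a \<in> carrier R; b \<in> carrier R; x \<in> carrier M\<rbrakk> \<Longrightarrow>
      (a \<otimes>\<^bsub>R\<^esub> b) \<odot>\<^bsub>M\<^esub> x = a \<odot>\<^bsub>M\<^esub> (b \<odot>\<^bsub>M\<^esub> x)"
    and smult_one: "x \<in> carrier M \<Longrightarrow> \<one>\<^bsub>R\<^esub> \<odot>\<^bsub>M\<^esub> x = x"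

text \<open>\<open>A d\<close> is the degree \<open>d\<close> component of the graded ring \<open>R\<close>.\<close>

locale graded_left_module = left_module R M for R (structure) and A :: "int \<Rightarrow> 'a set" and M (structure) +
  assumes homog_subgroup: "subgroup (homog M d) (add_monoid M)"
    and homog_smult: "\<lbrakk>a \<in> A d; x \<in> homog M e\<rbrakk> \<Longrightarrow> a \<odot>\<^bsub>M\<^esub> x \<in> homog M (d + e)"
    and homog_direct_sum: "x \<in> carrier M \<Longrightarrow>
      \<exists>!c. (\<forall>d. c d \<in> homog M d) \<and> finite {d. c d \<noteq> \<zero>\<^bsub>M\<^esub>} \<and> x = finsum M c {d. c d \<noteq> \<zero>\<^bsub>M\<^esub>}"

definition fin_gen_module :: "('a, 'r) ring_scheme \<Rightarrow> ('a, 'm, 's) module_scheme \<Rightarrow> bool" where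
  "fin_gen_module R M \<longleftrightarrow> (\<exists>S \<subseteq> carrier M. finite S \<and>
     (\<forall>N. submodule N R M \<longrightarrow> S \<subseteq> N \<longrightarrow> N = carrier M))"

definition zero_module :: "('a, 'm, 's) module_scheme \<Rightarrow> bool" where
  "zero_module M \<longleftrightarrow> carrier M = {\<zero>\<^bsub>M\<^esub>}"

text \<open>
  Objects of \<open>\<H>[i]\<close>: a direct sum of categories consists of families with finitely many
  nonzero members.
\<close>

definition cyc_cat :: "('i \<Rightarrow> 'i \<Rightarrow> int) \<Rightarrow> ('i \<Rightarrow> 'i \<Rightarrow> 'k::comm_ring_1 poly2) \<Rightarrow> 'i \<Rightarrow>
    ('i multiset \<Rightarrow> (('i, 'k) cyc_elem, 'm) gmodule) set" where
  "cyc_cat ip Q i = {M.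
     (\<forall>\<beta>. graded_left_module (cyc_klr Q i \<beta>) (cyc_homog ip Q i \<beta>) (M \<beta>)
        \<and> fin_gen_module (cyc_klr Q i \<beta>) (M \<beta>))
     \<and> finite {\<beta>. \<not> zero_module (M \<beta>)}}"

definition inflate :: "('i \<Rightarrow> 'i \<Rightarrow> 'k::comm_ring_1 poly2) \<Rightarrow> 'i \<Rightarrow> 'i multiset \<Rightarrow>
    (('i, 'k) cyc_elem, 'm) gmodule \<Rightarrow> (('i, 'k) klr_elem, 'm) gmodule" where
  "inflate Q i \<beta> M = \<lparr>carrier = carrier M, monoid.mult = undefined, one = undefined,
     zero = \<zero>\<^bsub>M\<^esub>, add = add M, smult = (\<lambda>h x. cyc_class Q i \<beta> h \<odot>\<^bsub>M\<^esub> x), homog = homog M\<rparr>"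


section \<open>The functors \<open>E\<^sub>i\<close>, \<open>\<pi>\<^sub>i\<close> and \<open>ad\<^bsub>E\<^sub>i\<^esub>\<close> on objects\<close>

text \<open>
  \<open>P \<otimes>\<^bsub>R\<^esub> M\<close>, for an additive subgroup \<open>P\<close> of the ring \<open>A\<close> with right \<open>R\<close>-action
  \<open>h \<cdot> r = h \<phi>(r)\<close>: the quotient of the free abelian group on \<open>P \<times> M\<close> by the subgroup
  generated by the biadditivity and balancing relations.
\<close>

inductive_set tensor_rels ::
  "('a, 'z) ring_scheme \<Rightarrow> 'a set \<Rightarrow> ('r, 'y) ring_scheme \<Rightarrow> ('r \<Rightarrow> 'a) \<Rightarrow> ('r, 'm, 's) module_scheme \<Rightarrow>
    ('a \<times> 'm \<Rightarrow>\<^sub>0 int) set"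
  for A :: "('a, 'z) ring_scheme" and P :: "'a set" and R :: "('r, 'y) ring_scheme"
    and \<phi> :: "'r \<Rightarrow> 'a" and M :: "('r, 'm, 's) module_scheme" where
  "\<lbrakk>g \<in> P; h \<in> P; x \<in> carrier M\<rbrakk> \<Longrightarrow>
    frag_of (g \<oplus>\<^bsub>A\<^esub> h, x) - frag_of (g, x) - frag_of (h, x) \<in> tensor_rels A P R \<phi> M"
| "\<lbrakk>h \<in> P; x \<in> carrier M; y \<in> carrier M\<rbrakk> \<Longrightarrow>
    frag_of (h, x \<oplus>\<^bsub>M\<^esub> y) - frag_of (h, x) - frag_of (h, y) \<in> tensor_rels A P R \<phi> M"
| "\<lbrakk>h \<in> P; r \<in> carrier R; x \<in> carrier M\<rbrakk> \<Longrightarrow>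
    frag_of (h \<otimes>\<^bsub>A\<^esub> \<phi> r, x) - frag_of (h, r \<odot>\<^bsub>M\<^esub> x) \<in> tensor_rels A P R \<phi> M"

text \<open>
  \<open>A\<^sub>0 d\<close> and \<open>homog M d\<close> are the degree \<open>d\<close> components of \<open>A\<close> and \<open>M\<close>;
  \<open>P\<close> is a graded left ideal of \<open>A\<close>.
\<close>

definition tensor_module ::
  "('a, 'z) ring_scheme \<Rightarrow> (int \<Rightarrow> 'a set) \<Rightarrow> 'a set \<Rightarrow> ('r, 'y) ring_scheme \<Rightarrow> ('r \<Rightarrow> 'a) \<Rightarrow>
    ('r, 'm) gmodule \<Rightarrow> ('a, ('a \<times> 'm \<Rightarrow>\<^sub>0 int) set) gmodule" where
  "tensor_module A A\<^sub>0 P R \<phi> M =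
    (let F = free_Abelian_group (P \<times> carrier M);
         N = generate F (tensor_rels A P R \<phi> M);
         T = F Mod N
     in \<lparr>carrier = carrier T, monoid.mult = undefined, one = undefined,
         zero = \<one>\<^bsub>T\<^esub>, add = monoid.mult T,
         smult = (\<lambda>a C. the_elem
           ((\<lambda>f. N #>\<^bsub>F\<^esub> frag_extend (\<lambda>(h, x). frag_of (a \<otimes>\<^bsub>A\<^esub> h, x)) f) ` C)),
         homog = (\<lambda>d. generate T {N #>\<^bsub>F\<^esub> frag_of (h, x) | h x a b.
           h \<in> P \<inter> A\<^sub>0 a \<and> x \<in> homog M b \<and> a + b = d})\<rparr>)"

text \<open>\<open>E\<^sub>i M = H\<^bsub>\<beta>+i\<^esub> 1\<^bsub>i,\<beta>\<^esub> \<otimes> M\<close> over \<open>H\<^sub>\<beta>\<close>, which acts on the right through \<open>z \<mapsto> 1\<^sub>i \<diamond> z\<close>.\<close>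

definition E_functor :: "('i \<Rightarrow> 'i \<Rightarrow> int) \<Rightarrow> ('i \<Rightarrow> 'i \<Rightarrow> 'k::comm_ring_1 poly2) \<Rightarrow> 'i \<Rightarrow> 'i multiset \<Rightarrow>
    (('i, 'k) klr_elem, 'm) gmodule \<Rightarrow>
    (('i, 'k) klr_elem, (('i, 'k) klr_elem \<times> 'm \<Rightarrow>\<^sub>0 int) set) gmodule" where
  "E_functor ip Q i \<beta> M =
    (let A = klr Q ({#i#} + \<beta>);
         \<phi> = klr_diamond Q {#i#} \<beta> \<one>\<^bsub>klr Q {#i#}\<^esub>
     in tensor_module A (klr_homog ip Q ({#i#} + \<beta>))
          {h \<otimes>\<^bsub>A\<^esub> \<phi> \<one>\<^bsub>klr Q \<beta>\<^esub> | h. h \<in> carrier A} (klr Q \<beta>) \<phi> M)"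

text \<open>\<open>\<pi>\<^sub>i(M) = M / H\<^sub>\<beta> 1\<^bsub>\<beta>-i,i\<^esub> M\<close>, as a module over \<open>H\<^sub>\<beta>\<^sup>i\<close>.\<close>

definition pi_submodule :: "('i \<Rightarrow> 'i \<Rightarrow> 'k::comm_ring_1 poly2) \<Rightarrow> 'i \<Rightarrow> 'i multiset \<Rightarrow>
    (('i, 'k) klr_elem, 'm) gmodule \<Rightarrow> 'm set" where
  "pi_submodule Q i \<beta> M = generate (add_monoid M)
     {h \<odot>\<^bsub>M\<^esub> (last_idem Q i \<beta> \<odot>\<^bsub>M\<^esub> x) | h x. h \<in> carrier (klr Q \<beta>) \<and> x \<in> carrier M}"

definition pi_functor :: "('i \<Rightarrow> 'i \<Rightarrow> 'k::comm_ring_1 poly2) \<Rightarrow> 'i \<Rightarrow> 'i multiset \<Rightarrow>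
    (('i, 'k) klr_elem, 'm) gmodule \<Rightarrow> (('i, 'k) cyc_elem, 'm set) gmodule" where
  "pi_functor Q i \<beta> M =
    (let N = pi_submodule Q i \<beta> M
     in \<lparr>carrier = a_rcosets\<^bsub>M\<^esub> N, monoid.mult = undefined, one = undefined,
         zero = N, add = set_add M,
         smult = (\<lambda>a C. the_elem ((\<lambda>(h, x). N +>\<^bsub>M\<^esub> (h \<odot>\<^bsub>M\<^esub> x)) ` (a \<times> C))),
         homog = (\<lambda>d. (\<lambda>x. N +>\<^bsub>M\<^esub> x) ` homog M d)\<rparr>)"

text \<open>
  The carrier of \<open>\<pi>\<^sub>i(E\<^sub>i M)\<close> lives in a larger type than that of \<open>M\<close>. In order to iterate,
  it is transported along an injection into the following type, which is closed under the
  construction: an element is sent to a chosen formal combination \<open>\<Sum> c (h \<otimes> x)\<close> representing it.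
\<close>

datatype ('a, 'm) univ = Base 'm | Comb "(int \<times> 'a \<times> ('a, 'm) univ) list"

definition encode :: "('a \<times> ('a, 'm) univ \<Rightarrow>\<^sub>0 int) set set \<Rightarrow> ('a, 'm) univ" where
  "encode D = Comb (SOME l. (\<Sum>(c, h, x) \<leftarrow> l. frag_cmul c (frag_of (h, x))) \<in> \<Union>D)"

text \<open>The elements \<open>D\<close> of \<open>\<pi>\<^sub>i(E\<^sub>i M)\<close> have nonempty, pairwise disjoint unions, so they are encoded faithfully.\<close>

lemma encode_in: assumes "\<Union>D \<noteq> {}"
  shows "\<exists>l. encode D = Comb l \<and> (\<Sum>(c, h, x) \<leftarrow> l. frag_cmul c (frag_of (h, x))) \<in> \<Union>D"
proof -
  have repr: "\<exists>l. (\<Sum>(c, h, x) \<leftarrow> l. frag_cmul c (frag_of (h, x))) = f"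
    for f :: "'a \<times> ('a, 'm) univ \<Rightarrow>\<^sub>0 int"
  proof -
    obtain ks where ks: "set ks = Poly_Mapping.keys f" "distinct ks"
      using finite_distinct_list [OF finite_keys, of f] by (elim exE conjE)
    have "(\<Sum>k \<leftarrow> ks. frag_cmul (Poly_Mapping.lookup f k) (frag_of k)) = frag_extend frag_of f"
      by (simp only: sum_list_distinct_conv_sum_set [OF ks(2)] ks(1) frag_extend_def)
    also have "\<dots> = f"
      by (rule frag_expansion [symmetric])
    finally have "(\<Sum>(c, h, x) \<leftarrow> map (\<lambda>k. (Poly_Mapping.lookup f k, k)) ks. frag_cmul c (frag_of (h, x))) = f"
      by (simp only: map_map comp_def case_prod_beta fst_conv snd_conv prod.collapse)
    then show ?thesis by (rule exI)
  qed
  obtain f where f: "f \<in> \<Union>D"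
    using assms by blast
  obtain l where "(\<Sum>(c, h, x) \<leftarrow> l. frag_cmul c (frag_of (h, x))) = f"
    using repr [of f] by (rule exE)
  with f have "\<exists>l. (\<Sum>(c, h, x) \<leftarrow> l. frag_cmul c (frag_of (h, x))) \<in> \<Union>D"
    by (intro exI [of _ l]) (simp only:)
  from someI_ex[OF this] show ?thesis
    unfolding encode_def by (intro exI, rule conjI [OF refl])
qed

lemma inj_on_encode:
  assumes "\<And>D. D \<in> \<D> \<Longrightarrow> \<Union>D \<noteq> {}"
    and "\<And>D D'. \<lbrakk>D \<in> \<D>; D' \<in> \<D>; D \<noteq> D'\<rbrakk> \<Longrightarrow> \<Union>D \<inter> \<Union>D' = {}"
  shows "inj_on encode \<D>"
proof (rule inj_onI, rule ccontr)
  fix D D' assume D: "D \<in> \<D>" "D' \<in> \<D>" "encode D = encode D'" "D \<noteq> D'"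
  obtain l where l: "encode D = Comb l" "(\<Sum>(c, h, x) \<leftarrow> l. frag_cmul c (frag_of (h, x))) \<in> \<Union>D"
    using encode_in[OF assms(1)[OF D(1)]] by blast
  obtain l' where l': "encode D' = Comb l'" "(\<Sum>(c, h, x) \<leftarrow> l'. frag_cmul c (frag_of (h, x))) \<in> \<Union>D'"
    using encode_in[OF assms(1)[OF D(2)]] by blast
  from l(1) l'(1) D(3) have "l = l'" by simp
  with l(2) l'(2) show False using assms(2)[OF D(1,2,4)] by blast
qed

definition relabel :: "('m \<Rightarrow> 'n) \<Rightarrow> ('a, 'm) gmodule \<Rightarrow> ('a, 'n) gmodule" where
  "relabel f M = (let g = inv_into (carrier M) f
     in \<lparr>carrier = f ` carrier M, monoid.mult = undefined, one = undefined,
         zero = f \<zero>\<^bsub>M\<^esub>, add = (\<lambda>x y. f (g x \<oplus>\<^bsub>M\<^esub> g y)),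
         smult = (\<lambda>a x. f (a \<odot>\<^bsub>M\<^esub> g x)), homog = (\<lambda>d. f ` homog M d)\<rparr>)"

definition trivial_module :: "'m \<Rightarrow> ('a, 'm) gmodule" where
  "trivial_module z = \<lparr>carrier = {z}, monoid.mult = undefined, one = undefined,
     zero = z, add = (\<lambda>_ _. z), smult = (\<lambda>_ _. z), homog = (\<lambda>_. {z})\<rparr>"

text \<open>The component of weight \<open>\<gamma>\<close> of \<open>ad\<^bsub>E\<^sub>i\<^esub>(M)\<close> comes from the component of \<open>M\<close> of weight \<open>\<gamma> - i\<close>.\<close>

definition ad_E :: "('i \<Rightarrow> 'i \<Rightarrow> int) \<Rightarrow> ('i \<Rightarrow> 'i \<Rightarrow> 'k::comm_ring_1 poly2) \<Rightarrow> 'i \<Rightarrow>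
    ('i multiset \<Rightarrow> (('i, 'k) cyc_elem, (('i, 'k) klr_elem, 'm) univ) gmodule) \<Rightarrow>
    'i multiset \<Rightarrow> (('i, 'k) cyc_elem, (('i, 'k) klr_elem, 'm) univ) gmodule" where
  "ad_E ip Q i M \<gamma> = (if i \<in># \<gamma>
     then let \<beta> = \<gamma> - {#i#}
          in relabel encode (pi_functor Q i \<gamma> (E_functor ip Q i \<beta> (inflate Q i \<beta> (M \<beta>))))
     else trivial_module (Comb []))"

end

theory Submission
  imports Defs
begin

text \<open>
  The module \<open>ad\<^bsub>E\<^sub>i\<^esub>\<^sup>n(M)\<close> is generated by vectors fixed by the idempotents \<open>1\<^bsub>i\<^sup>n\<nu>\<^esub>\<close>, where \<open>\<nu>\<close> runs through
  the finitely many words whose weight lies in the support of \<open>M\<close>. So it suffices that \<open>1\<^bsub>i\<^sup>n\<nu>\<^esub>\<close> lies in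
  the ideal of \<open>H\<^bsub>\<beta>+ni\<^esub>\<close> generated by the \<open>1\<^bsub>\<mu>i\<^esub>\<close> as soon as \<open>n\<close> is large compared to \<open>\<nu>\<close>.
  To this end one shows, by induction on \<open>\<nu>\<close>, that modulo this ideal \<open>x\<^bsub>|\<nu>|+1\<^esub>\<close> satisfies on all \<open>1\<^bsub>\<mu>i\<nu>\<^esub>\<close>
  a monic polynomial equation over \<open>K[x\<^sub>1, \<dots>, x\<^bsub>|\<nu>|\<^esub>]\<close>. Conjugation by \<open>\<tau>\<close> moves the equation past a
  letter \<open>j \<noteq> i\<close> at the cost of a factor \<open>Q\<^bsub>j,i\<^esub>\<close>, which raises the degree by \<open>- c\<^bsub>i,j\<^esub>\<close>; past a letter
  \<open>i\<close> it produces the divided difference, which is monic of degree one less. After sufficiently many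
  letters \<open>i\<close> the degree is 0 and the idempotent itself vanishes.
\<close>


section \<open>Free algebras and congruences\<close>

text \<open>When the letter to be passed is \<open>i\<close>, crossing is not enough by itself. Let
  e be the idempotent of a word with two adjacent letters \<open>i\<close>, s their crossing, x and
  y their variables, p monic with p e = 0 modulo the ideal, p' its copy in y, and D the quotient of
  p - p' by x - y. The relation s p e = 0 yields only D e = p' s e. That both sides vanish comes
  from \<open>Q_{i,i} = 0\<close>, that is s s e = 0, together with (x - y) D = p - p'. The
  induction starts in degree 0, because the idempotents of words ending in \<open>i\<close> lie in
  the ideal. One polynomial has to serve every prefix \<mu>, because a crossing shifts a letter of
  the word into the prefix. All computations are made with words in the free algebra, up to elements
  of an ideal. There the variables commute only up to the ideal, so degree and monicity are attached
  to explicit Horner words and not to elements of the quotient; operations that reorder factors give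
  a Horner word only up to congruence.\<close>

lemma scal_0 [simp]: "scal 0 = 0" and scal_1 [simp]: "scal 1 = 1"
  by (simp_all add: scal_def)

lemma scal_add: "scal (a + b) = scal a + scal b"
  by (simp add: scal_def single_add)

lemma scal_mult: "scal (a * b) = scal a * scal b"
  by (simp add: scal_def mult_single)

lemma poly_mapping_decomp: "f = (\<Sum>w \<in> Poly_Mapping.keys f. Poly_Mapping.single w (Poly_Mapping.lookup f w))"
  by (rule poly_mapping_eqI)
    (simp add: lookup_sum lookup_single when_def sum.delta not_in_keys_iff_lookup_eq_zero)

lemma scal_central: "scal c * f = f * scal c"
  by (subst (1 2) poly_mapping_decomp[of f])
    (simp add: sum_distrib_left sum_distrib_right scal_def mult_single mult.commute)

lemma prod_list_var: "prod_list (map var ws) = Poly_Mapping.single (FWord ws) 1"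
  by (induction ws) (simp_all add: var_def mult_single plus_fword_def flip: zero_fword_def)

lemma single_eq_scal_var:
  "Poly_Mapping.single w c = scal c * prod_list (map var (letters w))"
  by (simp add: prod_list_var scal_def mult_single)

text \<open>Every element is a finite sum of monomials, and a monomial is a scalar times a product
  of generators. Membership of both operands in the carrier is passed to the step cases, because
  \<open>window_idem_comm\<close> needs it to stay in the ideal.\<close>

lemma free_alg_induct [consumes 1, case_names scal var add mult]:
  fixes f :: "'g fword \<Rightarrow>\<^sub>0 'k::comm_ring_1"
  assumes f: "f \<in> carrier (free_alg G)"
    and scal: "\<And>c. P (scal c)" and var: "\<And>g. g \<in> G \<Longrightarrow> P (var g)"
    and add: "\<And>f g. \<lbrakk>f \<in> carrier (free_alg G); g \<in> carrier (free_alg G); P f; P g\<rbrakk> \<Longrightarrow> P (f + g)"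
    and mult: "\<And>f g. \<lbrakk>f \<in> carrier (free_alg G); g \<in> carrier (free_alg G); P f; P g\<rbrakk> \<Longrightarrow> P (f * g)"
  shows "P f"
proof -
  have words: "(prod_list (map var ws) :: 'g fword \<Rightarrow>\<^sub>0 'k) \<in> carrier (free_alg G) \<and> P (prod_list (map var ws))"
    if "set ws \<subseteq> G" for ws
    using that
  proof (induction ws)
    case Nil then show ?case using scal[of 1] by (simp add: fa_1)
  next
    case (Cons a ws) then show ?case using var[of a] mult[of "var a" "prod_list (map var ws)"]
      by (simp add: fa_mult fa_var)
  qed
  have single: "Poly_Mapping.single w c \<in> carrier (free_alg G) \<and> P (Poly_Mapping.single w c)"
    if "set (letters w) \<subseteq> G" for w c
    using words[OF that] by (auto simp: single_eq_scal_var intro!: fa_mult fa_scal mult scal)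
  have "sum (\<lambda>w. Poly_Mapping.single w (Poly_Mapping.lookup f w)) A \<in> carrier (free_alg G)
      \<and> P (sum (\<lambda>w. Poly_Mapping.single w (Poly_Mapping.lookup f w)) A)"
    if "finite A" "A \<subseteq> Poly_Mapping.keys f" for A
    using that
  proof (induction A rule: finite_induct)
    case empty then show ?case using scal[of 0] by (simp add: fa_0)
  next
    case (insert w A)
    moreover have "set (letters w) \<subseteq> G" using f insert by (auto simp: free_alg_simps(1))
    ultimately show ?case using single[of w "Poly_Mapping.lookup f w"]
      by (simp add: fa_add add)
  qed
  from this[OF finite_keys order.refl] show ?thesis
    using poly_mapping_decomp[of f] by simp
qed

section \<open>Substitution as a homomorphism of free algebras\<close>

text \<open>The key sets of \<open>f\<close>, \<open>g\<close> and \<open>f + g\<close> differ; over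
  a common finite superset additivity becomes a termwise statement.\<close>

lemma word_subst_superset:
  assumes "finite A" "Poly_Mapping.keys f \<subseteq> A"
  shows "word_subst \<phi> f = (\<Sum>w \<in> A. scal (Poly_Mapping.lookup f w) * prod_list (map \<phi> (letters w)))"
  unfolding word_subst_def
  by (rule sum.mono_neutral_left) (use assms in \<open>auto simp: not_in_keys_iff_lookup_eq_zero\<close>)

lemma word_subst_single: "word_subst \<phi> (Poly_Mapping.single w c) = scal c * prod_list (map \<phi> (letters w))"
  by (subst word_subst_superset[where A = "{w}"]) auto

lemma word_subst_add: "word_subst \<phi> (f + g) = word_subst \<phi> f + word_subst \<phi> g"
proof -
  let ?A = "Poly_Mapping.keys f \<union> Poly_Mapping.keys g"
  have "Poly_Mapping.keys (f + g) \<subseteq> ?A" by (rule keys_add)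
  then show ?thesis
    by (simp add: word_subst_superset[where A = ?A] lookup_add scal_add distrib_right sum.distrib)
qed

lemma word_subst_0 [simp]: "word_subst \<phi> 0 = 0"
  by (simp add: word_subst_def)

lemma word_subst_sum: "word_subst \<phi> (sum f A) = (\<Sum>a\<in>A. word_subst \<phi> (f a))"
  by (induction A rule: infinite_finite_induct) (simp_all add: word_subst_add)

lemma word_subst_minus: "word_subst \<phi> (- f) = - word_subst \<phi> f"
  using word_subst_add[of \<phi> f "- f"] by (simp add: eq_neg_iff_add_eq_0 add.commute)

lemma word_subst_diff: "word_subst \<phi> (f - g) = word_subst \<phi> f - word_subst \<phi> g"
  using word_subst_add[of \<phi> f "- g"] by (simp add: word_subst_minus)

text \<open>Concatenated words go to products, and the scalars can be collected in front because
  they are central.\<close>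

lemma word_subst_mult: "word_subst \<phi> (f * g) = word_subst \<phi> f * word_subst \<phi> g"
proof -
  have single: "word_subst \<phi> (Poly_Mapping.single v a * Poly_Mapping.single w b)
      = word_subst \<phi> (Poly_Mapping.single v a) * word_subst \<phi> (Poly_Mapping.single w b)" for v w a b
    by (simp add: mult_single word_subst_single plus_fword_def scal_mult mult.assoc)
       (metis mult.assoc scal_central)
  show ?thesis
    by (subst (1 2) poly_mapping_decomp[of f], subst (1 2) poly_mapping_decomp[of g])
      (simp add: sum_distrib_left sum_distrib_right word_subst_sum single)
qed

lemma word_subst_scal [simp]: "word_subst \<phi> (scal c) = scal c"
  by (subst (1) scal_def) (simp add: word_subst_single zero_fword_def)

lemma word_subst_1 [simp]: "word_subst \<phi> 1 = 1"
  using word_subst_scal[of \<phi> 1] by simp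

lemma word_subst_var [simp]: "word_subst \<phi> (var g) = \<phi> g"
  by (simp add: var_def word_subst_single)

lemma word_subst_power: "word_subst \<phi> (f ^ n) = word_subst \<phi> f ^ n"
  by (induction n) (simp_all add: word_subst_mult)

lemma word_subst_closed:
  assumes "f \<in> carrier (free_alg G)" "\<And>g. g \<in> G \<Longrightarrow> \<phi> g \<in> carrier (free_alg G')"
  shows "word_subst \<phi> f \<in> carrier (free_alg G')"
  using assms(1)
  by (induction rule: free_alg_induct)
    (simp_all add: word_subst_add word_subst_mult assms fa_add fa_mult fa_scal)

lemmas word_subst_hom = word_subst_add word_subst_diff word_subst_minus word_subst_mult
  word_subst_power word_subst_sum

lemma word_subst_eval2:
  "word_subst \<phi> (eval2 scal q a b) = eval2 scal q (word_subst \<phi> a) (word_subst \<phi> b)"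
  by (simp add: eval2_def split_def word_subst_hom)

lemma word_subst_dquot2:
  "word_subst \<phi> (dquot2 scal q a c b) = dquot2 scal q (word_subst \<phi> a) (word_subst \<phi> c) (word_subst \<phi> b)"
  by (simp add: dquot2_def split_def word_subst_hom)

lemma ideal_free_algI:
  fixes K :: "('g fword \<Rightarrow>\<^sub>0 'k::comm_ring_1) set"
  assumes sub: "K \<subseteq> carrier (free_alg G)" and zero: "0 \<in> K"
    and add: "\<And>a b. \<lbrakk>a \<in> K; b \<in> K\<rbrakk> \<Longrightarrow> a + b \<in> K"
    and mult: "\<And>a x. \<lbrakk>a \<in> K; x \<in> carrier (free_alg G)\<rbrakk> \<Longrightarrow> x * a \<in> K"
      "\<And>a x. \<lbrakk>a \<in> K; x \<in> carrier (free_alg G)\<rbrakk> \<Longrightarrow> a * x \<in> K"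
  shows "ideal K (free_alg G)"
proof (intro idealI ring_free_alg group.subgroupI abelian_group.a_group ring.is_abelian_group)
  fix a assume a: "a \<in> K"
  have "inv\<^bsub>add_monoid (free_alg G)\<^esub> a = - a"
  proof (rule group.inv_equality)
    show "Group.group (add_monoid (free_alg G))"
      by (intro abelian_group.a_group ring.is_abelian_group ring_free_alg)
  qed (use a sub in \<open>auto simp: free_alg_simps(3,4) fa_minus\<close>)
  \<comment> \<open>Closure under negation follows from closure under multiplication by -1.\<close>
  moreover have "- 1 * a \<in> K" using mult(1)[OF a, of "- 1"] by (simp add: fa_minus fa_1)
  ultimately show "inv\<^bsub>add_monoid (free_alg G)\<^esub> a \<in> K" by simp
qed (use assms in \<open>auto simp: free_alg_simps(2,3)\<close>)

section \<open>Congruence modulo an ideal of the free algebra\<close>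

text \<open>The ambient type is a ring in the sense of type classes, so identities between
  representatives are proved by \<open>algebra_simps\<close> and only membership in \<open>J\<close>
  remains to be argued. For this reason the polynomial part works with representatives and not with
  the record-based quotient rings.\<close>

locale free_alg_ideal =
  fixes G :: "'g set" and J :: "('g fword \<Rightarrow>\<^sub>0 'k::comm_ring_1) set"
  assumes ideal: "ideal J (free_alg G)"
begin

abbreviation S :: "('g fword \<Rightarrow>\<^sub>0 'k) set" where "S \<equiv> carrier (free_alg G)"

interpretation I: ideal J "free_alg G" by (rule ideal)

lemma J_carrier: "a \<in> J \<Longrightarrow> a \<in> S"
  using I.a_subset by auto

lemma J_0: "0 \<in> J" using additive_subgroup.zero_closed[OF I.additive_subgroup_axioms] by (simp only: free_alg_simps(4))

lemma J_add: "a \<in> J \<Longrightarrow> b \<in> J \<Longrightarrow> a + b \<in> J"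
  using additive_subgroup.a_closed[OF I.additive_subgroup_axioms, of a b] by (simp add: free_alg_simps(3))

lemma J_mult_left: "a \<in> J \<Longrightarrow> f \<in> S \<Longrightarrow> f * a \<in> J"
  using I.I_l_closed[of a f] by (simp add: free_alg_simps(2))

lemma J_mult_right: "a \<in> J \<Longrightarrow> f \<in> S \<Longrightarrow> a * f \<in> J"
  using I.I_r_closed[of a f] by (simp add: free_alg_simps(2))

lemma J_minus: "a \<in> J \<Longrightarrow> - a \<in> J"
  using J_mult_left[of a "- 1"] by (simp add: fa_minus fa_1)

lemma J_diff: "a \<in> J \<Longrightarrow> b \<in> J \<Longrightarrow> a - b \<in> J"
  using J_add[OF _ J_minus, of a b] by simp

lemma J_sum: "(\<And>x. x \<in> A \<Longrightarrow> f x \<in> J) \<Longrightarrow> sum f A \<in> J"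
  by (induction A rule: infinite_finite_induct) (auto intro: J_0 J_add)

definition cong :: "('g fword \<Rightarrow>\<^sub>0 'k) \<Rightarrow> ('g fword \<Rightarrow>\<^sub>0 'k) \<Rightarrow> bool" (infix "\<asymp>" 50) where
  "a \<asymp> b \<longleftrightarrow> a - b \<in> J"

lemma cong_refl [simp]: "a \<asymp> a" by (simp add: cong_def J_0)

lemma cong_sym: "a \<asymp> b \<Longrightarrow> b \<asymp> a"
  using J_minus[of "a - b"] by (simp add: cong_def)

lemma cong_trans [trans]: "a \<asymp> b \<Longrightarrow> b \<asymp> c \<Longrightarrow> a \<asymp> c"
  using J_add[of "a - b" "b - c"] by (simp add: cong_def)

lemma cong_0: "a \<asymp> 0 \<longleftrightarrow> a \<in> J" by (simp add: cong_def)

lemma cong_add: "a \<asymp> b \<Longrightarrow> c \<asymp> d \<Longrightarrow> a + c \<asymp> b + d"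
  using J_add[of "a - b" "c - d"] by (simp add: cong_def algebra_simps)

lemma cong_sum: "(\<And>x. x \<in> A \<Longrightarrow> f x \<asymp> g x) \<Longrightarrow> sum f A \<asymp> sum g A"
  unfolding cong_def by (simp flip: sum_subtractf add: J_sum)

lemma cong_mult_left: "a \<asymp> b \<Longrightarrow> f \<in> S \<Longrightarrow> f * a \<asymp> f * b"
  using J_mult_left[of "a - b" f] by (simp add: cong_def algebra_simps)

end


section \<open>Monic annihilators of \<open>x\<^bsub>k+1\<^esub>\<close>\<close>

text \<open>\<open>J\<close> may be larger than the ideal of relations. The instances are
  \<open>klr_ideal\<close>, which governs \<open>klr_diamond\<close>, and the preimage of
  \<open>cyc_ideal\<close> in the free algebra, where the vanishing is proved.\<close>

locale klr_congruence = free_alg_ideal "klr_gens \<delta>" J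
  for \<delta> :: "'i multiset" and J :: "('i, 'k::comm_ring_1) klr_word_alg set" +
  fixes Q :: "'i \<Rightarrow> 'i \<Rightarrow> 'k poly2"
  assumes rels: "klr_rels Q \<delta> \<subseteq> J"
begin

lemma x_S: "k \<in> {1..size \<delta>} \<Longrightarrow> xgen k \<in> S"
  and tau_S: "k \<in> {1..<size \<delta>} \<Longrightarrow> tau k \<in> S"
  and e_S: "\<nu> \<in> seqs \<delta> \<Longrightarrow> egen \<nu> \<in> S"
  by (auto intro!: fa_var simp: klr_gens_def)

lemma rel_idem_orth: "\<lbrakk>\<nu> \<in> seqs \<delta>; \<nu>' \<in> seqs \<delta>\<rbrakk> \<Longrightarrow>
    egen \<nu> * egen \<nu>' \<asymp> (if \<nu> = \<nu>' then egen \<nu> else 0)"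
  unfolding cong_def using rels klr_rels.idem_orth by blast

lemma rel_idem_sum: "(\<Sum>\<nu> \<in> seqs \<delta>. egen \<nu>) \<asymp> 1"
  unfolding cong_def using rels klr_rels.idem_sum by blast

lemma rel_x_idem: "\<lbrakk>k \<in> {1..size \<delta>}; \<nu> \<in> seqs \<delta>\<rbrakk> \<Longrightarrow> xgen k * egen \<nu> \<asymp> egen \<nu> * xgen k"
  unfolding cong_def using rels klr_rels.x_idem by blast

lemma rel_tau_idem: "\<lbrakk>k \<in> {1..<size \<delta>}; \<nu> \<in> seqs \<delta>\<rbrakk> \<Longrightarrow>
    tau k * egen \<nu> \<asymp> egen (swap_at k \<nu>) * tau k"
  unfolding cong_def using rels klr_rels.tau_idem by blast

lemma rel_x_comm: "\<lbrakk>k \<in> {1..size \<delta>}; l \<in> {1..size \<delta>}\<rbrakk> \<Longrightarrow> xgen k * xgen l \<asymp> xgen l * xgen k"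
  unfolding cong_def using rels klr_rels.x_comm by blast

lemma rel_tau_square: "\<lbrakk>k \<in> {1..<size \<delta>}; \<nu> \<in> seqs \<delta>\<rbrakk> \<Longrightarrow>
    tau k * tau k * egen \<nu> \<asymp>
      eval2 scal (Q (entry \<nu> k) (entry \<nu> (k + 1))) (xgen k) (xgen (k + 1)) * egen \<nu>"
  unfolding cong_def using rels klr_rels.tau_square by blast

lemma rel_tau_x: "\<lbrakk>k \<in> {1..<size \<delta>}; l \<in> {1..size \<delta>}; \<nu> \<in> seqs \<delta>\<rbrakk> \<Longrightarrow>
    (tau k * xgen l - xgen (if l = k then k + 1 else if l = k + 1 then k else l) * tau k) * egen \<nu> \<asymp>
      (if l = k + 1 \<and> entry \<nu> k = entry \<nu> (k + 1) then egen \<nu>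
       else if l = k \<and> entry \<nu> k = entry \<nu> (k + 1) then - egen \<nu> else 0)"
  unfolding cong_def using rels klr_rels.tau_x by blast

lemma rel_tau_comm: "\<lbrakk>k \<in> {1..<size \<delta>}; l \<in> {1..<size \<delta>}; \<bar>int k - int l\<bar> > 1\<rbrakk> \<Longrightarrow>
    tau k * tau l \<asymp> tau l * tau k"
  unfolding cong_def using rels klr_rels.tau_comm by blast

lemma rel_braid: "\<lbrakk>k \<in> {1..<size \<delta>}; k + 1 \<in> {1..<size \<delta>}; \<nu> \<in> seqs \<delta>\<rbrakk> \<Longrightarrow>
    (tau (k + 1) * tau k * tau (k + 1) - tau k * tau (k + 1) * tau k) * egen \<nu> \<asymp>
      (if entry \<nu> k = entry \<nu> (k + 2)
       then dquot2 scal (Q (entry \<nu> k) (entry \<nu> (k + 1))) (xgen (k + 2)) (xgen k) (xgen (k + 1)) * egen \<nu>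
       else 0)"
  unfolding cong_def using rels klr_rels.braid by blast

end

text \<open>\<open>pol k\<close> is the subalgebra generated by \<open>x\<^sub>1, \<dots>, x\<^sub>k\<close>; \<open>low k m\<close> and \<open>mon k m\<close> consist
  of the Horner forms \<open>x\<^bsub>k+1\<^esub> (\<dots> (x\<^bsub>k+1\<^esub> f + a) \<dots>) + b\<close> of the polynomials in \<open>x\<^bsub>k+1\<^esub>\<close> over
  \<open>pol k\<close> that are of degree less than \<open>m\<close>, respectively monic of degree \<open>m\<close>.\<close>

inductive_set pol :: "nat \<Rightarrow> ('i, 'k::comm_ring_1) klr_word_alg set" for k where
  pol_scal: "scal c \<in> pol k"
| pol_x: "l \<in> {1..k} \<Longrightarrow> xgen l \<in> pol k"
| pol_add: "\<lbrakk>f \<in> pol k; g \<in> pol k\<rbrakk> \<Longrightarrow> f + g \<in> pol k"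
| pol_mult: "\<lbrakk>f \<in> pol k; g \<in> pol k\<rbrakk> \<Longrightarrow> f * g \<in> pol k"

primrec low :: "nat \<Rightarrow> nat \<Rightarrow> ('i, 'k::comm_ring_1) klr_word_alg set" where
  "low k 0 = {0}"
| "low k (Suc m) = {xgen (k + 1) * f + a | f a. f \<in> low k m \<and> a \<in> pol k}"

primrec mon :: "nat \<Rightarrow> nat \<Rightarrow> ('i, 'k::comm_ring_1) klr_word_alg set" where
  "mon k 0 = {1}"
| "mon k (Suc m) = {xgen (k + 1) * f + a | f a. f \<in> mon k m \<and> a \<in> pol k}"

lemma pol_0: "0 \<in> pol k" and pol_1: "1 \<in> pol k"
  using pol_scal[of 0 k] pol_scal[of 1 k] by simp_all

lemma pol_power: "f \<in> pol k \<Longrightarrow> f ^ m \<in> pol k"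
  by (induction m) (auto intro: pol_1 pol_mult)

lemma pol_mono: assumes "k \<le> l" shows "pol k \<subseteq> pol l"
proof
  fix f :: "('i, 'k::comm_ring_1) klr_word_alg" assume "f \<in> pol k"
  then show "f \<in> pol l"
    by induction (use assms in \<open>auto intro: pol.intros\<close>)
qed

lemma low_pol: "f \<in> low k m \<Longrightarrow> f \<in> pol (Suc k)"
  by (induction m arbitrary: f)
    (use pol_mono[of k "Suc k"] in \<open>auto intro!: pol_0 pol_add pol_mult pol_x\<close>)

lemma mon_pol: "f \<in> mon k m \<Longrightarrow> f \<in> pol (Suc k)"
  by (induction m arbitrary: f)
    (use pol_mono[of k "Suc k"] in \<open>auto intro!: pol_1 pol_add pol_mult pol_x\<close>)

lemma low_SucI: "f \<in> low k m \<Longrightarrow> a \<in> pol k \<Longrightarrow> xgen (Suc k) * f + a \<in> low k (Suc m)"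
  by auto

lemma mon_SucI: "f \<in> mon k m \<Longrightarrow> a \<in> pol k \<Longrightarrow> xgen (Suc k) * f + a \<in> mon k (Suc m)"
  by auto

lemma low_zero: "0 \<in> low k m"
  using low_SucI[OF _ pol_0, of 0 k] by (induction m) auto

lemma low_step: "f \<in> low k m \<Longrightarrow> f \<in> low k (Suc m)"
proof (induction m arbitrary: f)
  case 0 then show ?case using low_zero[of k 1] by simp
next
  case (Suc m)
  then obtain g a where g: "f = xgen (Suc k) * g + a" "g \<in> low k m" "a \<in> pol k" by auto
  show ?case unfolding g(1) by (rule low_SucI[OF Suc.IH[OF g(2)] g(3)])
qed

lemma low_le: "m \<le> m' \<Longrightarrow> f \<in> low k m \<Longrightarrow> f \<in> low k m'"
  by (induction m' rule: dec_induct) (auto simp del: low.simps intro: low_step)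

lemma low_add: "f \<in> low k m \<Longrightarrow> g \<in> low k m \<Longrightarrow> f + g \<in> low k m"
proof (induction m arbitrary: f g)
  case (Suc m)
  then obtain f' a g' b where f: "f = xgen (Suc k) * f' + a" "f' \<in> low k m" "a \<in> pol k"
    and g: "g = xgen (Suc k) * g' + b" "g' \<in> low k m" "b \<in> pol k" by auto
  have "f + g = xgen (Suc k) * (f' + g') + (a + b)" by (simp add: f g algebra_simps)
  then show ?case using low_SucI[OF Suc.IH[OF f(2) g(2)] pol_add[OF f(3) g(3)]] by (simp only:)
qed auto

lemma mon_add_low: "f \<in> mon k m \<Longrightarrow> g \<in> low k m \<Longrightarrow> f + g \<in> mon k m"
proof (induction m arbitrary: f g)
  case (Suc m)
  then obtain f' a g' b where f: "f = xgen (Suc k) * f' + a" "f' \<in> mon k m" "a \<in> pol k"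
    and g: "g = xgen (Suc k) * g' + b" "g' \<in> low k m" "b \<in> pol k" by auto
  have "f + g = xgen (Suc k) * (f' + g') + (a + b)" by (simp add: f g algebra_simps)
  then show ?case using mon_SucI[OF Suc.IH[OF f(2) g(2)] pol_add[OF f(3) g(3)]] by (simp only:)
qed auto

lemma mon_low: "f \<in> mon k m \<Longrightarrow> f \<in> low k (Suc m)"
proof (induction m arbitrary: f)
  case 0 then show ?case using low_SucI[OF low_zero pol_1, of k 0] by simp
next
  case (Suc m)
  then obtain g a where g: "f = xgen (Suc k) * g + a" "g \<in> mon k m" "a \<in> pol k" by auto
  show ?case unfolding g(1) by (rule low_SucI[OF Suc.IH[OF g(2)] g(3)])
qed

lemma mon_power_mult: "f \<in> mon k m \<Longrightarrow> xgen (Suc k) ^ b * f \<in> mon k (m + b)"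
proof (induction b)
  case (Suc b)
  then show ?case using mon_SucI[OF _ pol_0, of "xgen (Suc k) ^ b * f" k "m + b"] by (simp add: mult.assoc)
qed simp

text \<open>Horner forms carry their coefficients on the right; this fixes the order of the
  factors.\<close>

lemma low_power_mult: "a \<in> pol k \<Longrightarrow> xgen (Suc k) ^ b * a \<in> low k (Suc b)"
proof (induction b)
  case 0 then show ?case using low_SucI[OF low_zero, of a k 0] by simp
next
  case (Suc b)
  then show ?case using low_SucI[OF _ pol_0, of "xgen (Suc k) ^ b * a" k "Suc b"] by (simp add: mult.assoc)
qed

lemma eval2_superset:
  assumes "finite A" "Poly_Mapping.keys q \<subseteq> A"
  shows "eval2 scal q a b = (\<Sum>(s, t) \<in> A. scal (Poly_Mapping.lookup q (s, t)) * a ^ s * b ^ t)"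
  unfolding eval2_def
  by (rule sum.mono_neutral_left) (use assms in \<open>auto simp: not_in_keys_iff_lookup_eq_zero\<close>)

lemma eval2_single: "eval2 scal (Poly_Mapping.single (s, t) c) a b = scal c * a ^ s * b ^ t"
  by (subst eval2_superset[where A = "{(s, t)}"]) auto

lemma eval2_add: "eval2 scal (p + q) a b = eval2 scal p a b + eval2 scal q a b"
proof -
  let ?A = "Poly_Mapping.keys p \<union> Poly_Mapping.keys q"
  have "Poly_Mapping.keys (p + q) \<subseteq> ?A" by (rule keys_add)
  then show ?thesis
    by (simp add: eval2_superset[where A = ?A] lookup_add scal_add distrib_right sum.distrib split_def)
qed

lemma eval2_pol: "a \<in> pol k \<Longrightarrow> b \<in> pol k \<Longrightarrow> eval2 scal q a b \<in> pol k"
proof -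
  assume ab: "a \<in> pol k" "b \<in> pol k"
  have *: "sum f A \<in> pol k" if "\<And>x. x \<in> A \<Longrightarrow> f x \<in> pol k" for A and f :: "nat \<times> nat \<Rightarrow> ('a, 'b) klr_word_alg"
    using that by (induction A rule: infinite_finite_induct) (auto intro: pol_0 pol_add)
  then show ?thesis unfolding eval2_def
    using ab by (intro *) (auto intro!: pol_mult pol_scal pol_power)
qed

section \<open>Moving polynomials past variables, idempotents and distant crossings\<close>

context klr_congruence
begin

lemma pol_S: "f \<in> pol k \<Longrightarrow> k \<le> size \<delta> \<Longrightarrow> f \<in> S"
  by (induction rule: pol.induct) (auto intro: fa_scal x_S fa_add fa_mult)

lemma pol_comm_x:
  assumes "k \<le> size \<delta>" "l \<in> {1..size \<delta>}" "f \<in> pol k"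
  shows "f * xgen l \<asymp> xgen l * f"
  using assms(3)
proof induction
  case (pol_scal c) then show ?case by (simp add: scal_central)
next
  case (pol_x j) then show ?case using assms by (intro rel_x_comm) auto
next
  case (pol_add f g)
  then show ?case using cong_add[of "f * xgen l" "xgen l * f" "g * xgen l" "xgen l * g"]
    by (simp add: algebra_simps)
next
  case (pol_mult f g)
  have "f * g * xgen l - xgen l * (f * g) = f * (g * xgen l - xgen l * g) + (f * xgen l - xgen l * f) * g"
    by (simp add: algebra_simps)
  moreover have "f \<in> S" "g \<in> S" using pol_S pol_mult assms(1) by auto
  ultimately show ?case using pol_mult(3,4) unfolding cong_def
    by (auto intro: J_add J_mult_left J_mult_right)
qed

lemma pol_comm:
  assumes "k \<le> size \<delta>" "f \<in> pol k" "g \<in> pol k"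
  shows "f * g \<asymp> g * f"
  using assms(3)
proof induction
  case (pol_scal c) then show ?case by (simp add: scal_central)
next
  case (pol_x j) then show ?case using assms by (intro pol_comm_x) auto
next
  case (pol_add g h)
  then show ?case using cong_add[of "f * g" "g * f" "f * h" "h * f"]
    by (simp add: algebra_simps)
next
  case (pol_mult g h)
  have "f * (g * h) - g * h * f = (f * g - g * f) * h + g * (f * h - h * f)"
    by (simp add: algebra_simps)
  moreover have "g \<in> S" "h \<in> S" using pol_S pol_mult assms(1) by auto
  ultimately show ?case using pol_mult(3,4) unfolding cong_def
    by (auto intro: J_add J_mult_left J_mult_right)
qed

lemma pol_idem:
  assumes "k \<le> size \<delta>" "\<nu> \<in> seqs \<delta>" "f \<in> pol k"
  shows "f * egen \<nu> \<asymp> egen \<nu> * f"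
  using assms(3)
proof induction
  case (pol_scal c) then show ?case by (simp add: scal_central)
next
  case (pol_x j) then show ?case using assms by (intro rel_x_idem) auto
next
  case (pol_add f g)
  then show ?case using cong_add[of "f * egen \<nu>" "egen \<nu> * f" "g * egen \<nu>" "egen \<nu> * g"]
    by (simp add: algebra_simps)
next
  case (pol_mult f g)
  have "f * g * egen \<nu> - egen \<nu> * (f * g) = f * (g * egen \<nu> - egen \<nu> * g) + (f * egen \<nu> - egen \<nu> * f) * g"
    by (simp add: algebra_simps)
  moreover have "f \<in> S" "g \<in> S" using pol_S pol_mult assms(1) by auto
  ultimately show ?case using pol_mult(3,4) unfolding cong_def
    by (auto intro: J_add J_mult_left J_mult_right)
qed

lemma pol_tau:
  assumes "k < r" "r \<in> {1..<size \<delta>}" "\<nu> \<in> seqs \<delta>" "f \<in> pol k"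
  shows "tau r * f * egen \<nu> \<asymp> f * tau r * egen \<nu>"
  using assms(4)
proof induction
  case (pol_scal c) then show ?case by (simp add: scal_central)
next
  case (pol_x j)
  then show ?case using assms rel_tau_x[of r j \<nu>]
    by (auto simp: cong_def algebra_simps split: if_splits)
next
  case (pol_add f g)
  then show ?case using cong_add[of "tau r * f * egen \<nu>" "f * tau r * egen \<nu>" "tau r * g * egen \<nu>" "g * tau r * egen \<nu>"]
    by (simp add: algebra_simps)
next
  case (pol_mult f g)
  \<comment> \<open>The relation between \<open>tau r\<close> and a variable holds only in front of
    an idempotent. So the idempotent is moved to the left of \<open>g\<close> for the step with
    \<open>f\<close>, and back again for the step with \<open>g\<close>.\<close>
  have "tau r * (f * g) * egen \<nu> - f * g * tau r * egen \<nu>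
    = tau r * f * (g * egen \<nu> - egen \<nu> * g) + (tau r * f * egen \<nu> - f * tau r * egen \<nu>) * g
     - f * tau r * (g * egen \<nu> - egen \<nu> * g) + f * (tau r * g * egen \<nu> - g * tau r * egen \<nu>)"
    by (simp add: algebra_simps)
  moreover have "g * egen \<nu> - egen \<nu> * g \<in> J"
    using pol_idem[of k \<nu> g] pol_mult assms by (simp add: cong_def)
  moreover have "f \<in> S" "g \<in> S" "tau r \<in> S" using pol_S[of _ k] pol_mult assms tau_S[OF assms(2)] by auto
  ultimately show ?case using pol_mult(3,4) unfolding cong_def
    by (simp only: J_add J_diff J_mult_left J_mult_right fa_mult)
qed

text \<open>A coefficient multiplied from the left has to be moved past every
  \<open>x_{k+1}\<close>, so the result is a Horner form only up to \<open>J\<close>.\<close>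

lemma low_smult:
  assumes "k < size \<delta>" "c \<in> pol k" "f \<in> low k m"
  shows "\<exists>g \<in> low k m. c * f \<asymp> g"
  using assms(3)
proof (induction m arbitrary: f)
  case 0 then show ?case by simp
next
  case (Suc m)
  then obtain f' a where f: "f = xgen (Suc k) * f' + a" "f' \<in> low k m" "a \<in> pol k" by auto
  obtain g where g: "g \<in> low k m" "c * f' \<asymp> g" using Suc.IH[OF f(2)] by auto
  have S: "f' \<in> S" "c \<in> S" "xgen (Suc k) \<in> S"
    using pol_S[OF low_pol[OF f(2)]] pol_S[OF assms(2)] x_S[of "Suc k"] assms(1) by auto
  have cx: "c * xgen (Suc k) \<asymp> xgen (Suc k) * c"
    using pol_comm_x[of k "Suc k" c] assms by auto
  have "c * f - (xgen (Suc k) * g + c * a)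
      = (c * xgen (Suc k) - xgen (Suc k) * c) * f' + xgen (Suc k) * (c * f' - g)"
    unfolding f(1) by (simp add: algebra_simps)
  then have "c * f \<asymp> xgen (Suc k) * g + c * a"
    using cx g(2) S unfolding cong_def by (auto intro: J_add J_mult_left J_mult_right)
  then show ?case using low_SucI[OF g(1) pol_mult[OF assms(2) f(3)]] by blast
qed

text \<open>The bounds in \<open>low\<close> are strict: \<open>p\<close> has degree at most a,
  \<open>q\<close> less than b, the product less than a + b. The recursion runs over the Horner form
  of the left factor, so that only its coefficients, by \<open>low_smult\<close>, have to be
  moved.\<close>

lemma low_mult:
  assumes "k < size \<delta>" "p \<in> low k (Suc a)" "q \<in> low k b"
  shows "\<exists>g \<in> low k (a + b). q * p \<asymp> g"
  using assms(3)
proof (induction b arbitrary: q)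
  case 0 then show ?case by (auto intro!: bexI[OF _ low_zero])
next
  case (Suc b)
  then obtain q' c where q: "q = xgen (Suc k) * q' + c" "q' \<in> low k b" "c \<in> pol k" by auto
  obtain g where g: "g \<in> low k (a + b)" "q' * p \<asymp> g" using Suc.IH[OF q(2)] by auto
  obtain h where h: "h \<in> low k (Suc a)" "c * p \<asymp> h" using low_smult[OF assms(1) q(3) assms(2)] by auto
  have "xgen (Suc k) * g + 0 \<in> low k (Suc (a + b))" by (rule low_SucI[OF g(1) pol_0])
  moreover have "h \<in> low k (Suc (a + b))" using low_le[OF _ h(1), of "Suc (a + b)"] by simp
  ultimately have "xgen (Suc k) * g + h \<in> low k (a + Suc b)"
    using low_add[of "xgen (Suc k) * g"] by (simp del: low.simps)
  moreover have "q * p \<asymp> xgen (Suc k) * g + h"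
    using cong_add[OF cong_mult_left[OF g(2), of "xgen (Suc k)"] h(2)] x_S[of "Suc k"] assms(1)
    by (simp add: q(1) algebra_simps)
  ultimately show ?case by blast
qed

lemma low_sum:
  assumes "\<And>x. x \<in> A \<Longrightarrow> \<exists>g \<in> low k m. f x \<asymp> g"
  shows "\<exists>g \<in> low k m. sum f A \<asymp> g"
  using assms
proof (induction A rule: infinite_finite_induct)
  case (insert x A)
  then obtain g h where "g \<in> low k m" "f x \<asymp> g" "h \<in> low k m" "sum f A \<asymp> h" by (meson insertI1 insertI2)
  then have "g + h \<in> low k m" "sum f (insert x A) \<asymp> g + h"
    using insert.hyps by (auto intro: low_add cong_add)
  then show ?case by blast
qed (auto intro!: bexI[OF _ low_zero])

section \<open>Moving a monic polynomial through an adjacent crossing\<close>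

text \<open>With different letters at the positions k + 1 and k + 2 the crossing exchanges the two
  variables without correction term, and it commutes with the coefficients, which involve only
  \<open>x_1, ..., x_k\<close>. So \<open>p'\<close> is \<open>p\<close> with \<open>x_{k+2}\<close>
  in place of \<open>x_{k+1}\<close>, the same for all words.\<close>

lemma tau_transport_distinct:
  assumes k: "k + 2 \<le> size \<delta>" and p: "p \<in> mon k m"
  shows "\<exists>p' \<in> mon (Suc k) m. \<forall>\<nu> \<in> seqs \<delta>. entry \<nu> (k + 1) \<noteq> entry \<nu> (k + 2) \<longrightarrow>
    tau (k + 1) * p * egen \<nu> \<asymp> p' * tau (k + 1) * egen \<nu>"
  using p
proof (induction m arbitrary: p)
  case 0 then show ?case by simp
next
  case (Suc m)
  then obtain f a where p: "p = xgen (Suc k) * f + a" "f \<in> mon k m" "a \<in> pol k" by auto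
  obtain f' where f': "f' \<in> mon (Suc k) m" and IH: "\<And>\<nu>. \<nu> \<in> seqs \<delta> \<Longrightarrow> entry \<nu> (k + 1) \<noteq> entry \<nu> (k + 2)
      \<Longrightarrow> tau (k + 1) * f * egen \<nu> \<asymp> f' * tau (k + 1) * egen \<nu>"
    using Suc.IH[OF p(2)] by auto
  define s x y :: "('i, 'k) klr_word_alg" where "s = tau (k + 1)" and "x = xgen (k + 1)" and "y = xgen (k + 2)"
  have S: "s \<in> S" "x \<in> S" "y \<in> S" "f \<in> S" "a \<in> S"
    using tau_S[of "k + 1"] x_S[of "k + 1"] x_S[of "k + 2"] k pol_S[OF mon_pol[OF p(2)]] pol_S[OF p(3)]
    by (auto simp: s_def x_def y_def)
  have "s * p * egen \<nu> \<asymp> (y * f' + a) * s * egen \<nu>"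
    if \<nu>: "\<nu> \<in> seqs \<delta>" "entry \<nu> (k + 1) \<noteq> entry \<nu> (k + 2)" for \<nu>
  proof -
    define e :: "('i, 'k) klr_word_alg" where "e = egen \<nu>"
    have fe: "f * e - e * f \<in> J"
      using pol_idem[OF _ \<nu>(1) mon_pol[OF p(2)]] k by (simp add: cong_def e_def)
    have sx: "s * x * e - y * s * e \<in> J"
      using rel_tau_x[of "k + 1" "k + 1" \<nu>] k \<nu> by (simp add: cong_def s_def x_def y_def e_def algebra_simps)
    have sa: "s * a * e - a * s * e \<in> J"
      using pol_tau[OF _ _ \<nu>(1) p(3), of "k + 1"] k by (simp add: cong_def s_def e_def)
    have "s * f * e - f' * s * e \<in> J" using IH[OF \<nu>] by (simp add: cong_def s_def e_def)
    moreover have "s * p * e - (y * f' + a) * s * e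
       = s * x * (f * e - e * f) + (s * x * e - y * s * e) * f - y * s * (f * e - e * f)
         + y * (s * f * e - f' * s * e) + (s * a * e - a * s * e)"
      unfolding p(1) by (simp add: x_def algebra_simps)
    ultimately have "s * p * e - (y * f' + a) * s * e \<in> J"
      using fe sx sa S by (simp only: J_add J_diff J_mult_left J_mult_right fa_mult)
    then show ?thesis by (simp add: cong_def e_def)
  qed
  moreover have "y * f' + a \<in> mon (Suc k) (Suc m)"
    using mon_SucI[OF f', of a] p(3) pol_mono[of k "Suc k"] by (auto simp: y_def simp del: mon.simps)
  ultimately show ?case unfolding s_def by blast
qed

text \<open>Here \<open>p'\<close> is \<open>p\<close> with \<open>y = x\<^bsub>k+2\<^esub>\<close> in place of \<open>x = x\<^bsub>k+1\<^esub>\<close>, and \<open>D = (p - p') / (x - y)\<close>. The recursion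
  \<open>D(x f + a) = y D(f) + f\<close> is again of Horner form, with \<open>f\<close> as a coefficient in \<open>K[x\<^sub>1, \<dots>, x\<^bsub>k+1\<^esub>]\<close>.\<close>

lemma tau_transport_equal:
  assumes k: "k + 2 \<le> size \<delta>" and p: "p \<in> mon k m"
  shows "\<exists>p' \<in> mon (Suc k) m. \<exists>D. D \<in> (if m = 0 then {0} else mon (Suc k) (m - 1)) \<and>
    (xgen (k + 1) - xgen (k + 2)) * D \<asymp> p - p' \<and>
    (\<forall>\<nu> \<in> seqs \<delta>. entry \<nu> (k + 1) = entry \<nu> (k + 2) \<longrightarrow>
      tau (k + 1) * p * egen \<nu> \<asymp> p' * tau (k + 1) * egen \<nu> - D * egen \<nu>)"
  using p
proof (induction m arbitrary: p)
  case 0 then show ?case by simp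
next
  case (Suc m)
  then obtain f a where p: "p = xgen (Suc k) * f + a" "f \<in> mon k m" "a \<in> pol k" by auto
  obtain f' D where f': "f' \<in> mon (Suc k) m" and D: "D \<in> (if m = 0 then {0} else mon (Suc k) (m - 1))"
    and dq: "(xgen (k + 1) - xgen (k + 2)) * D \<asymp> f - f'"
    and IH: "\<And>\<nu>. \<nu> \<in> seqs \<delta> \<Longrightarrow> entry \<nu> (k + 1) = entry \<nu> (k + 2)
      \<Longrightarrow> tau (k + 1) * f * egen \<nu> \<asymp> f' * tau (k + 1) * egen \<nu> - D * egen \<nu>"
    using Suc.IH[OF p(2)] by auto
  define s x y :: "('i, 'k) klr_word_alg" where "s = tau (k + 1)" and "x = xgen (k + 1)" and "y = xgen (k + 2)"
  have "D \<in> pol (Suc (Suc k))" using D mon_pol[of D "Suc k" "m - 1"] by (auto intro: pol_0 split: if_splits)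
  then have "D \<in> S" using k by (auto intro: pol_S)
  then have S: "s \<in> S" "x \<in> S" "y \<in> S" "f \<in> S" "a \<in> S" "D \<in> S"
    using tau_S[of "k + 1"] x_S[of "k + 1"] x_S[of "k + 2"] k pol_S[OF mon_pol[OF p(2)]] pol_S[OF p(3)]
    by (auto simp: s_def x_def y_def)
  \<comment> \<open>The correction term \<open>- e\<close> of the crossing relation, multiplied by
    \<open>f\<close>, accounts for the summand \<open>f\<close> of the new quotient.\<close>
  have "s * p * egen \<nu> \<asymp> (y * f' + a) * s * egen \<nu> - (y * D + f) * egen \<nu>"
    if \<nu>: "\<nu> \<in> seqs \<delta>" "entry \<nu> (k + 1) = entry \<nu> (k + 2)" for \<nu>
  proof -
    define e :: "('i, 'k) klr_word_alg" where "e = egen \<nu>"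
    have fe: "f * e - e * f \<in> J"
      using pol_idem[OF _ \<nu>(1) mon_pol[OF p(2)]] k by (simp add: cong_def e_def)
    have sx: "s * x * e - (y * s * e - e) \<in> J"
      using rel_tau_x[of "k + 1" "k + 1" \<nu>] k \<nu> by (simp add: cong_def s_def x_def y_def e_def algebra_simps)
    have sa: "s * a * e - a * s * e \<in> J"
      using pol_tau[OF _ _ \<nu>(1) p(3), of "k + 1"] k by (simp add: cong_def s_def e_def)
    have "s * f * e - (f' * s * e - D * e) \<in> J" using IH[OF \<nu>] by (simp add: cong_def s_def e_def)
    moreover have "s * p * e - ((y * f' + a) * s * e - (y * D + f) * e)
       = s * x * (f * e - e * f) + (s * x * e - (y * s * e - e)) * f - y * s * (f * e - e * f)
         + y * (s * f * e - (f' * s * e - D * e)) + (f * e - e * f) + (s * a * e - a * s * e)"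
      unfolding p(1) by (simp add: x_def algebra_simps)
    ultimately have "s * p * e - ((y * f' + a) * s * e - (y * D + f) * e) \<in> J"
      using fe sx sa S by (simp only: J_add J_diff J_mult_left J_mult_right fa_mult)
    then show ?thesis by (simp add: cong_def e_def)
  qed
  moreover have "y * f' + a \<in> mon (Suc k) (Suc m)"
    using mon_SucI[OF f', of a] p(3) pol_mono[of k "Suc k"] by (auto simp: y_def simp del: mon.simps)
  moreover have "y * D + f \<in> mon (Suc k) m"
  proof (cases m)
    \<comment> \<open>Here \<open>D = 0\<close> and \<open>f = 1\<close>, so the summand
      \<open>f\<close> supplies the leading coefficient; in higher degree it is inherited from
      \<open>D\<close>.\<close>
    case 0 then show ?thesis using D p(2) by simp
  next
    case (Suc m')
    then show ?thesis using D mon_SucI[of D "Suc k" m' f] mon_pol[OF p(2)]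
      by (simp add: y_def del: mon.simps)
  qed
  moreover have "(x - y) * (y * D + f) \<asymp> p - (y * f' + a)"
  proof -
    have xy: "x * y - y * x \<in> J"
      using rel_x_comm[of "k + 1" "k + 2"] k by (simp add: cong_def x_def y_def)
    have "(x - y) * (y * D + f) - (p - (y * f' + a)) = (x * y - y * x) * D + y * ((x - y) * D - (f - f'))"
      unfolding p(1) by (simp add: x_def algebra_simps)
    then show ?thesis using xy dq S unfolding cong_def x_def[symmetric] y_def[symmetric]
      by (simp only: J_add J_mult_left J_mult_right)
  qed
  ultimately show ?case unfolding s_def x_def y_def by auto
qed

end

section \<open>Vanishing of the idempotents\<close>

text \<open>The degree of the polynomial in \<open>monic_annihilator\<close>, for a letter
  \<open>i\<close> standing to the left of the word. The head of the list is the leftmost letter,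
  hence the last one to be passed. The truncated subtraction is meant: in degree 0 the idempotent
  itself lies in the ideal, and passing a further \<open>i\<close> keeps it there.\<close>

primrec annihilator_degree :: "('i \<Rightarrow> 'i \<Rightarrow> int) \<Rightarrow> 'i \<Rightarrow> 'i list \<Rightarrow> nat" where
  "annihilator_degree ip i [] = 0"
| "annihilator_degree ip i (j # \<nu>) = (if j = i then annihilator_degree ip i \<nu> - 1
     else annihilator_degree ip i \<nu> + nat (- cartan ip i j))"

lemma entry_append: "length \<nu> = k \<Longrightarrow> entry (\<mu> @ i # j # \<nu>) (k + 1) = j"
  "length \<nu> = k \<Longrightarrow> entry (\<mu> @ i # j # \<nu>) (k + 2) = i"
  by (auto simp: entry_def nth_append)

lemma swap_at_append: "length \<nu> = k \<Longrightarrow> swap_at (k + 1) (\<mu> @ i # j # \<nu>) = \<mu> @ j # i # \<nu>"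
  using entry_append[of \<nu> k \<mu> i j]
  by (simp add: swap_at_def list_update_append)

locale klr_vanishing = klr_congruence \<delta> J Q + klr_datum ip t Q
  for \<delta> :: "'i multiset" and J :: "('i, 'k::comm_ring_1) klr_word_alg set"
    and Q :: "'i \<Rightarrow> 'i \<Rightarrow> 'k poly2" and ip t +
  fixes i :: 'i
  assumes last_in_J: "\<mu> @ [i] \<in> seqs \<delta> \<Longrightarrow> egen (\<mu> @ [i]) \<in> J"
begin

text \<open>As a polynomial in its second argument \<open>Q j i\<close> has leading coefficient
  \<open>t i j\<close> in degree \<open>- c_{i,j}\<close>, or is an invertible constant if
  \<open>c_{i,j} = 0\<close>; \<open>u\<close> is the inverse of that coefficient. Mixed terms have
  smaller degree in the second argument, because by homogeneity the first one uses up part of the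
  weight.\<close>

lemma Q_leading:
  assumes "i \<noteq> j" and k: "k < size \<delta>" and x: "x \<in> pol k"
  shows "\<exists>u. \<exists>q \<in> low k (nat (- cartan ip i j)).
    scal u * eval2 scal (Q j i) x (xgen (Suc k)) \<asymp> xgen (Suc k) ^ nat (- cartan ip i j) + q"
proof (cases "cartan ip i j = 0")
  case True
  \<comment> \<open>The conditions on \<open>Q j i\<close> are governed by
    \<open>cartan ip j i\<close>; its vanishing here, and its sign in the other case, follow from
    the symmetry of the form.\<close>
  have "ip i j = 0" using cartan_integral[of i j] True ip_pos[of i] by (auto simp: cartan_def dvd_div_eq_0_iff)
  then have "cartan ip j i = 0" by (simp add: cartan_def ip_sym[of j i])
  then obtain c where c: "c dvd 1" "Q j i = Poly_Mapping.single (0, 0) c"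
    using Q_zero[of j i] assms(1) by auto
  obtain u where "1 = c * u" using c(1) by (elim dvdE)
  then have "scal u * eval2 scal (Q j i) x (xgen (Suc k)) = 1"
    by (simp add: c(2) eval2_single mult.commute flip: scal_mult)
  then show ?thesis using True by (intro exI[of _ u]) simp
next
  case False
  then have neg: "cartan ip i j < 0" using cartan_nonpos[OF assms(1)] by simp
  have ip_cartan: "2 * ip i j = ip i i * cartan ip i j" using cartan_integral[of i j] by (simp add: cartan_def)
  have "ip i j < 0" using ip_cartan neg ip_pos[of i] by (smt (verit) mult_pos_neg)
  moreover have "2 * ip j i = ip j j * cartan ip j i" using cartan_integral[of j i] by (simp add: cartan_def)
  ultimately have neg': "cartan ip j i < 0" using ip_pos[of j] ip_sym[of i j] by (smt (verit) mult_nonneg_nonneg)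
  define b where "b = nat (- cartan ip i j)"
  define a where "a = nat (- cartan ip j i)"
  obtain R where R: "Q j i = Poly_Mapping.single (a, 0) (t j i) + Poly_Mapping.single (0, b) (t i j) + R"
    and keys: "Poly_Mapping.keys R \<subseteq> {(a, b). 0 < a \<and> 0 < b
            \<and> (ip j j div 2) * int a + (ip i i div 2) * int b = - ip j i}"
    using Q_neg[OF assms(1)[symmetric] neg'] unfolding a_def b_def by auto
  obtain u where u: "1 = t i j * u" using t_unit[OF assms(1) neg] by (elim dvdE)
  \<comment> \<open>In \<open>d_j l + d_i m = - j . i\<close> the exponent l is positive, and the
    right-hand side equals \<open>d_i b\<close>.\<close>
  have small: "m < b" if "(l, m) \<in> Poly_Mapping.keys R" for l m
  proof -
    have lm: "0 < l" "(ip j j div 2) * int l + (ip i i div 2) * int m = - ip j i" using keys that by auto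
    have "ip j j div 2 > 0" using ip_pos[of j] ip_even[of j] by presburger
    then have "(ip j j div 2) * int l > 0" using lm(1) by simp
    then have "(ip i i div 2) * int m < - ip i j" using lm(2) ip_sym[of i j] by linarith
    also have "- ip i j = (ip i i div 2) * (- cartan ip i j)"
    proof -
      have "ip i i = 2 * (ip i i div 2)" using ip_even[of i] by simp
      then have "2 * ip i j = 2 * ((ip i i div 2) * cartan ip i j)" using ip_cartan by (metis mult.assoc)
      then show ?thesis by simp
    qed
    finally have "(ip i i div 2) * int m < (ip i i div 2) * (- cartan ip i j)" .
    moreover have "0 < ip i i div 2" using ip_pos[of i] ip_even[of i] by presburger
    ultimately have "int m < - cartan ip i j" by (simp only: mult_less_cancel_left_pos)
    then show ?thesis by (simp add: b_def)
  qed
  have monomial: "\<exists>g \<in> low k b. c * xgen (Suc k) ^ m \<asymp> g" if "m < b" "c \<in> pol k" for m c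
  proof (intro bexI)
    show "xgen (Suc k) ^ m * c \<in> low k b"
      using low_le[OF _ low_power_mult[OF that(2), of m], of b] that(1) by (simp del: low.simps)
    have "c \<in> pol (Suc k)" using pol_mono[of k "Suc k"] that(2) by auto
    moreover have "xgen (Suc k) ^ m \<in> pol (Suc k)" by (intro pol_power pol_x) simp
    ultimately show "c * xgen (Suc k) ^ m \<asymp> xgen (Suc k) ^ m * c"
      using k by (intro pol_comm[of "Suc k"]) auto
  qed
  have "\<exists>g \<in> low k b. eval2 scal R x (xgen (Suc k)) \<asymp> g"
    unfolding eval2_def
    by (rule low_sum) (auto intro!: monomial small pol_mult pol_scal pol_power x)
  then obtain g where g: "g \<in> low k b" "eval2 scal R x (xgen (Suc k)) \<asymp> g" by auto
  \<comment> \<open>The pure power of the first argument has degree 0 in \<open>x_{k+1}\<close>; it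
    is of lower order because b is positive in this case.\<close>
  have "\<exists>h \<in> low k b. scal (t j i) * x ^ a * xgen (Suc k) ^ 0 \<asymp> h"
    using neg by (intro monomial pol_mult pol_scal pol_power x) (simp add: b_def)
  then obtain h where h: "h \<in> low k b" "scal (t j i) * x ^ a \<asymp> h" by auto
  obtain q where q: "q \<in> low k b" "scal u * (g + h) \<asymp> q"
    using low_smult[OF k pol_scal low_add[OF g(1) h(1)]] by blast
  have ut: "scal u * scal (t i j) = 1" using u by (simp add: mult.commute flip: scal_mult)
  have "scal u * eval2 scal (Q j i) x (xgen (Suc k))
     = scal u * scal (t i j) * xgen (Suc k) ^ b + scal u * (eval2 scal R x (xgen (Suc k)) + scal (t j i) * x ^ a)"
    by (simp add: R eval2_add eval2_single algebra_simps)
  also have "\<dots> \<asymp> xgen (Suc k) ^ b + q"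
    unfolding ut using cong_add[OF cong_refl cong_trans[OF cong_mult_left[OF cong_add[OF g(2) h(2)] fa_scal] q(2)]]
    by simp
  finally show ?thesis using q(1) unfolding b_def by blast
qed

text \<open>The polynomial is chosen before \<mu>, and the induction depends on it: a crossing takes
  \<open>\<mu> @ i # j # \<nu>\<close> to \<open>\<mu> @ j # i # \<nu>\<close>, to which the
  hypothesis for \<nu> applies with the longer prefix \<open>\<mu> @ [j]\<close>.\<close>

lemma monic_annihilator:
  "length \<nu> < size \<delta> \<Longrightarrow> \<exists>p \<in> mon (length \<nu>) (annihilator_degree ip i \<nu>).
     \<forall>\<mu>. \<mu> @ i # \<nu> \<in> seqs \<delta> \<longrightarrow> p * egen (\<mu> @ i # \<nu>) \<in> J"
proof (induction \<nu>)
  case Nil then show ?case using last_in_J by simp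
next
  case (Cons j \<nu>)
  define k m where "k = length \<nu>" and "m = annihilator_degree ip i \<nu>"
  have k: "k + 2 \<le> size \<delta>" using Cons.prems by (simp add: k_def)
  obtain p where p: "p \<in> mon k m" and pJ: "\<And>\<mu>. \<mu> @ i # \<nu> \<in> seqs \<delta> \<Longrightarrow> p * egen (\<mu> @ i # \<nu>) \<in> J"
    using Cons unfolding k_def m_def by auto
  define s x y :: "('i, 'k) klr_word_alg" where "s = tau (k + 1)" and "x = xgen (k + 1)" and "y = xgen (k + 2)"
  have S: "s \<in> S" "x \<in> S" "y \<in> S" "p \<in> S"
    using tau_S[of "k + 1"] x_S[of "k + 1"] x_S[of "k + 2"] k pol_S[OF mon_pol[OF p]]
    by (auto simp: s_def x_def y_def)
  show ?case
  proof (cases "j = i")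
    case True
    show ?thesis
    proof (cases m)
      case 0
      \<comment> \<open>The polynomial is 1, so the hypothesis for the prefix
        \<open>\<mu> @ [i]\<close> is already the claim.\<close>
      then show ?thesis using True p pJ[of "_ @ [i]"] by (simp add: m_def)
    next
      case (Suc m')
      obtain p' D where p': "p' \<in> mon (Suc k) m" and D: "D \<in> mon (Suc k) m'"
        and dq: "(x - y) * D - (p - p') \<in> J"
        and tr: "\<And>\<nu>. \<nu> \<in> seqs \<delta> \<Longrightarrow> entry \<nu> (k + 1) = entry \<nu> (k + 2)
          \<Longrightarrow> s * p * egen \<nu> - (p' * s * egen \<nu> - D * egen \<nu>) \<in> J"
        using tau_transport_equal[OF k p] Suc unfolding cong_def s_def x_def y_def by auto
      have "D * egen (\<mu> @ i # i # \<nu>) \<in> J" if w: "\<mu> @ i # i # \<nu> \<in> seqs \<delta>" for \<mu>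
      proof -
        define e :: "('i, 'k) klr_word_alg" where "e = egen (\<mu> @ i # i # \<nu>)"
        have S': "D \<in> S" "p' \<in> S" "e \<in> S"
          using pol_S[OF mon_pol[OF D]] pol_S[OF mon_pol[OF p']] k e_S[OF w] by (auto simp: e_def)
        have pe: "p * e \<in> J" using pJ[of "\<mu> @ [i]"] w by (simp add: e_def)
        have se: "s * e - e * s \<in> J"
          using rel_tau_idem[of "k + 1" "\<mu> @ i # i # \<nu>"] k w swap_at_append[of \<nu> k \<mu> i i]
          by (simp add: cong_def s_def e_def k_def)
        have sse: "s * s * e \<in> J"
          using rel_tau_square[of "k + 1" "\<mu> @ i # i # \<nu>"] k w entry_append[of \<nu> k \<mu> i i]
          by (simp add: s_def e_def k_def Q_diag eval2_def flip: cong_0)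
        have "s * p * e - (p' * s * e - D * e) \<in> J"
          using tr[OF w] entry_append[of \<nu> k \<mu> i i] by (simp add: e_def k_def)
        \<comment> \<open>As \<open>p e\<close> vanishes, the transport formula leaves
          \<open>p' s e = D e\<close> modulo \<open>J\<close>.\<close>
        from J_diff[OF J_mult_left[OF pe S(1)] this] have 1: "p' * s * e - D * e \<in> J"
          by (simp add: mult.assoc)
        \<comment> \<open>Fact \<open>1\<close> is multiplied by \<open>s\<close> on the right;
          after \<open>e\<close> has been moved past \<open>s\<close>, its first term contains
          \<open>s s e\<close>, which vanishes.\<close>
        have "D * s * e = p' * s * (e * s - s * e) + p' * (s * s * e) - (p' * s * e - D * e) * s - D * (e * s - s * e)"
          by (simp add: algebra_simps)
        moreover have "e * s - s * e \<in> J" using J_minus[OF se] by simp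
        ultimately have 2: "D * s * e \<in> J"
          using 1 sse S S' by (simp only: J_add J_diff J_mult_left J_mult_right fa_mult)
        \<comment> \<open>Here \<open>p'\<close> is replaced by \<open>p - (x - y) D\<close>. The
          first part vanishes since \<open>p s e = p e s\<close>, the second by
          \<open>2\<close>.\<close>
        have "p' * s * e = p * (s * e - e * s) + p * e * s - (x - y) * (D * s * e) + ((x - y) * D - (p - p')) * (s * e)"
          by (simp add: algebra_simps)
        then have 3: "p' * s * e \<in> J"
          using se pe 2 dq S S' by (simp only: J_add J_diff J_mult_left J_mult_right fa_mult fa_diff)
        show "D * egen (\<mu> @ i # i # \<nu>) \<in> J" using J_diff[OF 3 1] by (simp add: e_def)
      qed
      then show ?thesis using D True Suc unfolding m_def[symmetric] k_def[symmetric]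
        by (intro bexI[of _ D]) (auto simp: k_def m_def simp del: mon.simps)
    qed
  next
    case False
    define b where "b = nat (- cartan ip i j)"
    obtain p' where p': "p' \<in> mon (Suc k) m"
      and tr: "\<And>\<nu>. \<nu> \<in> seqs \<delta> \<Longrightarrow> entry \<nu> (k + 1) \<noteq> entry \<nu> (k + 2)
        \<Longrightarrow> s * p * egen \<nu> - p' * s * egen \<nu> \<in> J"
      using tau_transport_distinct[OF k p] unfolding cong_def s_def x_def y_def by auto
    have x: "x \<in> pol (Suc k)" unfolding x_def by (rule pol_x) simp
    \<comment> \<open>The square of the crossing on \<open>\<mu> @ i # j # \<nu>\<close>; there
      \<open>j\<close> stands at the lower position k + 1, whence the order of the indices.\<close>
    define q0 where "q0 = eval2 scal (Q j i) x y"
    obtain u q where q: "q \<in> low (Suc k) b" "scal u * q0 \<asymp> y ^ b + q"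
      using Q_leading[OF False[symmetric] _ x] k unfolding y_def b_def q0_def by auto
    obtain g where g: "g \<in> low (Suc k) (m + b)" "q * p' \<asymp> g"
      using low_mult[OF _ mon_low[OF p'] q(1)] k by auto
    have y: "y \<in> pol (Suc (Suc k))" unfolding y_def by (rule pol_x) simp
    have q0: "q0 \<in> pol (Suc (Suc k))"
      unfolding q0_def using eval2_pol[OF _ y] pol_mono[of "Suc k" "Suc (Suc k)"] x by auto
    have S': "p' \<in> S" "q0 \<in> S" "scal u \<in> S"
      using pol_S[OF mon_pol[OF p']] k pol_S[OF q0] by (auto simp: fa_scal)
    have comm: "q0 * p' - p' * q0 \<in> J"
      using pol_comm[OF _ q0 mon_pol[OF p']] k by (simp add: cong_def)
    have "(y ^ b * p' + g) * egen (\<mu> @ i # j # \<nu>) \<in> J" if w: "\<mu> @ i # j # \<nu> \<in> seqs \<delta>" for \<mu>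
    proof -
      have w0: "\<mu> @ j # i # \<nu> \<in> seqs \<delta>" using w by (auto simp: seqs_def)
      define e e0 :: "('i, 'k) klr_word_alg" where "e = egen (\<mu> @ i # j # \<nu>)" and "e0 = egen (\<mu> @ j # i # \<nu>)"
      have eS: "e \<in> S" using e_S[OF w] by (simp add: e_def)
      have pe: "p * e0 \<in> J" using pJ[of "\<mu> @ [j]"] w0 by (simp add: e0_def)
      have se: "s * e - e0 * s \<in> J"
        using rel_tau_idem[of "k + 1" "\<mu> @ i # j # \<nu>"] k w swap_at_append[of \<nu> k \<mu> i j]
        by (simp add: cong_def s_def e_def e0_def k_def)
      have sse: "s * s * e - q0 * e \<in> J"
        using rel_tau_square[of "k + 1" "\<mu> @ i # j # \<nu>"] k w entry_append[of \<nu> k \<mu> i j]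
        by (simp add: cong_def s_def e_def k_def q0_def x_def y_def)
      have "s * p * e0 - p' * s * e0 \<in> J"
        using tr[OF w0] entry_append[of \<nu> k \<mu> j i] False by (simp add: e0_def k_def)
      \<comment> \<open>The right-hand crossing leads to the word
        \<open>\<mu> @ j # i # \<nu>\<close>, on which \<open>p\<close> is known to vanish; moving
        \<open>p\<close> through the other crossing produces \<open>p'\<close>.\<close>
      moreover have "p' * (s * s * e) = p' * s * (s * e - e0 * s) - (s * p * e0 - p' * s * e0) * s + s * (p * e0) * s"
        by (simp add: algebra_simps)
      ultimately have psse: "p' * (s * s * e) \<in> J"
        using se pe S S' by (simp only: J_add J_diff J_mult_left J_mult_right fa_mult)
      \<comment> \<open>Modulo \<open>J\<close>, \<open>p' q0 e\<close> vanishes. It is rearranged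
        to \<open>q0 p' e\<close> before scaling by \<open>u\<close>, so that the leading power of
        \<open>y\<close> stands on the left, as in a Horner form.\<close>
      have "(y ^ b * p' + g) * e = scal u * (q0 * p' - p' * q0) * e
          + scal u * (p' * (s * s * e)) - scal u * p' * (s * s * e - q0 * e)
          - (scal u * q0 - (y ^ b + q)) * (p' * e) - (q * p' - g) * e"
        by (simp add: algebra_simps)
      then show ?thesis using comm psse sse q(2) g(2) eS S S' unfolding cong_def e_def[symmetric]
        by (simp only: J_add J_diff J_mult_left J_mult_right fa_mult)
    qed
    moreover have "y ^ b * p' + g \<in> mon (Suc k) (m + b)"
      using mon_add_low[OF mon_power_mult[OF p'] g(1)] by (simp add: y_def)
    ultimately show ?thesis using False unfolding m_def b_def k_def by (auto simp del: mon.simps)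
  qed
qed

lemma annihilator_degree_replicate:
  "annihilator_degree ip i (replicate n i @ \<nu>) = annihilator_degree ip i \<nu> - n"
  by (induction n) auto

lemma idem_in_J:
  assumes "annihilator_degree ip i \<nu> < n" "replicate n i @ \<nu> \<in> seqs \<delta>"
  shows "egen (replicate n i @ \<nu>) \<in> J"
proof -
  \<comment> \<open>The first of the n letters is the distinguished \<open>i\<close>; the remaining
    n - 1 lower the degree, and the strict inequality brings it down to 0.\<close>
  obtain n' where n: "n = Suc n'" using assms(1) by (cases n) auto
  then have "length (replicate n' i @ \<nu>) < size \<delta>" using seqs_size[OF assms(2)] by simp
  from monic_annihilator[OF this] show ?thesis
    using assms(1) assms(2)[unfolded n] unfolding n annihilator_degree_replicate
    by (auto dest: spec[of _ "[]"])
qed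

end


section \<open>The morphism \<open>\<diamond>\<close>\<close>

lemma finite_seqs: "finite (seqs \<beta>)"
proof (rule finite_subset)
  show "seqs \<beta> \<subseteq> {\<nu>. set \<nu> \<subseteq> set_mset \<beta> \<and> length \<nu> = size \<beta>}" by (auto simp: seqs_def)
qed (rule finite_lists_length_eq[OF finite_set_mset])

lemma swap_at_swap_at: "k \<in> {1..<length \<nu>} \<Longrightarrow> swap_at k (swap_at k \<nu>) = \<nu>"
  by (auto simp: swap_at_def entry_def nth_list_update intro!: nth_equalityI simp: rev_nth rev_update)

lemma entry_append_left: "k \<in> {1..length \<mu>} \<Longrightarrow> entry (\<mu> @ \<nu>) (length \<nu> + k) = entry \<mu> k"
  by (auto simp: entry_def nth_append)

lemma entry_append_right: "k \<in> {1..length \<nu>} \<Longrightarrow> entry (\<mu> @ \<nu>) k = entry \<nu> k"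
  by (auto simp: entry_def nth_append)

lemma swap_at_append_left:
  assumes "k \<in> {1..<length \<mu>}"
  shows "swap_at (length \<nu> + k) (\<mu> @ \<nu>) = swap_at k \<mu> @ \<nu>"
  using assms entry_append_left[of k \<mu> \<nu>] entry_append_left[of "k + 1" \<mu> \<nu>]
  by (auto simp: swap_at_def list_update_append)

lemma swap_at_append_right:
  assumes "k \<in> {1..<length \<nu>}"
  shows "swap_at k (\<mu> @ \<nu>) = \<mu> @ swap_at k \<nu>"
  using assms entry_append_right[of k \<nu> \<mu>] entry_append_right[of "k + 1" \<nu> \<mu>]
  by (auto simp: swap_at_def list_update_append)

text \<open>Both factors of \<open>\<diamond>\<close> are instances of one construction: the words of weight \<open>\<alpha>\<close> are placed
  at the positions \<open>c + 1, \<dots>, c + |\<alpha>|\<close>, the remaining positions being filled by \<open>b \<in> B\<close>.\<close>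

fun window_img :: "('i list \<Rightarrow> 'b \<Rightarrow> 'i list) \<Rightarrow> 'b set \<Rightarrow> nat \<Rightarrow> 'i klr_gen \<Rightarrow> ('i, 'k::comm_ring_1) klr_word_alg" where
  "window_img emb B c (EGen \<nu>) = (\<Sum>b \<in> B. egen (emb \<nu> b))"
| "window_img emb B c (XGen k) = xgen (c + k)"
| "window_img emb B c (Tau k) = tau (c + k)"

lemma left_img_window: "left_img \<gamma> = window_img (@) (seqs \<gamma>) (size \<gamma>)"
proof
  show "left_img \<gamma> g = window_img (@) (seqs \<gamma>) (size \<gamma>) g" for g by (cases g) auto
qed

lemma right_img_window: "right_img \<beta> = window_img (\<lambda>\<nu> \<mu>. \<mu> @ \<nu>) (seqs \<beta>) 0"
proof
  show "right_img \<beta> g = window_img (\<lambda>\<nu> \<mu>. \<mu> @ \<nu>) (seqs \<beta>) 0 g" for g by (cases g) auto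
qed

context klr_congruence
begin

lemma idem_sum_mult:
  assumes "A \<subseteq> seqs \<delta>" "A' \<subseteq> seqs \<delta>"
  shows "sum egen A * sum egen A' \<asymp> sum egen (A \<inter> A')"
proof -
  have fin: "finite A" "finite A'" using assms finite_subset finite_seqs by blast+
  have "sum egen A * sum egen A' = (\<Sum>\<nu>\<in>A. \<Sum>\<nu>'\<in>A'. egen \<nu> * egen \<nu>')"
    by (simp add: sum_product)
  also have "\<dots> \<asymp> (\<Sum>\<nu>\<in>A. \<Sum>\<nu>'\<in>A'. if \<nu> = \<nu>' then egen \<nu> else 0)"
    using assms by (intro cong_sum rel_idem_orth) auto
  also have "(\<Sum>\<nu>\<in>A. \<Sum>\<nu>'\<in>A'. if \<nu> = \<nu>' then egen \<nu> else 0) = (\<Sum>\<nu>\<in>A. if \<nu> \<in> A' then egen \<nu> else 0)"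
    using fin by (simp add: sum.delta)
  also have "\<dots> = sum egen (A \<inter> A')" using fin by (simp add: sum.inter_restrict)
  finally show ?thesis .
qed

end

text \<open>Filling the window has to respect what the relations refer to: entries and exchanges at
  the shifted positions. Joint injectivity of \<open>emb\<close> makes the images of distinct
  idempotents orthogonal.\<close>

locale klr_window = klr_congruence \<delta> J Q
  for \<delta> :: "'i multiset" and J :: "('i, 'k::comm_ring_1) klr_word_alg set" and Q +
  fixes \<alpha> :: "'i multiset" and B :: "'b set" and emb :: "'i list \<Rightarrow> 'b \<Rightarrow> 'i list" and c :: nat
  assumes finite_B: "finite B"
    and emb_seqs: "\<nu> \<in> seqs \<alpha> \<Longrightarrow> b \<in> B \<Longrightarrow> emb \<nu> b \<in> seqs \<delta>"
    and emb_inj: "\<lbrakk>\<nu> \<in> seqs \<alpha>; \<nu>' \<in> seqs \<alpha>; b \<in> B; b' \<in> B; emb \<nu> b = emb \<nu>' b'\<rbrakk> \<Longrightarrow> \<nu> = \<nu>' \<and> b = b'"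
    and shift: "c + size \<alpha> \<le> size \<delta>"
    and entry_emb: "\<lbrakk>\<nu> \<in> seqs \<alpha>; b \<in> B; k \<in> {1..size \<alpha>}\<rbrakk> \<Longrightarrow> entry (emb \<nu> b) (c + k) = entry \<nu> k"
    and swap_emb: "\<lbrakk>\<nu> \<in> seqs \<alpha>; b \<in> B; k \<in> {1..<size \<alpha>}\<rbrakk> \<Longrightarrow>
      swap_at (c + k) (emb \<nu> b) = emb (swap_at k \<nu>) b"
begin

abbreviation "subst \<equiv> word_subst (window_img emb B c :: 'i klr_gen \<Rightarrow> ('i, 'k) klr_word_alg)"

text \<open>The image of the unit under the non-unital morphism, equal to \<open>idem_pair\<close>
  in both instances. As \<open>subst\<close> sends 1 to 1, the relation that the idempotents of
  weight \<alpha> add up to 1 is respected only after multiplication by this element.\<close>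

definition window_idem :: "('i, 'k) klr_word_alg" where
  "window_idem = (\<Sum>\<nu> \<in> seqs \<alpha>. \<Sum>b \<in> B. egen (emb \<nu> b))"

lemma window_img_set: "\<nu> \<in> seqs \<alpha> \<Longrightarrow> window_img emb B c (EGen \<nu>) = sum egen (emb \<nu> ` B)"
  by (simp, subst sum.reindex) (auto intro!: inj_onI dest: emb_inj)

lemma window_idem_set: "window_idem = sum egen (case_prod emb ` (seqs \<alpha> \<times> B))"
  unfolding window_idem_def
  by (subst sum.reindex) (auto simp: sum.cartesian_product split_def intro!: inj_onI dest: emb_inj)

lemma window_sets: "\<nu> \<in> seqs \<alpha> \<Longrightarrow> emb \<nu> ` B \<subseteq> seqs \<delta>" "case_prod emb ` (seqs \<alpha> \<times> B) \<subseteq> seqs \<delta>"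
  using emb_seqs by auto

lemma window_idem_S: "window_idem \<in> S"
  unfolding window_idem_def by (intro fa_sum e_S emb_seqs)

lemma window_img_S:
  assumes "g \<in> klr_gens \<alpha>"
  shows "window_img emb B c g \<in> S"
proof (cases g)
  case (EGen \<nu>)
  then have "\<nu> \<in> seqs \<alpha>" using assms by (auto simp: klr_gens_def)
  then show ?thesis unfolding EGen by (auto intro!: fa_sum e_S emb_seqs)
next
  case (XGen k)
  then show ?thesis using assms shift x_S[of "c + k"] by (auto simp: klr_gens_def)
next
  case (Tau k)
  then show ?thesis using assms shift tau_S[of "c + k"] by (auto simp: klr_gens_def)
qed

lemma subst_S: "f \<in> carrier (klr_free \<alpha>) \<Longrightarrow> subst f \<in> S"
  by (erule word_subst_closed) (rule window_img_S)

lemma window_idem_idem: "window_idem * window_idem \<asymp> window_idem"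
  unfolding window_idem_set using idem_sum_mult[OF window_sets(2) window_sets(2)] by simp

lemma window_idem_absorb:
  assumes "A \<subseteq> case_prod emb ` (seqs \<alpha> \<times> B)"
  shows "window_idem * sum egen A \<asymp> sum egen A"
  unfolding window_idem_set using idem_sum_mult[OF window_sets(2), of A] assms window_sets(2)
  by (simp add: Int_absorb1)

lemma window_idem_comm_gen:
  assumes "g \<in> klr_gens \<alpha>"
  shows "window_idem * window_img emb B c g \<asymp> window_img emb B c g * window_idem"
proof (cases g)
  case (EGen \<nu>)
  then have \<nu>: "\<nu> \<in> seqs \<alpha>" using assms by (auto simp: klr_gens_def)
  let ?A = "case_prod emb ` (seqs \<alpha> \<times> B)" and ?A' = "emb \<nu> ` B"
  have "sum egen ?A * sum egen ?A' \<asymp> sum egen (?A \<inter> ?A')"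
    by (intro idem_sum_mult window_sets \<nu>)
  moreover have "sum egen ?A' * sum egen ?A \<asymp> sum egen (?A \<inter> ?A')"
    using idem_sum_mult[OF window_sets(1)[OF \<nu>] window_sets(2)] by (simp only: Int_commute)
  ultimately show ?thesis unfolding EGen window_img_set[OF \<nu>] window_idem_set
    by (blast intro: cong_trans cong_sym)
next
  case (XGen k)
  then have "c + k \<in> {1..size \<delta>}" using assms shift by (auto simp: klr_gens_def)
  then show ?thesis unfolding XGen window_idem_def
    by (auto simp: sum_distrib_left sum_distrib_right intro!: cong_sum cong_sym[OF rel_x_idem] emb_seqs)
next
  case (Tau k)
  then have k: "k \<in> {1..<size \<alpha>}" using assms by (auto simp: klr_gens_def)
  have "tau (c + k) * window_idem = (\<Sum>\<nu> \<in> seqs \<alpha>. \<Sum>b \<in> B. tau (c + k) * egen (emb \<nu> b))"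
    by (simp add: window_idem_def sum_distrib_left)
  also have "\<dots> \<asymp> (\<Sum>\<nu> \<in> seqs \<alpha>. \<Sum>b \<in> B. egen (swap_at (c + k) (emb \<nu> b)) * tau (c + k))"
    using k shift by (intro cong_sum rel_tau_idem emb_seqs) auto
  also have "(\<Sum>\<nu> \<in> seqs \<alpha>. \<Sum>b \<in> B. egen (swap_at (c + k) (emb \<nu> b)) * tau (c + k))
      = (\<Sum>\<nu> \<in> seqs \<alpha>. \<Sum>b \<in> B. egen (emb (swap_at k \<nu>) b) * tau (c + k))"
    using k by (intro sum.cong refl) (simp add: swap_emb)
  \<comment> \<open>\<open>swap_at k\<close> is an involution of \<open>seqs \<alpha>\<close>, so it
    permutes the summands.\<close>
  also have "\<dots> = (\<Sum>\<nu> \<in> seqs \<alpha>. \<Sum>b \<in> B. egen (emb \<nu> b) * tau (c + k))"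
    using k by (intro sum.reindex_bij_witness[of _ "swap_at k" "swap_at k"])
      (auto simp: swap_at_swap_at seqs_size intro!: swap_seqs)
  also have "\<dots> = window_idem * tau (c + k)"
    by (simp add: window_idem_def sum_distrib_right)
  finally show ?thesis unfolding Tau by (auto intro: cong_sym)
qed

lemma window_idem_comm:
  assumes "f \<in> carrier (klr_free \<alpha>)"
  shows "window_idem * subst f \<asymp> subst f * window_idem"
  using assms
proof (induction rule: free_alg_induct)
  case (scal k) then show ?case by (simp add: scal_central)
next
  case (var g) then show ?case by (simp add: window_idem_comm_gen)
next
  case (add f g) then show ?case by (simp add: word_subst_add distrib_left distrib_right cong_add)
next
  case (mult f g)
  have "window_idem * subst (f * g) - subst (f * g) * window_idem
    = (window_idem * subst f - subst f * window_idem) * subst g + subst f * (window_idem * subst g - subst g * window_idem)"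
    by (simp add: word_subst_mult algebra_simps)
  then show ?case using mult subst_S unfolding cong_def
    by (auto intro: J_add J_mult_left J_mult_right)
qed

lemma subst_cong: "subst f \<asymp> subst g \<Longrightarrow> window_idem * subst (f - g) \<in> J"
  unfolding cong_def word_subst_diff by (intro J_mult_left window_idem_S)

lemma subst_rel:
  assumes "r \<in> klr_rels Q \<alpha>"
  shows "window_idem * subst r \<in> J"
  using assms
proof induction
  case (idem_orth \<nu> \<nu>')
  have "window_img emb B c (EGen \<nu>) * window_img emb B c (EGen \<nu>')
      \<asymp> (if \<nu> = \<nu>' then window_img emb B c (EGen \<nu>) else 0)"
  proof (cases "\<nu> = \<nu>'")
    case True
    then show ?thesis unfolding window_img_set[OF idem_orth(1)] window_img_set[OF idem_orth(2)]
      using idem_sum_mult[OF window_sets(1)[OF idem_orth(1)] window_sets(1)[OF idem_orth(2)]] True by simp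
  next
    case False
    then have "emb \<nu> ` B \<inter> emb \<nu>' ` B = {}" using emb_inj[OF idem_orth] by auto
    then show ?thesis unfolding window_img_set[OF idem_orth(1)] window_img_set[OF idem_orth(2)]
      using idem_sum_mult[OF window_sets(1)[OF idem_orth(1)] window_sets(1)[OF idem_orth(2)]] False by simp
  qed
  then show ?case
    by (intro subst_cong) (auto simp: word_subst_hom simp del: window_img.simps)
next
  case idem_sum
  \<comment> \<open>Unlike in the other cases the factor \<open>window_idem\<close> takes part: the
    sum of the idempotents is mapped to it and not to 1.\<close>
  have "window_idem * subst (sum egen (seqs \<alpha>) - 1) = window_idem * window_idem - window_idem"
    by (simp add: word_subst_hom window_idem_def algebra_simps)
  then show ?case using window_idem_idem by (simp add: cong_def)
next
  case (x_idem k \<nu>)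
  then have "(\<Sum>b\<in>B. xgen (c + k) * egen (emb \<nu> b)) \<asymp> (\<Sum>b\<in>B. egen (emb \<nu> b) * xgen (c + k))"
    using shift by (intro cong_sum rel_x_idem emb_seqs) auto
  then show ?case
    by (intro subst_cong) (simp add: word_subst_hom sum_distrib_left sum_distrib_right)
next
  case (tau_idem k \<nu>)
  then have "(\<Sum>b\<in>B. tau (c + k) * egen (emb \<nu> b)) \<asymp> (\<Sum>b\<in>B. egen (swap_at (c + k) (emb \<nu> b)) * tau (c + k))"
    using shift by (intro cong_sum rel_tau_idem emb_seqs) auto
  then show ?case using tau_idem
    by (intro subst_cong) (simp add: word_subst_hom sum_distrib_left sum_distrib_right swap_emb)
next
  case (x_comm k l)
  then have "xgen (c + k) * xgen (c + l) \<asymp> xgen (c + l) * xgen (c + k)"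
    using shift by (intro rel_x_comm) auto
  then show ?case by (intro subst_cong) (simp add: word_subst_hom)
next
  case (tau_square k \<nu>)
  then have "(\<Sum>b\<in>B. tau (c + k) * tau (c + k) * egen (emb \<nu> b)) \<asymp> (\<Sum>b\<in>B.
      eval2 scal (Q (entry (emb \<nu> b) (c + k)) (entry (emb \<nu> b) (c + k + 1))) (xgen (c + k)) (xgen (c + k + 1)) * egen (emb \<nu> b))"
    using shift by (intro cong_sum rel_tau_square emb_seqs) auto
  also have "\<dots> = eval2 scal (Q (entry \<nu> k) (entry \<nu> (k + 1))) (xgen (c + k)) (xgen (c + (k + 1))) * (\<Sum>b\<in>B. egen (emb \<nu> b))"
    using tau_square entry_emb[of \<nu> _ k] entry_emb[of \<nu> _ "k + 1"] by (simp add: sum_distrib_left)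
  finally show ?case
    by (intro subst_cong) (simp add: word_subst_hom word_subst_eval2 sum_distrib_left)
next
  case (tau_x k l \<nu>)
  let ?l = "if l = k then k + 1 else if l = k + 1 then k else l"
  have "(\<Sum>b\<in>B. (tau (c + k) * xgen (c + l) - xgen (if c + l = c + k then c + k + 1 else if c + l = c + k + 1 then c + k else c + l)
        * tau (c + k)) * egen (emb \<nu> b))
      \<asymp> (\<Sum>b\<in>B. if c + l = c + k + 1 \<and> entry (emb \<nu> b) (c + k) = entry (emb \<nu> b) (c + k + 1) then egen (emb \<nu> b)
         else if c + l = c + k \<and> entry (emb \<nu> b) (c + k) = entry (emb \<nu> b) (c + k + 1) then - egen (emb \<nu> b) else 0)"
    using tau_x shift by (intro cong_sum rel_tau_x emb_seqs) auto
  also have "\<dots> = (\<Sum>b\<in>B. if l = k + 1 \<and> entry \<nu> k = entry \<nu> (k + 1) then egen (emb \<nu> b)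
         else if l = k \<and> entry \<nu> k = entry \<nu> (k + 1) then - egen (emb \<nu> b) else 0)"
    using tau_x entry_emb[of \<nu> _ k] entry_emb[of \<nu> _ "k + 1"] by (intro sum.cong refl) simp
  also have "\<dots> = subst (if l = k + 1 \<and> entry \<nu> k = entry \<nu> (k + 1) then egen \<nu>
         else if l = k \<and> entry \<nu> k = entry \<nu> (k + 1) then - egen \<nu> else 0)"
    by (auto simp: word_subst_hom sum_negf intro!: sum.neutral)
  also have "(\<Sum>b\<in>B. (tau (c + k) * xgen (c + l) - xgen (if c + l = c + k then c + k + 1 else if c + l = c + k + 1 then c + k else c + l)
        * tau (c + k)) * egen (emb \<nu> b)) = subst ((tau k * xgen l - xgen ?l * tau k) * egen \<nu>)"
    by (simp add: word_subst_hom sum_distrib_left sum_subtractf algebra_simps)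
  finally show ?case by (rule subst_cong)
next
  case (tau_comm k l)
  then have "tau (c + k) * tau (c + l) \<asymp> tau (c + l) * tau (c + k)"
    using shift by (intro rel_tau_comm) auto
  then show ?case by (intro subst_cong) (simp add: word_subst_hom)
next
  case (braid k \<nu>)
  let ?q = "if entry \<nu> k = entry \<nu> (k + 2)
    then dquot2 scal (Q (entry \<nu> k) (entry \<nu> (k + 1))) (xgen (k + 2)) (xgen k) (xgen (k + 1)) * egen \<nu> else 0"
  have "(\<Sum>b\<in>B. (tau (c + k + 1) * tau (c + k) * tau (c + k + 1) - tau (c + k) * tau (c + k + 1) * tau (c + k)) * egen (emb \<nu> b))
      \<asymp> (\<Sum>b\<in>B. if entry (emb \<nu> b) (c + k) = entry (emb \<nu> b) (c + k + 2)
       then dquot2 scal (Q (entry (emb \<nu> b) (c + k)) (entry (emb \<nu> b) (c + k + 1)))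
          (xgen (c + k + 2)) (xgen (c + k)) (xgen (c + k + 1)) * egen (emb \<nu> b) else 0)"
    using braid shift by (intro cong_sum rel_braid emb_seqs) auto
  also have "\<dots> = (\<Sum>b\<in>B. if entry \<nu> k = entry \<nu> (k + 2)
       then dquot2 scal (Q (entry \<nu> k) (entry \<nu> (k + 1)))
          (xgen (c + k + 2)) (xgen (c + k)) (xgen (c + k + 1)) * egen (emb \<nu> b) else 0)"
    using braid entry_emb[of \<nu> _ k] entry_emb[of \<nu> _ "k + 1"] entry_emb[of \<nu> _ "k + 2"]
    by (intro sum.cong refl) simp
  also have "\<dots> = subst ?q"
    by (simp add: word_subst_hom word_subst_dquot2 sum_distrib_left)
  also have "(\<Sum>b\<in>B. (tau (c + k + 1) * tau (c + k) * tau (c + k + 1) - tau (c + k) * tau (c + k + 1) * tau (c + k)) * egen (emb \<nu> b))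
      = subst ((tau (k + 1) * tau k * tau (k + 1) - tau k * tau (k + 1) * tau k) * egen \<nu>)"
    by (simp add: word_subst_hom sum_distrib_left)
  finally show ?case by (rule subst_cong)
qed

text \<open>The elements with this property form an ideal, since \<open>window_idem\<close> commutes
  with the image of \<open>subst\<close> modulo \<open>J\<close>, and this ideal contains the
  relations.\<close>

lemma subst_klr_ideal:
  assumes "f \<in> klr_ideal Q \<alpha>"
  shows "window_idem * subst f \<in> J"
proof -
  let ?K = "{f \<in> carrier (klr_free \<alpha>). window_idem * subst f \<in> J}"
  have "ideal ?K (klr_free \<alpha>)"
  proof (rule ideal_free_algI)
    show "0 \<in> ?K" by (simp add: fa_0 J_0)
  next
    fix a b assume "a \<in> ?K" "b \<in> ?K"
    then show "a + b \<in> ?K" by (auto simp: word_subst_hom distrib_left fa_add J_add)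
  next
    fix a x :: "('i, 'k) klr_word_alg" assume a: "a \<in> ?K" and x: "x \<in> carrier (klr_free \<alpha>)"
    have "window_idem * subst (x * a) = (window_idem * subst x - subst x * window_idem) * subst a
        + subst x * (window_idem * subst a)"
      by (simp add: word_subst_mult algebra_simps)
    then have "window_idem * subst (x * a) \<in> J"
      using a window_idem_comm[OF x] subst_S[of a] subst_S[OF x] unfolding cong_def
      by (auto intro: J_add J_mult_left J_mult_right)
    then show "x * a \<in> ?K" using a x by (auto simp: fa_mult)
    have "window_idem * subst (a * x) = window_idem * subst a * subst x"
      by (simp add: word_subst_mult algebra_simps)
    then have "window_idem * subst (a * x) \<in> J" using a subst_S[OF x] by (auto intro: J_mult_right)
    then show "a * x \<in> ?K" using a x by (auto simp: fa_mult)
  qed auto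
  moreover have "klr_rels Q \<alpha> \<subseteq> ?K" using subst_rel klr_rels_sub by auto
  ultimately have "klr_ideal Q \<alpha> \<subseteq> ?K"
    unfolding klr_ideal_def by (intro ring.genideal_minimal[OF ring_free_alg])
  then show ?thesis using assms by auto
qed

end

section \<open>Passing from the free algebra to the KLR algebra\<close>

lemma klr_congruence_ideal: "klr_congruence \<delta> (klr_ideal Q \<delta>) Q"
  by (intro klr_congruence.intro free_alg_ideal.intro klr_congruence_axioms.intro ideal_klr)
    (unfold klr_ideal_def, rule ring.genideal_self[OF ring_free_alg klr_rels_sub])

lemma klr_class_hom: "klr_class Q \<delta> \<in> ring_hom (klr_free \<delta>) (klr Q \<delta>)"
  unfolding klr_class_def[abs_def] klr_def by (rule ideal.rcos_ring_hom[OF ideal_klr])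

lemma klr_class_closed: "f \<in> carrier (klr_free \<delta>) \<Longrightarrow> klr_class Q \<delta> f \<in> carrier (klr Q \<delta>)"
  by (rule ring_hom_closed[OF klr_class_hom])

lemma klr_class_mult: "f \<in> carrier (klr_free \<delta>) \<Longrightarrow> g \<in> carrier (klr_free \<delta>) \<Longrightarrow>
    klr_class Q \<delta> (f * g) = klr_class Q \<delta> f \<otimes>\<^bsub>klr Q \<delta>\<^esub> klr_class Q \<delta> g"
  using ring_hom_mult[OF klr_class_hom[of Q \<delta>], of f g] by (simp add: free_alg_simps(2))

lemma klr_class_add: "f \<in> carrier (klr_free \<delta>) \<Longrightarrow> g \<in> carrier (klr_free \<delta>) \<Longrightarrow>
    klr_class Q \<delta> (f + g) = klr_class Q \<delta> f \<oplus>\<^bsub>klr Q \<delta>\<^esub> klr_class Q \<delta> g"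
  using ring_hom_add[OF klr_class_hom[of Q \<delta>], of f g] by (simp add: free_alg_simps(3))

lemma klr_class_1: "klr_class Q \<delta> 1 = \<one>\<^bsub>klr Q \<delta>\<^esub>"
  using ring_hom_one[OF klr_class_hom[of Q \<delta>]] by (simp add: free_alg_simps(5))

lemma klr_carrierE:
  assumes "y \<in> carrier (klr Q \<delta>)"
  obtains f where "f \<in> carrier (klr_free \<delta>)" "y = klr_class Q \<delta> f"
  using assms unfolding klr_def klr_class_def FactRing_def A_RCOSETS_def' by auto

lemma free_alg_minus: "f \<in> carrier (free_alg G) \<Longrightarrow> g \<in> carrier (free_alg G) \<Longrightarrow> f \<ominus>\<^bsub>free_alg G\<^esub> g = f - g"
proof -
  assume fg: "f \<in> carrier (free_alg G)" "g \<in> carrier (free_alg G)"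
  interpret R: ring "free_alg G" by (rule ring_free_alg)
  have "\<ominus>\<^bsub>free_alg G\<^esub> g = - g"
    using fg by (intro R.minus_equality) (auto simp: free_alg_simps(3,4) fa_minus)
  then show ?thesis by (simp add: R.minus_eq free_alg_simps(3))
qed

lemma mem_klr_class:
  assumes "f \<in> carrier (klr_free \<delta>)"
  shows "g \<in> klr_class Q \<delta> f \<longleftrightarrow> g \<in> carrier (klr_free \<delta>) \<and> g - f \<in> klr_ideal Q \<delta>"
proof -
  interpret I: ideal "klr_ideal Q \<delta>" "klr_free \<delta>" by (rule ideal_klr)
  have "g \<in> klr_class Q \<delta> f \<Longrightarrow> g \<in> carrier (klr_free \<delta>)"
    unfolding klr_class_def by (rule I.a_elemrcos_carrier[OF assms])
  then show ?thesis
    using I.a_rcos_module_minus[OF ring_free_alg assms, of g] assms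
    by (auto simp: klr_class_def free_alg_minus)
qed

lemma klr_class_eqI:
  assumes "f \<in> carrier (klr_free \<delta>)" "g \<in> carrier (klr_free \<delta>)" "f - g \<in> klr_ideal Q \<delta>"
  shows "klr_class Q \<delta> f = klr_class Q \<delta> g"
proof -
  interpret I: ideal "klr_ideal Q \<delta>" "klr_free \<delta>" by (rule ideal_klr)
  have "f \<in> klr_class Q \<delta> g" using mem_klr_class[OF assms(2)] assms by blast
  then show ?thesis unfolding klr_class_def
    using I.a_repr_independence'[of f g] assms(2) by simp
qed

lemma klr_window_left: "klr_window (\<beta> + \<gamma>) (klr_ideal Q (\<beta> + \<gamma>)) Q \<beta> (seqs \<gamma>) (@) (size \<gamma>)"
proof -
  interpret klr_congruence "\<beta> + \<gamma>" "klr_ideal Q (\<beta> + \<gamma>)" Q by (rule klr_congruence_ideal)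
  show ?thesis
  proof (standard, goal_cases)
    case 1 show ?case by (rule finite_seqs)
  next
    case (3 \<nu> \<nu>' b b') then show ?case by (auto dest!: seqs_size)
  next
    case (5 \<nu> b k) then show ?case using entry_append_left[of k \<nu> b] by (auto dest!: seqs_size)
  next
    case (6 \<nu> b k) then show ?case using swap_at_append_left[of k \<nu> b] by (auto dest!: seqs_size)
  qed (auto simp: seqs_def)
qed

lemma klr_window_right:
  "klr_window (\<beta> + \<gamma>) (klr_ideal Q (\<beta> + \<gamma>)) Q \<gamma> (seqs \<beta>) (\<lambda>\<nu> \<mu>. \<mu> @ \<nu>) 0"
proof -
  interpret klr_congruence "\<beta> + \<gamma>" "klr_ideal Q (\<beta> + \<gamma>)" Q by (rule klr_congruence_ideal)
  show ?thesis
  proof (standard, goal_cases)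
    case 1 show ?case by (rule finite_seqs)
  next
    case (3 \<nu> \<nu>' b b') then show ?case by (auto dest!: seqs_size)
  next
    case (5 \<nu> b k) then show ?case using entry_append_right[of k \<nu> b] by (auto dest!: seqs_size)
  next
    case (6 \<nu> b k) then show ?case using swap_at_append_right[of k \<nu> b] by (auto dest!: seqs_size)
  qed (auto simp: seqs_def)
qed

context
  fixes Q :: "'i \<Rightarrow> 'i \<Rightarrow> 'k::comm_ring_1 poly2" and \<beta> \<gamma> :: "'i multiset"
begin

interpretation L: klr_window "\<beta> + \<gamma>" "klr_ideal Q (\<beta> + \<gamma>)" Q \<beta> "seqs \<gamma>" "(@)" "size \<gamma>"
  by (rule klr_window_left)

interpretation R: klr_window "\<beta> + \<gamma>" "klr_ideal Q (\<beta> + \<gamma>)" Q \<gamma> "seqs \<beta>" "\<lambda>\<nu> \<mu>. \<mu> @ \<nu>" 0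
  by (rule klr_window_right)

lemma idem_pair_left: "idem_pair \<beta> \<gamma> = L.window_idem"
  by (simp add: idem_pair_def L.window_idem_def)

lemma idem_pair_right: "idem_pair \<beta> \<gamma> = R.window_idem"
  unfolding idem_pair_def R.window_idem_def by (rule sum.swap)

lemma idem_pair_carrier: "(idem_pair \<beta> \<gamma> :: ('i, 'k) klr_word_alg) \<in> carrier (klr_free (\<beta> + \<gamma>))"
  unfolding idem_pair_left by (rule L.window_idem_S)

lemma left_subst_carrier:
  fixes f :: "('i, 'k) klr_word_alg"
  shows "f \<in> carrier (klr_free \<beta>) \<Longrightarrow> word_subst (left_img \<gamma>) f \<in> carrier (klr_free (\<beta> + \<gamma>))"
  unfolding left_img_window by (rule L.subst_S)

lemma right_subst_carrier:
  fixes f :: "('i, 'k) klr_word_alg"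
  shows "f \<in> carrier (klr_free \<gamma>) \<Longrightarrow> word_subst (right_img \<beta>) f \<in> carrier (klr_free (\<beta> + \<gamma>))"
  unfolding right_img_window by (rule R.subst_S)

text \<open>The definition applies \<open>the_elem\<close> to the classes obtained from all pairs of
  representatives, so the content is independence of the representatives.\<close>

lemma klr_diamond_class:
  assumes f: "f \<in> carrier (klr_free \<beta>)" and g: "g \<in> carrier (klr_free \<gamma>)"
  shows "klr_diamond Q \<beta> \<gamma> (klr_class Q \<beta> f) (klr_class Q \<gamma> g) = klr_class Q (\<beta> + \<gamma>)
     (idem_pair \<beta> \<gamma> * word_subst (left_img \<gamma>) f * word_subst (right_img \<beta>) g)"
proof -
  let ?E = "idem_pair \<beta> \<gamma> :: ('i, 'k) klr_word_alg"
  let ?h = "\<lambda>f g. ?E * word_subst (left_img \<gamma>) f * word_subst (right_img \<beta>) g"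
  have eq: "klr_class Q (\<beta> + \<gamma>) (?h f' g') = klr_class Q (\<beta> + \<gamma>) (?h f g)"
    if f': "f' \<in> carrier (klr_free \<beta>)" "f' - f \<in> klr_ideal Q \<beta>"
      and g': "g' \<in> carrier (klr_free \<gamma>)" "g' - g \<in> klr_ideal Q \<gamma>" for f' g'
  proof (rule klr_class_eqI)
    show "?h f' g' \<in> carrier (klr_free (\<beta> + \<gamma>))" "?h f g \<in> carrier (klr_free (\<beta> + \<gamma>))"
      using f g f' g' by (intro fa_mult idem_pair_carrier left_subst_carrier right_subst_carrier; simp)+
    have 1: "?E * word_subst (left_img \<gamma>) (f' - f) \<in> klr_ideal Q (\<beta> + \<gamma>)"
      unfolding idem_pair_left left_img_window by (rule L.subst_klr_ideal[OF f'(2)])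
    have 2: "?E * word_subst (right_img \<beta>) (g' - g) \<in> klr_ideal Q (\<beta> + \<gamma>)"
      unfolding idem_pair_right right_img_window by (rule R.subst_klr_ideal[OF g'(2)])
    have 3: "?E * word_subst (left_img \<gamma>) f - word_subst (left_img \<gamma>) f * ?E \<in> klr_ideal Q (\<beta> + \<gamma>)"
      using L.window_idem_comm[OF f] unfolding L.cong_def idem_pair_left left_img_window .
    \<comment> \<open>First \<open>f'\<close> is exchanged for \<open>f\<close>, then
      \<open>g'\<close> for \<open>g\<close>. For the second exchange the idempotent has to stand
      next to the right-hand image, whence the commutator with the left-hand one.\<close>
    have "?h f' g' - ?h f g = ?E * word_subst (left_img \<gamma>) (f' - f) * word_subst (right_img \<beta>) g'
        + word_subst (left_img \<gamma>) f * (?E * word_subst (right_img \<beta>) (g' - g))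
        + (?E * word_subst (left_img \<gamma>) f - word_subst (left_img \<gamma>) f * ?E) * word_subst (right_img \<beta>) (g' - g)"
      by (simp add: word_subst_hom algebra_simps)
    also have "\<dots> \<in> klr_ideal Q (\<beta> + \<gamma>)"
      using f g' g 1 2 3 by (intro L.J_add L.J_mult_right[OF 1] L.J_mult_left[OF 2] L.J_mult_right[OF 3]
          left_subst_carrier right_subst_carrier fa_diff)
    finally show "?h f' g' - ?h f g \<in> klr_ideal Q (\<beta> + \<gamma>)" .
  qed
  have ideal_0: "0 \<in> klr_ideal Q \<delta>" for \<delta>
    using free_alg_ideal.J_0[OF free_alg_ideal.intro[OF ideal_klr]] .
  have "(\<lambda>(f, g). klr_class Q (\<beta> + \<gamma>) (?h f g)) ` (klr_class Q \<beta> f \<times> klr_class Q \<gamma> g)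
      = {klr_class Q (\<beta> + \<gamma>) (?h f g)}" (is "?A = ?B")
  proof (intro equalityI subsetI)
    fix z assume "z \<in> ?A"
    then obtain f' g' where fg: "f' \<in> klr_class Q \<beta> f" "g' \<in> klr_class Q \<gamma> g" "z = klr_class Q (\<beta> + \<gamma>) (?h f' g')"
      by auto
    then show "z \<in> ?B" using eq[of f' g'] mem_klr_class[OF f] mem_klr_class[OF g] by blast
  next
    fix z assume "z \<in> ?B"
    moreover have "f \<in> klr_class Q \<beta> f" "g \<in> klr_class Q \<gamma> g"
      using mem_klr_class[OF f] mem_klr_class[OF g] f g ideal_0 by auto
    ultimately show "z \<in> ?A" by force
  qed
  then show ?thesis unfolding klr_diamond_def by simp
qed

lemma klr_diamond_one_class:
  "g \<in> carrier (klr_free \<gamma>) \<Longrightarrow>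
    klr_diamond Q \<beta> \<gamma> \<one>\<^bsub>klr Q \<beta>\<^esub> (klr_class Q \<gamma> g) = klr_class Q (\<beta> + \<gamma>) (idem_pair \<beta> \<gamma> * word_subst (right_img \<beta>) g)"
  using klr_diamond_class[OF fa_1, of g] by (simp add: klr_class_1)

lemma klr_diamond_one_one:
  "klr_diamond Q \<beta> \<gamma> \<one>\<^bsub>klr Q \<beta>\<^esub> \<one>\<^bsub>klr Q \<gamma>\<^esub> = klr_class Q (\<beta> + \<gamma>) (idem_pair \<beta> \<gamma>)"
  using klr_diamond_one_class[OF fa_1] by (simp add: klr_class_1)

lemma klr_diamond_one_closed:
  "z \<in> carrier (klr Q \<gamma>) \<Longrightarrow> klr_diamond Q \<beta> \<gamma> \<one>\<^bsub>klr Q \<beta>\<^esub> z \<in> carrier (klr Q (\<beta> + \<gamma>))"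
  by (elim klr_carrierE) (simp add: klr_diamond_one_class klr_class_closed fa_mult idem_pair_carrier right_subst_carrier)

text \<open>The element \<open>idem_pair\<close> is idempotent and commutes with the right-hand
  image, so it can be distributed over both factors.\<close>

lemma klr_diamond_one_mult:
  assumes "y \<in> carrier (klr Q \<gamma>)" "z \<in> carrier (klr Q \<gamma>)"
  shows "klr_diamond Q \<beta> \<gamma> \<one>\<^bsub>klr Q \<beta>\<^esub> (y \<otimes>\<^bsub>klr Q \<gamma>\<^esub> z)
    = klr_diamond Q \<beta> \<gamma> \<one>\<^bsub>klr Q \<beta>\<^esub> y \<otimes>\<^bsub>klr Q (\<beta> + \<gamma>)\<^esub> klr_diamond Q \<beta> \<gamma> \<one>\<^bsub>klr Q \<beta>\<^esub> z"
proof -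
  obtain f g where f: "f \<in> carrier (klr_free \<gamma>)" "y = klr_class Q \<gamma> f"
    and g: "g \<in> carrier (klr_free \<gamma>)" "z = klr_class Q \<gamma> g"
    using assms by (elim klr_carrierE)
  let ?E = "idem_pair \<beta> \<gamma> :: ('i, 'k) klr_word_alg" and ?s = "word_subst (right_img \<beta>)"
  note S = idem_pair_carrier right_subst_carrier[OF f(1)] right_subst_carrier[OF g(1)]
  have 1: "?E * ?s f - ?s f * ?E \<in> klr_ideal Q (\<beta> + \<gamma>)"
    using R.window_idem_comm[OF f(1)] unfolding L.cong_def idem_pair_right right_img_window .
  have 2: "?E * ?E - ?E \<in> klr_ideal Q (\<beta> + \<gamma>)"
    using R.window_idem_idem unfolding L.cong_def idem_pair_right .
  have "?E * ?s (f * g) - (?E * ?s f) * (?E * ?s g)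
      = ?E * (?E * ?s f - ?s f * ?E) * ?s g - (?E * ?E - ?E) * (?s f * ?s g)"
    by (simp add: word_subst_hom algebra_simps)
  also have "\<dots> \<in> klr_ideal Q (\<beta> + \<gamma>)"
    by (intro L.J_diff L.J_mult_right[OF L.J_mult_left[OF 1]] L.J_mult_right[OF 2] fa_mult S)
  finally have "klr_class Q (\<beta> + \<gamma>) (?E * ?s (f * g)) = klr_class Q (\<beta> + \<gamma>) ((?E * ?s f) * (?E * ?s g))"
    using S by (intro klr_class_eqI fa_mult) (auto simp: word_subst_hom fa_mult)
  then show ?thesis
    using f g S by (simp add: klr_diamond_one_class fa_mult flip: klr_class_mult)
qed

lemma klr_class_idem_pair_absorb:
  assumes "A \<subseteq> seqs \<beta>" "A' \<subseteq> seqs \<gamma>"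
  shows "klr_class Q (\<beta> + \<gamma>) (idem_pair \<beta> \<gamma> * (\<Sum>\<mu>\<in>A. \<Sum>\<nu>\<in>A'. egen (\<mu> @ \<nu>)))
    = klr_class Q (\<beta> + \<gamma>) (\<Sum>\<mu>\<in>A. \<Sum>\<nu>\<in>A'. egen (\<mu> @ \<nu>))"
proof -
  have "(\<Sum>\<mu>\<in>A. \<Sum>\<nu>\<in>A'. egen (\<mu> @ \<nu>) :: ('i, 'k) klr_word_alg) = sum egen (case_prod (@) ` (A \<times> A'))"
  proof (subst sum.reindex)
    \<comment> \<open>The weight of the left part determines its length, so a concatenation splits
      in only one way.\<close>
    show "inj_on (case_prod (@)) (A \<times> A')"
    proof (rule inj_onI, clarsimp)
      fix \<mu> \<nu> \<mu>' \<nu>' assume "\<mu> @ \<nu> = \<mu>' @ \<nu>'" "\<mu> \<in> A" "\<mu>' \<in> A"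
      moreover from this have "length \<mu> = length \<mu>'" using assms(1) by (metis subsetD seqs_size)
      ultimately show "\<mu> = \<mu>' \<and> \<nu> = \<nu>'" by simp
    qed
  qed (simp add: sum.cartesian_product split_def)
  moreover have "case_prod (@) ` (A \<times> A') \<subseteq> case_prod (@) ` (seqs \<beta> \<times> seqs \<gamma>)" using assms by auto
  ultimately have "idem_pair \<beta> \<gamma> * (\<Sum>\<mu>\<in>A. \<Sum>\<nu>\<in>A'. egen (\<mu> @ \<nu>)) - (\<Sum>\<mu>\<in>A. \<Sum>\<nu>\<in>A'. egen (\<mu> @ \<nu>)) \<in> klr_ideal Q (\<beta> + \<gamma>)"
    using L.window_idem_absorb[of "case_prod (@) ` (A \<times> A')"] unfolding L.cong_def idem_pair_left by simp
  moreover have "(\<Sum>\<mu>\<in>A. \<Sum>\<nu>\<in>A'. egen (\<mu> @ \<nu>)) \<in> L.S"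
    using assms by (intro fa_sum L.e_S) (auto simp: seqs_def)
  ultimately show ?thesis by (intro klr_class_eqI fa_mult idem_pair_carrier)
qed

end

section \<open>The ideal generated by the words ending in \<open>i\<close>\<close>

lemma last_idem_eq: "last_idem Q i (\<gamma> + {#i#}) = klr_class Q (\<gamma> + {#i#}) (idem_pair \<gamma> {#i#})"
  using klr_diamond_one_one[of Q \<gamma> "{#i#}"] by (simp add: last_idem_def)

lemma last_idem_closed: "last_idem Q i \<delta> \<in> carrier (klr Q \<delta>)"
proof (cases "i \<in># \<delta>")
  case True
  then obtain \<gamma> where "\<delta> = \<gamma> + {#i#}" by (metis add_mset_add_single insert_DiffM)
  then show ?thesis
    by (simp only: last_idem_eq klr_class_closed idem_pair_carrier)
next
  case False
  interpret ring "klr Q \<delta>" by (rule ring_klr)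
  show ?thesis using False by (simp add: last_idem_def)
qed

lemma ideal_cyc: "ideal (cyc_ideal Q i \<delta>) (klr Q \<delta>)"
  unfolding cyc_ideal_def by (rule ring.genideal_ideal[OF ring_klr]) (simp add: last_idem_closed)

lemma ring_cyc: "ring (cyc_klr Q i \<delta>)"
  unfolding cyc_klr_def by (rule ideal.quotient_is_ring[OF ideal_cyc])

lemma cyc_class_hom: "cyc_class Q i \<delta> \<in> ring_hom (klr Q \<delta>) (cyc_klr Q i \<delta>)"
  unfolding cyc_class_def[abs_def] cyc_klr_def by (rule ideal.rcos_ring_hom[OF ideal_cyc])

lemma cyc_carrierE:
  assumes "y \<in> carrier (cyc_klr Q i \<delta>)"
  obtains h where "h \<in> carrier (klr Q \<delta>)" "y = cyc_class Q i \<delta> h"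
  using assms unfolding cyc_klr_def cyc_class_def FactRing_def A_RCOSETS_def' by auto

lemma seqs_single: "seqs {#i#} = {[i]}"
  by (auto simp: seqs_def)

text \<open>The idempotent is its own product with the generator \<open>last_idem\<close> of the
  ideal.\<close>

lemma idem_last_cyc:
  assumes "\<mu> \<in> seqs \<gamma>"
  shows "klr_class Q (\<gamma> + {#i#}) (egen (\<mu> @ [i])) \<in> cyc_ideal Q i (\<gamma> + {#i#})"
proof -
  let ?\<delta> = "\<gamma> + {#i#}"
  interpret I: ideal "cyc_ideal Q i ?\<delta>" "klr Q ?\<delta>" by (rule ideal_cyc)
  interpret klr_congruence ?\<delta> "klr_ideal Q ?\<delta>" Q by (rule klr_congruence_ideal)
  have e: "egen (\<mu> @ [i]) \<in> S" using assms by (intro e_S) (simp add: seqs_def)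
  have "last_idem Q i ?\<delta> \<in> cyc_ideal Q i ?\<delta>"
    unfolding cyc_ideal_def by (rule ring.genideal_self'[OF ring_klr last_idem_closed])
  then have "last_idem Q i ?\<delta> \<otimes>\<^bsub>klr Q ?\<delta>\<^esub> klr_class Q ?\<delta> (egen (\<mu> @ [i])) \<in> cyc_ideal Q i ?\<delta>"
    by (rule I.I_r_closed) (rule klr_class_closed[OF e])
  also have "last_idem Q i ?\<delta> \<otimes>\<^bsub>klr Q ?\<delta>\<^esub> klr_class Q ?\<delta> (egen (\<mu> @ [i]))
      = klr_class Q ?\<delta> (idem_pair \<gamma> {#i#} * egen (\<mu> @ [i]))"
    by (simp only: last_idem_eq klr_class_mult[OF idem_pair_carrier e])
  also have "\<dots> = klr_class Q ?\<delta> (egen (\<mu> @ [i]))"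
    using klr_class_idem_pair_absorb[of "{\<mu>}" \<gamma> "{[i]}" "{#i#}" Q] assms by (simp add: seqs_single)
  finally show ?thesis .
qed

text \<open>This is how the iteration prepends letters: each application of \<open>ad_E\<close> adds
  one \<open>i\<close> to the word of an idempotent.\<close>

lemma klr_diamond_idem:
  assumes "\<nu> \<in> seqs \<gamma>"
  shows "klr_diamond Q {#i#} \<gamma> \<one>\<^bsub>klr Q {#i#}\<^esub> (klr_class Q \<gamma> (egen \<nu>)) = klr_class Q ({#i#} + \<gamma>) (egen (i # \<nu>))"
proof -
  interpret klr_congruence \<gamma> "klr_ideal Q \<gamma>" Q by (rule klr_congruence_ideal)
  have "word_subst (right_img {#i#}) (egen \<nu>) = egen (i # \<nu>)"
    by (simp add: seqs_single)
  then show ?thesis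
    using klr_class_idem_pair_absorb[of "{[i]}" "{#i#}" "{\<nu>}" \<gamma> Q] assms
    by (simp only: klr_diamond_one_class[OF e_S[OF assms]]) (simp add: seqs_single)
qed

text \<open>The annihilator argument is applied to the preimage of \<open>cyc_ideal\<close> in the
  free algebra, which contains the relations and the idempotents of the words ending in
  \<open>i\<close>.\<close>

lemma idem_vanishes:
  fixes Q :: "'i \<Rightarrow> 'i \<Rightarrow> 'k::comm_ring_1 poly2"
  assumes "klr_datum ip t Q" "annihilator_degree ip i \<nu> < n" "replicate n i @ \<nu> \<in> seqs \<delta>"
  shows "klr_class Q \<delta> (egen (replicate n i @ \<nu>)) \<in> cyc_ideal Q i \<delta>"
proof -
  interpret I: ideal "cyc_ideal Q i \<delta>" "klr Q \<delta>" by (rule ideal_cyc)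
  interpret R: klr_congruence \<delta> "klr_ideal Q \<delta>" Q by (rule klr_congruence_ideal)
  let ?J = "{f \<in> carrier (klr_free \<delta>). klr_class Q \<delta> f \<in> cyc_ideal Q i \<delta>}"
  have zero: "klr_class Q \<delta> f \<in> cyc_ideal Q i \<delta>" if "f \<in> klr_ideal Q \<delta>" for f
  proof -
    have "klr_class Q \<delta> f = klr_class Q \<delta> 0"
      using that R.J_carrier by (intro klr_class_eqI) (auto simp: fa_0)
    also have "klr_class Q \<delta> 0 = \<zero>\<^bsub>klr Q \<delta>\<^esub>"
      using ring_hom_zero[OF klr_class_hom ring_free_alg ring_klr, of Q \<delta>] by (simp add: free_alg_simps(4))
    finally show ?thesis using additive_subgroup.zero_closed[OF I.additive_subgroup_axioms] by simp
  qed
  have J: "ideal ?J (klr_free \<delta>)"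
  proof (rule ideal_free_algI)
    show "0 \<in> ?J" using zero[OF R.J_0] by (simp add: fa_0)
  next
    fix a b assume "a \<in> ?J" "b \<in> ?J"
    then show "a + b \<in> ?J"
      using additive_subgroup.a_closed[OF I.additive_subgroup_axioms] by (auto simp: fa_add klr_class_add)
  next
    fix a x :: "('i, 'k) klr_word_alg" assume "a \<in> ?J" "x \<in> carrier (klr_free \<delta>)"
    then show "x * a \<in> ?J" "a * x \<in> ?J"
      using I.I_l_closed I.I_r_closed by (auto simp: fa_mult klr_class_mult klr_class_closed)
  qed auto
  have "klr_vanishing \<delta> ?J Q ip t i"
  proof (intro klr_vanishing.intro klr_congruence.intro free_alg_ideal.intro klr_congruence_axioms.intro
      klr_vanishing_axioms.intro J assms(1))
    show "klr_rels Q \<delta> \<subseteq> ?J" using R.rels R.J_carrier zero by auto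
    show "egen (\<mu> @ [i]) \<in> ?J" if "\<mu> @ [i] \<in> seqs \<delta>" for \<mu>
      using idem_last_cyc[of \<mu> "mset \<mu>" Q i] R.e_S[OF that] that by (auto simp: seqs_def)
  qed
  from klr_vanishing.idem_in_J[OF this assms(2,3)] show ?thesis by simp
qed


section \<open>Modules\<close>

context left_module
begin

lemma smult_r_zero: "a \<in> carrier R \<Longrightarrow> a \<odot>\<^bsub>M\<^esub> \<zero>\<^bsub>M\<^esub> = \<zero>\<^bsub>M\<^esub>"
  using smult_r_distr[of a "\<zero>\<^bsub>M\<^esub>" "\<zero>\<^bsub>M\<^esub>"] smult_closed[of a "\<zero>\<^bsub>M\<^esub>"] M.add.l_cancel_one by simp

lemma smult_l_zero: "x \<in> carrier M \<Longrightarrow> \<zero>\<^bsub>R\<^esub> \<odot>\<^bsub>M\<^esub> x = \<zero>\<^bsub>M\<^esub>"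
  using smult_l_distr[of "\<zero>\<^bsub>R\<^esub>" "\<zero>\<^bsub>R\<^esub>" x] smult_closed[of "\<zero>\<^bsub>R\<^esub>" x] M.add.l_cancel_one by simp

lemma smult_r_minus: "a \<in> carrier R \<Longrightarrow> x \<in> carrier M \<Longrightarrow> a \<odot>\<^bsub>M\<^esub> (\<ominus>\<^bsub>M\<^esub> x) = \<ominus>\<^bsub>M\<^esub> (a \<odot>\<^bsub>M\<^esub> x)"
  using smult_r_distr[of a "\<ominus>\<^bsub>M\<^esub> x" x] by (intro M.minus_equality[symmetric]) (auto simp: M.l_neg smult_r_zero smult_closed)

lemma smult_l_minus: "a \<in> carrier R \<Longrightarrow> x \<in> carrier M \<Longrightarrow> (\<ominus>\<^bsub>R\<^esub> a) \<odot>\<^bsub>M\<^esub> x = \<ominus>\<^bsub>M\<^esub> (a \<odot>\<^bsub>M\<^esub> x)"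
  using smult_l_distr[of "\<ominus>\<^bsub>R\<^esub> a" a x] by (intro M.minus_equality[symmetric]) (auto simp: R.l_neg smult_l_zero smult_closed)

end

lemma abelian_group_surj:
  assumes M: "abelian_group M" and p: "carrier Y = p ` carrier M" "\<zero>\<^bsub>Y\<^esub> = p \<zero>\<^bsub>M\<^esub>"
      "\<And>x y. \<lbrakk>x \<in> carrier M; y \<in> carrier M\<rbrakk> \<Longrightarrow> p (x \<oplus>\<^bsub>M\<^esub> y) = p x \<oplus>\<^bsub>Y\<^esub> p y"
  shows "abelian_group Y"
proof -
  interpret M: abelian_group M by fact
  show ?thesis
  proof (rule abelian_groupI)
    fix x assume "x \<in> carrier Y"
    then obtain x' where x': "x' \<in> carrier M" "x = p x'" by (auto simp: p(1))
    then show "\<exists>y\<in>carrier Y. y \<oplus>\<^bsub>Y\<^esub> x = \<zero>\<^bsub>Y\<^esub>"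
      by (intro bexI[of _ "p (\<ominus>\<^bsub>M\<^esub> x')"]) (auto simp: p(1,2) M.l_neg simp flip: p(3))
  qed (auto simp: p(1,2) M.a_assoc M.a_comm M.a_lcomm simp flip: p(3))
qed

text \<open>Used with a proper quotient of the ring for \<open>pi_functor\<close>, and with the
  identity on the ring for a relabelled copy; the axioms are checked on representatives.\<close>

lemma left_module_surj:
  assumes M: "left_module R M" and R': "ring R'" and Y: "abelian_group Y"
    and \<psi>: "\<psi> \<in> ring_hom R R'" "carrier R' \<subseteq> \<psi> ` carrier R"
    and p: "carrier Y = p ` carrier M"
      "\<And>x y. \<lbrakk>x \<in> carrier M; y \<in> carrier M\<rbrakk> \<Longrightarrow> p (x \<oplus>\<^bsub>M\<^esub> y) = p x \<oplus>\<^bsub>Y\<^esub> p y"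
      "\<And>a x. \<lbrakk>a \<in> carrier R; x \<in> carrier M\<rbrakk> \<Longrightarrow> p (a \<odot>\<^bsub>M\<^esub> x) = \<psi> a \<odot>\<^bsub>Y\<^esub> p x"
  shows "left_module R' Y"
proof -
  interpret left_module R M by fact
  have rep: "\<exists>b\<in>carrier R. a = \<psi> b" if "a \<in> carrier R'" for a using that \<psi>(2) by blast
  have rep': "\<exists>y\<in>carrier M. x = p y" if "x \<in> carrier Y" for x using that p(1) by blast
  note pull = p(2)[symmetric] p(3)[symmetric] ring_hom_add[OF \<psi>(1), symmetric]
    ring_hom_mult[OF \<psi>(1), symmetric] ring_hom_one[OF \<psi>(1), symmetric]
  show ?thesis
  proof (intro left_module.intro left_module_axioms.intro R' Y)
    fix a x assume "a \<in> carrier R'" "x \<in> carrier Y"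
    then show "a \<odot>\<^bsub>Y\<^esub> x \<in> carrier Y"
      using rep[of a] rep'[of x] p(1) by (auto simp: pull smult_closed)
  next
    fix a b x assume "a \<in> carrier R'" "b \<in> carrier R'" "x \<in> carrier Y"
    then show "(a \<oplus>\<^bsub>R'\<^esub> b) \<odot>\<^bsub>Y\<^esub> x = a \<odot>\<^bsub>Y\<^esub> x \<oplus>\<^bsub>Y\<^esub> b \<odot>\<^bsub>Y\<^esub> x"
      using rep[of a] rep[of b] rep'[of x] by (auto simp: pull smult_closed smult_l_distr)
  next
    fix a x y assume "a \<in> carrier R'" "x \<in> carrier Y" "y \<in> carrier Y"
    then show "a \<odot>\<^bsub>Y\<^esub> (x \<oplus>\<^bsub>Y\<^esub> y) = a \<odot>\<^bsub>Y\<^esub> x \<oplus>\<^bsub>Y\<^esub> a \<odot>\<^bsub>Y\<^esub> y"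
      using rep[of a] rep'[of x] rep'[of y] by (auto simp: pull smult_closed smult_r_distr)
  next
    fix a b x assume "a \<in> carrier R'" "b \<in> carrier R'" "x \<in> carrier Y"
    then show "(a \<otimes>\<^bsub>R'\<^esub> b) \<odot>\<^bsub>Y\<^esub> x = a \<odot>\<^bsub>Y\<^esub> (b \<odot>\<^bsub>Y\<^esub> x)"
      using rep[of a] rep[of b] rep'[of x] by (auto simp: pull smult_closed smult_assoc)
  next
    fix x assume "x \<in> carrier Y"
    then show "\<one>\<^bsub>R'\<^esub> \<odot>\<^bsub>Y\<^esub> x = x" using rep'[of x] by (auto simp: pull smult_one)
  qed
qed

text \<open>A map semilinear along \<phi> whose image generates the target. Generation is tested
  against all submodules \<open>G\<close>, so that it can be passed on by taking preimages.\<close>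

definition generating_map ::
  "('r, 'y) ring_scheme \<Rightarrow> ('r \<Rightarrow> 'a) \<Rightarrow> ('a, 'z) ring_scheme \<Rightarrow> ('r, 'm, 's) module_scheme \<Rightarrow>
    ('a, 'n, 't) module_scheme \<Rightarrow> ('m \<Rightarrow> 'n) \<Rightarrow> bool" where
  "generating_map R \<phi> A M X \<iota> \<longleftrightarrow>
     (\<forall>r \<in> carrier R. \<phi> r \<in> carrier A) \<and> (\<forall>x \<in> carrier M. \<iota> x \<in> carrier X) \<and>
     (\<forall>x \<in> carrier M. \<forall>y \<in> carrier M. \<iota> (x \<oplus>\<^bsub>M\<^esub> y) = \<iota> x \<oplus>\<^bsub>X\<^esub> \<iota> y) \<and>
     (\<forall>r \<in> carrier R. \<forall>x \<in> carrier M. \<iota> (r \<odot>\<^bsub>M\<^esub> x) = \<phi> r \<odot>\<^bsub>X\<^esub> \<iota> x) \<and>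
     (\<forall>G. submodule G A X \<longrightarrow> \<iota> ` carrier M \<subseteq> G \<longrightarrow> carrier X \<subseteq> G)"

lemma generating_map_vimage:
  assumes \<iota>: "generating_map R \<phi> A M X \<iota>" and M: "left_module R M" and X: "abelian_group X"
    and G: "submodule G A X"
  shows "submodule {x \<in> carrier M. \<iota> x \<in> G} R M"
proof -
  interpret M: left_module R M by fact
  interpret X: abelian_group X by fact
  interpret G: submodule G A X by fact
  interpret \<iota>: group_hom "add_monoid M" "add_monoid X" \<iota>
    using \<iota> unfolding generating_map_def by unfold_locales (auto simp: hom_def)
  have G_smult: "r \<in> carrier A \<Longrightarrow> x \<in> G \<Longrightarrow> r \<odot>\<^bsub>X\<^esub> x \<in> G" for r x by simp
  show ?thesis
  proof (intro submodule.intro submodule_axioms.intro group.subgroupI M.M.a_group)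
    show "{x \<in> carrier M. \<iota> x \<in> G} \<noteq> {}"
      using \<iota>.hom_one G.one_closed by fastforce
  next
    fix x assume "x \<in> {x \<in> carrier M. \<iota> x \<in> G}"
    then show "inv\<^bsub>add_monoid M\<^esub> x \<in> {x \<in> carrier M. \<iota> x \<in> G}"
      using \<iota>.hom_inv[of x] G.m_inv_closed[of "\<iota> x"] M.M.add.inv_closed[of x] by simp
  next
    fix x y assume "x \<in> {x \<in> carrier M. \<iota> x \<in> G}" "y \<in> {x \<in> carrier M. \<iota> x \<in> G}"
    then show "x \<otimes>\<^bsub>add_monoid M\<^esub> y \<in> {x \<in> carrier M. \<iota> x \<in> G}"
      using \<iota>.hom_mult[of x y] G.m_closed[of "\<iota> x" "\<iota> y"] by simp
  next
    fix a x assume "a \<in> carrier R" "x \<in> {x \<in> carrier M. \<iota> x \<in> G}"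
    then show "a \<odot>\<^bsub>M\<^esub> x \<in> {x \<in> carrier M. \<iota> x \<in> G}"
      using \<iota> unfolding generating_map_def by (auto intro: M.smult_closed G_smult)
  qed auto
qed

text \<open>A test submodule of the last module is pulled back along \<open>\<kappa>\<close> and
  then tested against \<open>\<iota>\<close>.\<close>

lemma generating_map_comp:
  assumes \<iota>: "generating_map R \<phi> A M X \<iota>" and \<kappa>: "generating_map A \<psi> B X Y \<kappa>"
    and X: "left_module A X" and Y: "abelian_group Y"
  shows "generating_map R (\<psi> \<circ> \<phi>) B M Y (\<kappa> \<circ> \<iota>)"
proof -
  have "carrier Y \<subseteq> G" if G: "submodule G B Y" and sub: "(\<kappa> \<circ> \<iota>) ` carrier M \<subseteq> G" for G
  proof -
    have "submodule {x \<in> carrier X. \<kappa> x \<in> G} A X" by (rule generating_map_vimage[OF \<kappa> X Y G])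
    moreover have "\<iota> ` carrier M \<subseteq> {x \<in> carrier X. \<kappa> x \<in> G}"
      using \<iota> sub unfolding generating_map_def by auto
    ultimately have "carrier X \<subseteq> {x \<in> carrier X. \<kappa> x \<in> G}" using \<iota> unfolding generating_map_def by blast
    then show ?thesis using \<kappa> G unfolding generating_map_def by blast
  qed
  then show ?thesis using \<iota> \<kappa> unfolding generating_map_def by auto
qed

lemma left_module_relabel:
  assumes M: "left_module R M" and f: "inj_on f (carrier M)"
  shows "left_module R (relabel f M)" and "generating_map R id R M (relabel f M) f"
proof -
  interpret left_module R M by fact
  let ?g = "inv_into (carrier M) f"
  have g: "?g (f x) = x" if "x \<in> carrier M" for x using inv_into_f_f[OF f that] .
  have carrier: "carrier (relabel f M) = f ` carrier M" by (simp add: relabel_def Let_def)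
  have zero: "\<zero>\<^bsub>relabel f M\<^esub> = f \<zero>\<^bsub>M\<^esub>" by (simp add: relabel_def Let_def)
  have add: "f (x \<oplus>\<^bsub>M\<^esub> y) = f x \<oplus>\<^bsub>relabel f M\<^esub> f y" if "x \<in> carrier M" "y \<in> carrier M" for x y
    using that by (simp add: relabel_def Let_def g)
  have smult: "f (a \<odot>\<^bsub>M\<^esub> x) = a \<odot>\<^bsub>relabel f M\<^esub> f x" if "x \<in> carrier M" for a x
    using that by (simp add: relabel_def Let_def g)
  have Y: "abelian_group (relabel f M)"
    by (rule abelian_group_surj[OF M.abelian_group_axioms carrier zero add])
  show "left_module R (relabel f M)"
    by (rule left_module_surj[where \<psi> = id and p = f, OF M R.ring_axioms Y])
      (auto simp: carrier add smult ring_hom_def)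
  show "generating_map R id R M (relabel f M) f"
    by (auto simp: generating_map_def carrier add smult)
qed

section \<open>The tensor product as a left module\<close>

text \<open>As \<phi> is multiplicative but may fail to be unital, \<phi>(1) is just an idempotent
  of \<open>A\<close>; \<open>P\<close> is the left ideal that it generates.\<close>

locale tensor_setup = A: ring A + M: left_module R M
  for A :: "('a, 'z) ring_scheme" and R :: "('r, 'y) ring_scheme" and M :: "('r, 'm) gmodule" +
  fixes A0 :: "int \<Rightarrow> 'a set" and \<phi> :: "'r \<Rightarrow> 'a"
  assumes \<phi>_closed: "r \<in> carrier R \<Longrightarrow> \<phi> r \<in> carrier A"
    and \<phi>_mult: "\<lbrakk>r \<in> carrier R; s \<in> carrier R\<rbrakk> \<Longrightarrow> \<phi> (r \<otimes>\<^bsub>R\<^esub> s) = \<phi> r \<otimes>\<^bsub>A\<^esub> \<phi> s"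
begin

definition P where "P = {h \<otimes>\<^bsub>A\<^esub> \<phi> \<one>\<^bsub>R\<^esub> | h. h \<in> carrier A}"
definition F where "F = free_Abelian_group (P \<times> carrier M)"
definition N where "N = generate F (tensor_rels A P R \<phi> M)"
definition q where "q f = N #>\<^bsub>F\<^esub> f"
definition act where "act a = frag_extend (\<lambda>(h, x). frag_of (a \<otimes>\<^bsub>A\<^esub> h, x))"
abbreviation X where "X \<equiv> tensor_module A A0 P R \<phi> M"

lemma \<phi>_one: "r \<in> carrier R \<Longrightarrow> \<phi> \<one>\<^bsub>R\<^esub> \<otimes>\<^bsub>A\<^esub> \<phi> r = \<phi> r" "r \<in> carrier R \<Longrightarrow> \<phi> r \<otimes>\<^bsub>A\<^esub> \<phi> \<one>\<^bsub>R\<^esub> = \<phi> r"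
  by (simp_all flip: \<phi>_mult)

lemma P_carrier: "h \<in> P \<Longrightarrow> h \<in> carrier A"
  by (auto simp: P_def \<phi>_closed)

lemma \<phi>_one_P: "\<phi> \<one>\<^bsub>R\<^esub> \<in> P"
  unfolding P_def by (rule CollectI, rule exI[of _ "\<one>\<^bsub>A\<^esub>"]) (simp add: \<phi>_closed)

lemma P_mult: "a \<in> carrier A \<Longrightarrow> h \<in> P \<Longrightarrow> a \<otimes>\<^bsub>A\<^esub> h \<in> P"
  unfolding P_def by (auto simp: \<phi>_closed simp flip: A.m_assoc)

lemma P_add: "g \<in> P \<Longrightarrow> h \<in> P \<Longrightarrow> g \<oplus>\<^bsub>A\<^esub> h \<in> P"
  unfolding P_def by (auto simp: \<phi>_closed simp flip: A.l_distr)

lemma P_\<phi>: "h \<in> P \<Longrightarrow> r \<in> carrier R \<Longrightarrow> h \<otimes>\<^bsub>A\<^esub> \<phi> r \<in> P"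
proof -
  assume "h \<in> P" and r: "r \<in> carrier R"
  then obtain h' where h': "h' \<in> carrier A" "h = h' \<otimes>\<^bsub>A\<^esub> \<phi> \<one>\<^bsub>R\<^esub>" by (auto simp: P_def)
  have "h \<otimes>\<^bsub>A\<^esub> \<phi> r = (h' \<otimes>\<^bsub>A\<^esub> \<phi> r) \<otimes>\<^bsub>A\<^esub> \<phi> \<one>\<^bsub>R\<^esub>"
    using h' r by (simp add: A.m_assoc \<phi>_closed \<phi>_one)
  then show ?thesis unfolding P_def using h'(1) r \<phi>_closed by blast
qed

lemma carrier_F: "f \<in> carrier F \<longleftrightarrow> Poly_Mapping.keys f \<subseteq> P \<times> carrier M"
  by (simp add: F_def)

lemma F_add: "f \<in> carrier F \<Longrightarrow> g \<in> carrier F \<Longrightarrow> f + g \<in> carrier F"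
  unfolding carrier_F using keys_add[of f g] by blast

lemma F_minus: "f \<in> carrier F \<Longrightarrow> - f \<in> carrier F"
  unfolding carrier_F by simp

lemma F_diff: "f \<in> carrier F \<Longrightarrow> g \<in> carrier F \<Longrightarrow> f - g \<in> carrier F"
  using F_add[OF _ F_minus, of f g] by simp

lemma F_frag_of: "h \<in> P \<Longrightarrow> x \<in> carrier M \<Longrightarrow> frag_of (h, x) \<in> carrier F"
  by (simp add: carrier_F)

interpretation F: comm_group F
  unfolding F_def by (rule abelian_free_Abelian_group)

lemma rels_F: "tensor_rels A P R \<phi> M \<subseteq> carrier F"
proof
  fix f assume "f \<in> tensor_rels A P R \<phi> M"
  then show "f \<in> carrier F"
    by induction (auto intro!: F_diff F_frag_of P_add P_\<phi> M.smult_closed)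
qed

lemma N_subgroup: "subgroup N F"
  unfolding N_def by (rule F.generate_is_subgroup[OF rels_F])

lemma N_F: "f \<in> N \<Longrightarrow> f \<in> carrier F"
  using subgroup.subset[OF N_subgroup] by auto

lemma N_rel: "f \<in> tensor_rels A P R \<phi> M \<Longrightarrow> f \<in> N"
  unfolding N_def by (rule generate.incl)

lemma N_0: "0 \<in> N"
  using subgroup.one_closed[OF N_subgroup] by (simp add: F_def)

lemma N_add: "f \<in> N \<Longrightarrow> g \<in> N \<Longrightarrow> f + g \<in> N"
  using subgroup.m_closed[OF N_subgroup, of f g] by (simp add: F_def)

lemma N_minus: "f \<in> N \<Longrightarrow> - f \<in> N"
  using subgroup.m_inv_closed[OF N_subgroup, of f] N_F[of f] by (simp add: F_def)

lemma N_diff: "f \<in> N \<Longrightarrow> g \<in> N \<Longrightarrow> f - g \<in> N"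
  using N_add[OF _ N_minus, of f g] by simp

lemma mem_q: "g \<in> q f \<longleftrightarrow> g - f \<in> N"
proof -
  have "q f = (\<lambda>n. n + f) ` N" by (auto simp: q_def r_coset_def F_def)
  then show ?thesis by (auto simp: image_iff intro: bexI[of _ "g - f"])
qed

lemma q_eq: "q f = q g \<longleftrightarrow> f - g \<in> N"
proof
  assume "q f = q g"
  moreover have "f \<in> q f" by (simp add: mem_q N_0)
  ultimately show "f - g \<in> N" by (simp add: mem_q)
next
  assume fg: "f - g \<in> N"
  have "h - f \<in> N \<longleftrightarrow> h - g \<in> N" for h
    using N_add[OF _ fg, of "h - f"] N_diff[OF _ fg, of "h - g"] by auto
  then show "q f = q g" by (auto simp: mem_q)
qed

lemma act_0: "act a 0 = 0" and act_diff: "act a (f - g) = act a f - act a g"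
  and act_add: "act a (f + g) = act a f + act a g" and act_minus: "act a (- f) = - act a f"
  and act_of: "act a (frag_of (h, x)) = frag_of (a \<otimes>\<^bsub>A\<^esub> h, x)"
  by (simp_all add: act_def frag_extend_diff frag_extend_add frag_extend_minus)

lemma F_induct [consumes 1, case_names zero one diff]:
  assumes "f \<in> carrier F" "Pr 0" "\<And>h x. \<lbrakk>h \<in> P; x \<in> carrier M\<rbrakk> \<Longrightarrow> Pr (frag_of (h, x))"
    and "\<And>f g. \<lbrakk>f \<in> carrier F; g \<in> carrier F; Pr f; Pr g\<rbrakk> \<Longrightarrow> Pr (f - g)"
  shows "Pr f"
proof -
  have "f \<in> carrier F \<and> Pr f"
    using assms(1)[unfolded carrier_F]
  proof (induction rule: frag_induction)
    case zero then show ?case using assms(2) by (simp add: carrier_F)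
  next
    case (one x) then show ?case using assms(3) by (auto intro: F_frag_of)
  next
    case (diff a b) then show ?case using assms(4) by (auto intro: F_diff)
  qed
  then show ?thesis ..
qed

lemma act_F: "f \<in> carrier F \<Longrightarrow> a \<in> carrier A \<Longrightarrow> act a f \<in> carrier F"
  by (induction rule: F_induct)
    (auto simp: act_0 act_of act_diff carrier_F[of 0] intro: F_frag_of P_mult F_diff)

text \<open>Left multiplication is additive and commutes with the right action, so each relation is
  sent to one of the same type.\<close>

lemma act_rel:
  assumes "f \<in> tensor_rels A P R \<phi> M" "a \<in> carrier A"
  shows "act a f \<in> tensor_rels A P R \<phi> M"
  using assms(1)
proof cases
  case (1 g h x)
  then show ?thesis using tensor_rels.intros(1)[OF P_mult[OF assms(2) 1(2)] P_mult[OF assms(2) 1(3)] 1(4)] assms(2)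
    by (simp add: act_diff act_of P_carrier A.r_distr)
next
  case (2 h x y)
  then show ?thesis using tensor_rels.intros(2)[OF P_mult[OF assms(2) 2(2)] 2(3,4)]
    by (simp add: act_diff act_of)
next
  case (3 h r x)
  then show ?thesis using tensor_rels.intros(3)[OF P_mult[OF assms(2) 3(2)] 3(3,4), where A = A and \<phi> = \<phi>] assms(2)
    by (simp add: act_diff act_of P_carrier \<phi>_closed A.m_assoc)
qed

lemma act_N: "f \<in> N \<Longrightarrow> a \<in> carrier A \<Longrightarrow> act a f \<in> N"
  unfolding N_def
proof (induction rule: generate.induct)
  case one then show ?case using N_0 by (simp add: F_def act_0 N_def)
next
  case (incl f) then show ?case by (intro generate.incl act_rel)
next
  case (inv f)
  then have "f \<in> carrier F" using rels_F by auto
  moreover have "- act a f \<in> generate F (tensor_rels A P R \<phi> M)"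
    using inv N_minus[OF N_rel[OF act_rel]] by (simp add: N_def)
  ultimately show ?case by (simp add: F_def act_minus)
next
  case (eng f g)
  then show ?case using N_add[of "act a f" "act a g"] by (simp add: F_def act_add N_def)
qed

lemma act_assoc: "\<lbrakk>f \<in> carrier F; a \<in> carrier A; b \<in> carrier A\<rbrakk> \<Longrightarrow> act (a \<otimes>\<^bsub>A\<^esub> b) f = act a (act b f)"
  by (induction rule: F_induct) (auto simp: act_0 act_diff act_of A.m_assoc P_carrier)

lemma act_one: "f \<in> carrier F \<Longrightarrow> act \<one>\<^bsub>A\<^esub> f = f"
  by (induction rule: F_induct) (auto simp: act_0 act_diff act_of P_carrier)

text \<open>The one module axiom that fails before passing to the quotient, because
  \<open>frag_of\<close> is not additive in the first component.\<close>

lemma act_add_left: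
  assumes "f \<in> carrier F" "a \<in> carrier A" "b \<in> carrier A"
  shows "act (a \<oplus>\<^bsub>A\<^esub> b) f - (act a f + act b f) \<in> N"
  using assms
proof (induction rule: F_induct)
  case zero then show ?case by (simp add: act_0 N_0)
next
  case (one h x)
  then show ?case using N_rel[OF tensor_rels.intros(1)[OF P_mult P_mult, of a h b h x]]
    by (simp add: act_of P_carrier A.l_distr diff_diff_eq)
next
  case (diff f g)
  then show ?case using N_diff[of "act (a \<oplus>\<^bsub>A\<^esub> b) f - (act a f + act b f)" "act (a \<oplus>\<^bsub>A\<^esub> b) g - (act a g + act b g)"]
    by (simp add: act_diff algebra_simps)
qed

lemma X_carrier: "carrier X = q ` carrier F"
  by (simp add: tensor_module_def Let_def carrier_FactGroup q_def[abs_def] flip: F_def N_def)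

lemma X_zero: "\<zero>\<^bsub>X\<^esub> = q 0"
proof -
  have "\<zero>\<^bsub>X\<^esub> = N" by (simp add: tensor_module_def Let_def flip: F_def N_def)
  also have "N = q 0" by (auto simp: mem_q)
  finally show ?thesis .
qed

lemma X_add: "f \<in> carrier F \<Longrightarrow> g \<in> carrier F \<Longrightarrow> q f \<oplus>\<^bsub>X\<^esub> q g = q (f + g)"
  using normal.rcos_sum[OF F.subgroup_imp_normal[OF N_subgroup], of f g]
  by (simp add: tensor_module_def Let_def q_def F_def[symmetric] N_def[symmetric]) (simp add: F_def)

lemma X_smult:
  assumes "f \<in> carrier F" "a \<in> carrier A"
  shows "a \<odot>\<^bsub>X\<^esub> q f = q (act a f)"
proof -
  have "(\<lambda>f. q (act a f)) ` q f = {q (act a f)}"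
  proof (intro equalityI subsetI)
    fix C assume "C \<in> (\<lambda>f. q (act a f)) ` q f"
    then obtain g where g: "g - f \<in> N" "C = q (act a g)" by (auto simp: mem_q)
    then show "C \<in> {q (act a f)}" using act_N[OF g(1) assms(2)] by (simp add: q_eq act_diff)
  next
    fix C assume "C \<in> {q (act a f)}"
    then show "C \<in> (\<lambda>f. q (act a f)) ` q f" using mem_q[of f f] N_0 by auto
  qed
  then show ?thesis
    by (simp add: tensor_module_def Let_def act_def q_def flip: F_def N_def)
qed

lemma X_group: "abelian_group X"
proof (rule abelian_groupI)
  fix x assume "x \<in> carrier X"
  then obtain f where f: "f \<in> carrier F" "x = q f" by (auto simp: X_carrier)
  then show "\<exists>y\<in>carrier X. y \<oplus>\<^bsub>X\<^esub> x = \<zero>\<^bsub>X\<^esub>"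
    by (intro bexI[of _ "q (- f)"]) (auto simp: X_carrier X_zero X_add F_minus)
qed (auto simp: X_carrier X_zero X_add F_add add_ac carrier_F[of 0])

lemma X_left_module: "left_module A X"
proof (intro left_module.intro left_module_axioms.intro A.ring_axioms X_group)
  fix a x assume "a \<in> carrier A" "x \<in> carrier X"
  then show "a \<odot>\<^bsub>X\<^esub> x \<in> carrier X" by (auto simp: X_smult X_carrier act_F)
next
  fix x assume "x \<in> carrier X"
  then show "\<one>\<^bsub>A\<^esub> \<odot>\<^bsub>X\<^esub> x = x" by (auto simp: X_carrier X_smult act_one)
next
  fix a b x assume "a \<in> carrier A" "b \<in> carrier A" "x \<in> carrier X"
  then show "(a \<oplus>\<^bsub>A\<^esub> b) \<odot>\<^bsub>X\<^esub> x = a \<odot>\<^bsub>X\<^esub> x \<oplus>\<^bsub>X\<^esub> b \<odot>\<^bsub>X\<^esub> x"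
    using act_add_left by (elim imageE[of x q "carrier F", folded X_carrier]) (simp add: X_smult X_add act_F q_eq)
next
  fix a b x assume "a \<in> carrier A" "b \<in> carrier A" "x \<in> carrier X"
  then show "(a \<otimes>\<^bsub>A\<^esub> b) \<odot>\<^bsub>X\<^esub> x = a \<odot>\<^bsub>X\<^esub> (b \<odot>\<^bsub>X\<^esub> x)"
    by (auto simp: X_carrier X_smult act_F act_assoc)
next
  fix a x y assume "a \<in> carrier A" "x \<in> carrier X" "y \<in> carrier X"
  then show "a \<odot>\<^bsub>X\<^esub> (x \<oplus>\<^bsub>X\<^esub> y) = a \<odot>\<^bsub>X\<^esub> x \<oplus>\<^bsub>X\<^esub> a \<odot>\<^bsub>X\<^esub> y"
    by (auto simp: X_carrier X_smult X_add act_F act_add F_add)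
qed

text \<open>Together with \<open>X_disjoint\<close> this will make \<open>encode\<close>
  injective.\<close>

lemma X_nonempty: "C \<in> carrier X \<Longrightarrow> C \<noteq> {}"
  using mem_q[of f f for f] N_0 by (auto simp: X_carrier)

lemma X_disjoint:
  assumes "C \<in> carrier X" "C' \<in> carrier X" "C \<inter> C' \<noteq> {}"
  shows "C = C'"
proof -
  obtain f g where fg: "C = q f" "C' = q g" using assms(1,2) by (auto simp: X_carrier)
  with assms(3) obtain h where "h - f \<in> N" "h - g \<in> N" by (auto simp: mem_q)
  then have "q h = q f" "q h = q g" by (simp_all add: q_eq)
  then show "C = C'" using fg by simp
qed

text \<open>Balancing moves a scalar r from the module to the left as \<phi>(r), since \<phi>(1) is
  a two-sided unit for the image of \<phi>. The image generates because each element of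
  \<open>P\<close> is a multiple of \<phi>(1) from the left.\<close>

lemma X_generating: "generating_map R \<phi> A M X (\<lambda>x. q (frag_of (\<phi> \<one>\<^bsub>R\<^esub>, x)))"
  unfolding generating_map_def
proof (intro conjI ballI allI impI)
  fix x y assume x: "x \<in> carrier M" and y: "y \<in> carrier M"
  show "q (frag_of (\<phi> \<one>\<^bsub>R\<^esub>, x)) \<in> carrier X" by (auto simp: X_carrier intro!: F_frag_of \<phi>_one_P x)
  show "q (frag_of (\<phi> \<one>\<^bsub>R\<^esub>, x \<oplus>\<^bsub>M\<^esub> y)) = q (frag_of (\<phi> \<one>\<^bsub>R\<^esub>, x)) \<oplus>\<^bsub>X\<^esub> q (frag_of (\<phi> \<one>\<^bsub>R\<^esub>, y))"
    using N_rel[OF tensor_rels.intros(2)[OF \<phi>_one_P x y]] x y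
    by (simp add: X_add F_frag_of \<phi>_one_P q_eq diff_diff_eq)
next
  fix r x assume r: "r \<in> carrier R" and x: "x \<in> carrier M"
  have "q (frag_of (\<phi> \<one>\<^bsub>R\<^esub>, r \<odot>\<^bsub>M\<^esub> x)) = q (frag_of (\<phi> \<one>\<^bsub>R\<^esub> \<otimes>\<^bsub>A\<^esub> \<phi> r, x))"
    using N_rel[OF tensor_rels.intros(3)[OF \<phi>_one_P r x]] by (subst eq_commute) (simp only: q_eq)
  then show "q (frag_of (\<phi> \<one>\<^bsub>R\<^esub>, r \<odot>\<^bsub>M\<^esub> x)) = \<phi> r \<odot>\<^bsub>X\<^esub> q (frag_of (\<phi> \<one>\<^bsub>R\<^esub>, x))"
    using r x by (simp add: X_smult F_frag_of \<phi>_one_P \<phi>_closed act_of \<phi>_one)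
next
  fix G assume G: "submodule G A X" and sub: "(\<lambda>x. q (frag_of (\<phi> \<one>\<^bsub>R\<^esub>, x))) ` carrier M \<subseteq> G"
  interpret X: abelian_group X by (rule X_group)
  have sg: "subgroup G (add_monoid X)" using G by (rule submodule.axioms)
  have "q f \<in> G" if "f \<in> carrier F" for f
    using that
  proof (induction rule: F_induct)
    case zero then show ?case using subgroup.one_closed[OF sg] by (simp add: X_zero)
  next
    case (one h x)
    then obtain h' where h': "h' \<in> carrier A" "h = h' \<otimes>\<^bsub>A\<^esub> \<phi> \<one>\<^bsub>R\<^esub>" by (auto simp: P_def)
    have "h' \<odot>\<^bsub>X\<^esub> q (frag_of (\<phi> \<one>\<^bsub>R\<^esub>, x)) \<in> G"
      using submodule.smult_closed[OF G h'(1)] sub one by auto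
    then show ?case using h' one by (simp add: X_smult F_frag_of \<phi>_one_P act_of)
  next
    case (diff f g)
    have "q f = q (f - g) \<oplus>\<^bsub>X\<^esub> q g" using diff by (simp add: X_add F_diff)
    then have "q (f - g) = q f \<ominus>\<^bsub>X\<^esub> q g"
      using diff imageI[of "f - g" "carrier F" q] imageI[of g "carrier F" q]
      by (simp add: X_carrier[symmetric] F_diff X.minus_eq X.a_assoc X.r_neg del: imageI)
    moreover have "q f \<ominus>\<^bsub>X\<^esub> q g \<in> G"
      using subgroup.m_closed[OF sg] subgroup.m_inv_closed[OF sg] diff
      unfolding X.minus_eq a_inv_def by simp
    ultimately show ?case by simp
  qed
  then show "carrier X \<subseteq> G" by (auto simp: X_carrier)
qed (rule \<phi>_closed)

end

section \<open>The quotient functor and the composite \<open>ad_E\<close>\<close>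

text \<open>The last two claims record that the elements are cosets, that is nonempty disjoint
  subsets of \<open>X\<close>; the injectivity of \<open>encode\<close> rests on them.\<close>

lemma pi_functor_properties:
  fixes X :: "(('i, 'k::comm_ring_1) klr_elem, 'm) gmodule"
  assumes X: "left_module (klr Q \<delta>) X"
  shows "left_module (cyc_klr Q i \<delta>) (pi_functor Q i \<delta> X)"
    and "\<exists>p. generating_map (klr Q \<delta>) (cyc_class Q i \<delta>) (cyc_klr Q i \<delta>) X (pi_functor Q i \<delta> X) p"
    and "\<And>D. D \<in> carrier (pi_functor Q i \<delta> X) \<Longrightarrow> D \<noteq> {} \<and> D \<subseteq> carrier X"
    and "\<And>D D'. \<lbrakk>D \<in> carrier (pi_functor Q i \<delta> X); D' \<in> carrier (pi_functor Q i \<delta> X); D \<inter> D' \<noteq> {}\<rbrakk> \<Longrightarrow> D = D'"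
proof -
  interpret X: left_module "klr Q \<delta>" X by fact
  define e where "e = last_idem Q i \<delta>"
  have e: "e \<in> carrier (klr Q \<delta>)" unfolding e_def by (rule last_idem_closed)
  define gens where "gens = {h \<odot>\<^bsub>X\<^esub> (e \<odot>\<^bsub>X\<^esub> x) | h x. h \<in> carrier (klr Q \<delta>) \<and> x \<in> carrier X}"
  define N where "N = generate (add_monoid X) gens"
  have N_eq: "pi_submodule Q i \<delta> X = N" by (simp add: pi_submodule_def N_def gens_def e_def)
  have gens: "gens \<subseteq> carrier X" using e by (auto simp: gens_def X.smult_closed)
  have N_sub: "subgroup N (add_monoid X)" unfolding N_def
    by (rule X.M.add.generate_is_subgroup) (use gens in simp)
  have N_carrier: "x \<in> N \<Longrightarrow> x \<in> carrier X" for x using subgroup.subset[OF N_sub] by auto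
  have N_add: "x \<in> N \<Longrightarrow> y \<in> N \<Longrightarrow> x \<oplus>\<^bsub>X\<^esub> y \<in> N" for x y
    using subgroup.m_closed[OF N_sub] by simp
  have N_minus: "x \<in> N \<Longrightarrow> \<ominus>\<^bsub>X\<^esub> x \<in> N" for x
    using subgroup.m_inv_closed[OF N_sub] by (simp add: a_inv_def)
  have N_zero: "\<zero>\<^bsub>X\<^esub> \<in> N" using subgroup.one_closed[OF N_sub] by simp
  have N_smult: "a \<odot>\<^bsub>X\<^esub> x \<in> N" if "x \<in> N" and a: "a \<in> carrier (klr Q \<delta>)" for a x
    using that(1) unfolding N_def
  proof (induction rule: generate.induct)
    case one then show ?case using X.smult_r_zero[OF a] N_zero by (simp add: N_def)
  next
    case (incl y)
    then obtain h x where hx: "h \<in> carrier (klr Q \<delta>)" "x \<in> carrier X" "y = h \<odot>\<^bsub>X\<^esub> (e \<odot>\<^bsub>X\<^esub> x)"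
      by (auto simp: gens_def)
    have "a \<odot>\<^bsub>X\<^esub> y = (a \<otimes>\<^bsub>klr Q \<delta>\<^esub> h) \<odot>\<^bsub>X\<^esub> (e \<odot>\<^bsub>X\<^esub> x)"
      using a hx e by (simp add: X.smult_assoc X.smult_closed)
    then have "a \<odot>\<^bsub>X\<^esub> y \<in> gens" using a hx unfolding gens_def by blast
    then show ?case by (rule generate.incl)
  next
    case (inv y)
    then obtain h x where hx: "h \<in> carrier (klr Q \<delta>)" "x \<in> carrier X" "y = h \<odot>\<^bsub>X\<^esub> (e \<odot>\<^bsub>X\<^esub> x)"
      by (auto simp: gens_def)
    have "a \<odot>\<^bsub>X\<^esub> y = (a \<otimes>\<^bsub>klr Q \<delta>\<^esub> h) \<odot>\<^bsub>X\<^esub> (e \<odot>\<^bsub>X\<^esub> x)"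
      using a hx e by (simp add: X.smult_assoc X.smult_closed)
    then have "a \<odot>\<^bsub>X\<^esub> y \<in> gens" using a hx unfolding gens_def by blast
    then have "a \<odot>\<^bsub>X\<^esub> y \<in> N" unfolding N_def by (rule generate.incl)
    moreover have "y \<in> carrier X" using inv gens by auto
    ultimately show ?case using N_minus[of "a \<odot>\<^bsub>X\<^esub> y"] X.smult_r_minus[OF a, of y]
      by (simp add: N_def a_inv_def)
  next
    case (eng x y)
    then show ?case using X.smult_r_distr[OF a N_carrier N_carrier, of x y] N_add[of "a \<odot>\<^bsub>X\<^esub> x" "a \<odot>\<^bsub>X\<^esub> y"]
      by (simp add: N_def)
  qed
  have cyc_N: "c \<odot>\<^bsub>X\<^esub> x \<in> N" if c: "c \<in> cyc_ideal Q i \<delta>" and x: "x \<in> carrier X" for c x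
  proof -
    \<comment> \<open>The scalars that move all of \<open>X\<close> into \<open>N\<close> form an
      ideal, and it contains the generator of \<open>cyc_ideal\<close>.\<close>
    let ?K = "{r \<in> carrier (klr Q \<delta>). \<forall>x \<in> carrier X. r \<odot>\<^bsub>X\<^esub> x \<in> N}"
    have "ideal ?K (klr Q \<delta>)"
    proof (intro idealI ring_klr group.subgroupI X.R.a_group)
      show "?K \<noteq> {}" using X.smult_l_zero N_zero by force
    next
      fix r assume "r \<in> ?K"
      then show "inv\<^bsub>add_monoid (klr Q \<delta>)\<^esub> r \<in> ?K"
        using X.smult_l_minus[of r] N_minus X.R.a_inv_closed[of r] by (simp add: a_inv_def)
    next
      fix r s assume "r \<in> ?K" "s \<in> ?K"
      then show "r \<otimes>\<^bsub>add_monoid (klr Q \<delta>)\<^esub> s \<in> ?K" by (simp add: X.smult_l_distr N_add)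
    next
      fix r s assume "r \<in> ?K" "s \<in> carrier (klr Q \<delta>)"
      then show "s \<otimes>\<^bsub>klr Q \<delta>\<^esub> r \<in> ?K" "r \<otimes>\<^bsub>klr Q \<delta>\<^esub> s \<in> ?K"
        by (simp_all add: X.smult_assoc N_smult X.smult_closed)
    qed auto
    moreover have "e \<odot>\<^bsub>X\<^esub> x \<in> N" if "x \<in> carrier X" for x
    proof -
      have "e \<odot>\<^bsub>X\<^esub> x = \<one>\<^bsub>klr Q \<delta>\<^esub> \<odot>\<^bsub>X\<^esub> (e \<odot>\<^bsub>X\<^esub> x)" using that e by (simp add: X.smult_one X.smult_closed)
      then have "e \<odot>\<^bsub>X\<^esub> x \<in> gens" unfolding gens_def using that X.R.one_closed by blast
      then show ?thesis unfolding N_def by (rule generate.incl)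
    qed
    ultimately have "cyc_ideal Q i \<delta> \<subseteq> ?K"
      unfolding cyc_ideal_def e_def[symmetric] using e by (intro X.R.genideal_minimal) auto
    then show ?thesis using c x by auto
  qed
  interpret N: abelian_subgroup N X
    by (intro abelian_subgroupI3 additive_subgroup.intro N_sub X.M.abelian_group_axioms)
  interpret C: ideal "cyc_ideal Q i \<delta>" "klr Q \<delta>" by (rule ideal_cyc)
  let ?Y = "pi_functor Q i \<delta> X"
  define p where "p x = N +>\<^bsub>X\<^esub> x" for x
  have carrier: "carrier ?Y = p ` carrier X"
    by (simp add: pi_functor_def Let_def N_eq A_RCOSETS_def' p_def image_def) blast
  have zero: "\<zero>\<^bsub>?Y\<^esub> = p \<zero>\<^bsub>X\<^esub>"
    by (simp add: pi_functor_def Let_def N_eq p_def N.a_rcos_const N_zero)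
  have add: "p (x \<oplus>\<^bsub>X\<^esub> y) = p x \<oplus>\<^bsub>?Y\<^esub> p y" if "x \<in> carrier X" "y \<in> carrier X" for x y
    using N.a_rcos_sum[OF that] by (simp add: pi_functor_def Let_def N_eq p_def)
  have smult: "p (h \<odot>\<^bsub>X\<^esub> x) = cyc_class Q i \<delta> h \<odot>\<^bsub>?Y\<^esub> p x" if h: "h \<in> carrier (klr Q \<delta>)" and x: "x \<in> carrier X" for h x
  proof -
    have "(\<lambda>(h, x). p (h \<odot>\<^bsub>X\<^esub> x)) ` (cyc_class Q i \<delta> h \<times> p x) = {p (h \<odot>\<^bsub>X\<^esub> x)}"
    proof (intro equalityI subsetI)
      fix z assume "z \<in> (\<lambda>(h, x). p (h \<odot>\<^bsub>X\<^esub> x)) ` (cyc_class Q i \<delta> h \<times> p x)"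
      then obtain h' x' where "h' \<in> cyc_class Q i \<delta> h" "x' \<in> p x" and z: "z = p (h' \<odot>\<^bsub>X\<^esub> x')" by auto
      then obtain c n where c: "c \<in> cyc_ideal Q i \<delta>" "h' = c \<oplus>\<^bsub>klr Q \<delta>\<^esub> h" and n: "n \<in> N" "x' = n \<oplus>\<^bsub>X\<^esub> x"
        by (auto simp: cyc_class_def p_def a_r_coset_def')
      have c': "c \<in> carrier (klr Q \<delta>)" using c(1) C.a_subset by auto
      have n': "n \<in> carrier X" by (rule N_carrier[OF n(1)])
      \<comment> \<open>Changing representatives alters the product by \<open>c x'\<close>, which
        lies in \<open>N\<close> by \<open>cyc_N\<close>, and by \<open>h n\<close>, which does so
        because \<open>N\<close> is stable under scalars.\<close>
      have "h' \<odot>\<^bsub>X\<^esub> x' = (c \<odot>\<^bsub>X\<^esub> x' \<oplus>\<^bsub>X\<^esub> h \<odot>\<^bsub>X\<^esub> n) \<oplus>\<^bsub>X\<^esub> h \<odot>\<^bsub>X\<^esub> x"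
        using c n h x c' n' by (simp add: X.smult_l_distr X.smult_r_distr X.smult_closed X.M.a_assoc X.M.a_lcomm)
      moreover have "c \<odot>\<^bsub>X\<^esub> x' \<oplus>\<^bsub>X\<^esub> h \<odot>\<^bsub>X\<^esub> n \<in> N"
        using cyc_N[OF c(1), of x'] N_smult[OF n(1) h] n(2) n' x by (intro N_add) auto
      ultimately have "h' \<odot>\<^bsub>X\<^esub> x' \<in> N +>\<^bsub>X\<^esub> (h \<odot>\<^bsub>X\<^esub> x)" unfolding a_r_coset_def' by blast
      then have "p (h \<odot>\<^bsub>X\<^esub> x) = z" unfolding z p_def
        using N.a_repr_independence' h x X.smult_closed by blast
      then show "z \<in> {p (h \<odot>\<^bsub>X\<^esub> x)}" by simp
    next
      fix z assume "z \<in> {p (h \<odot>\<^bsub>X\<^esub> x)}"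
      moreover have "h \<in> cyc_class Q i \<delta> h" unfolding cyc_class_def by (rule C.a_rcos_self[OF h])
      moreover have "x \<in> p x" unfolding p_def by (rule N.a_rcos_self[OF x])
      ultimately show "z \<in> (\<lambda>(h, x). p (h \<odot>\<^bsub>X\<^esub> x)) ` (cyc_class Q i \<delta> h \<times> p x)" by force
    qed
    then show ?thesis by (simp add: pi_functor_def Let_def N_eq p_def)
  qed
  have surj: "carrier (cyc_klr Q i \<delta>) \<subseteq> cyc_class Q i \<delta> ` carrier (klr Q \<delta>)"
    by (auto elim: cyc_carrierE)
  show Y: "left_module (cyc_klr Q i \<delta>) ?Y"
    by (rule left_module_surj[OF X ring_cyc abelian_group_surj[OF X.M.abelian_group_axioms carrier zero add]
          cyc_class_hom surj carrier add smult])
  have "generating_map (klr Q \<delta>) (cyc_class Q i \<delta>) (cyc_klr Q i \<delta>) X ?Y p"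
    unfolding generating_map_def using ring_hom_closed[OF cyc_class_hom]
    by (auto simp: add smult carrier)
  then show "\<exists>p. generating_map (klr Q \<delta>) (cyc_class Q i \<delta>) (cyc_klr Q i \<delta>) X ?Y p" by (rule exI[of _ p])
  show "D \<noteq> {} \<and> D \<subseteq> carrier X" if D: "D \<in> carrier ?Y" for D
  proof -
    obtain x where x: "x \<in> carrier X" "D = N +>\<^bsub>X\<^esub> x" using D by (auto simp: carrier p_def)
    then show ?thesis using N.a_rcos_self[OF x(1)] N.a_elemrcos_carrier[OF x(1)] by auto
  qed
  show "D = D'" if DD: "D \<in> carrier ?Y" "D' \<in> carrier ?Y" "D \<inter> D' \<noteq> {}" for D D'
  proof -
    obtain x y where "x \<in> carrier X" "D = N +>\<^bsub>X\<^esub> x" "y \<in> carrier X" "D' = N +>\<^bsub>X\<^esub> y"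
      using DD(1,2) by (auto simp: carrier p_def)
    then show ?thesis using DD(3) N.a_repr_independence'[of _ x] N.a_repr_independence'[of _ y] by blast
  qed
qed

lemma left_module_inflate:
  assumes X: "left_module (cyc_klr Q i \<beta>) X"
  shows "left_module (klr Q \<beta>) (inflate Q i \<beta> X)"
proof -
  interpret X: left_module "cyc_klr Q i \<beta>" X by fact
  note hom = cyc_class_hom[of Q i \<beta>]
  have Y: "abelian_group (inflate Q i \<beta> X)"
    by (rule abelian_group_surj[OF X.M.abelian_group_axioms, where p = id]) (simp_all add: inflate_def)
  show ?thesis
    by (intro left_module.intro left_module_axioms.intro ring_klr Y)
      (simp_all add: inflate_def X.smult_closed X.smult_l_distr X.smult_r_distr X.smult_assoc X.smult_one
        ring_hom_closed[OF hom] ring_hom_add[OF hom] ring_hom_mult[OF hom] ring_hom_one[OF hom])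
qed

text \<open>Scalars of the quotient ring lift to \<open>klr Q \<beta>\<close>, so stability under
  the latter suffices. It converts a pulled-back test submodule into one over the quotient
  ring.\<close>

lemma submodule_inflate:
  assumes "submodule G (klr Q \<beta>) (inflate Q i \<beta> X)"
  shows "submodule G (cyc_klr Q i \<beta>) X"
proof (intro submodule.intro submodule_axioms.intro)
  show "subgroup G (add_monoid X)"
    using submodule.axioms(1)[OF assms] by (simp add: subgroup_def m_inv_def inflate_def)
  fix a x assume "a \<in> carrier (cyc_klr Q i \<beta>)" "x \<in> G"
  then show "a \<odot>\<^bsub>X\<^esub> x \<in> G"
    using submodule.smult_closed[OF assms] by (elim cyc_carrierE) (auto simp: inflate_def)
qed

text \<open>The map is composed of those for the tensor product, the quotient and the relabelling;
  its scalar map determines what happens to idempotents.\<close>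

lemma ad_E_generating:
  fixes ip :: "'i \<Rightarrow> 'i \<Rightarrow> int" and Q :: "'i \<Rightarrow> 'i \<Rightarrow> 'k::comm_ring_1 poly2"
    and X :: "(('i, 'k) cyc_elem, (('i, 'k) klr_elem, 'm) univ) gmodule"
  assumes X: "left_module (cyc_klr Q i \<beta>) X"
  defines "Y \<equiv> relabel encode (pi_functor Q i ({#i#} + \<beta>) (E_functor ip Q i \<beta> (inflate Q i \<beta> X)))"
  shows "left_module (cyc_klr Q i ({#i#} + \<beta>)) Y"
    and "\<exists>\<iota>. generating_map (klr Q \<beta>)
      (cyc_class Q i ({#i#} + \<beta>) \<circ> klr_diamond Q {#i#} \<beta> \<one>\<^bsub>klr Q {#i#}\<^esub>)
      (cyc_klr Q i ({#i#} + \<beta>)) (inflate Q i \<beta> X) Y \<iota>"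
proof -
  let ?\<delta> = "{#i#} + \<beta>" and ?\<phi> = "klr_diamond Q {#i#} \<beta> \<one>\<^bsub>klr Q {#i#}\<^esub>"
  interpret tensor_setup "klr Q ?\<delta>" "klr Q \<beta>" "inflate Q i \<beta> X" "klr_homog ip Q ?\<delta>" ?\<phi>
    by (intro tensor_setup.intro tensor_setup_axioms.intro ring_klr left_module_inflate X
        klr_diamond_one_closed klr_diamond_one_mult)
  let ?T = "E_functor ip Q i \<beta> (inflate Q i \<beta> X)"
  have T: "?T = tensor_module (klr Q ?\<delta>) (klr_homog ip Q ?\<delta>) P (klr Q \<beta>) ?\<phi> (inflate Q i \<beta> X)"
    by (simp only: E_functor_def Let_def P_def)
  note T_module = X_left_module[folded T] and T_gen = X_generating[folded T]
    and T_disj = X_disjoint[folded T] and T_nonempty = X_nonempty[folded T]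
  let ?W = "pi_functor Q i ?\<delta> ?T"
  note pi = pi_functor_properties[OF T_module, where i = i]
  \<comment> \<open>An element of the quotient is a set of cosets of the tensor relations. Distinct
    elements share no coset, and distinct cosets are disjoint, so the unions are disjoint
    too.\<close>
  have inj: "inj_on encode (carrier ?W)"
  proof (rule inj_on_encode)
    show "\<Union>D \<noteq> {}" if D: "D \<in> carrier ?W" for D
    proof -
      obtain C where "C \<in> D" "C \<in> carrier ?T" using pi(3)[OF D] by blast
      then show ?thesis using T_nonempty by blast
    qed
    show "\<Union>D \<inter> \<Union>D' = {}" if D: "D \<in> carrier ?W" "D' \<in> carrier ?W" "D \<noteq> D'" for D D'
    proof (rule ccontr)
      assume "\<Union>D \<inter> \<Union>D' \<noteq> {}"
      then obtain C C' where C: "C \<in> D" "C' \<in> D'" "C \<inter> C' \<noteq> {}" by blast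
      moreover have "C \<in> carrier ?T" "C' \<in> carrier ?T" using C pi(3) D by blast+
      ultimately have "C = C'" by (intro T_disj)
      then show False using C pi(4)[OF D(1,2)] D(3) by blast
    qed
  qed
  show "left_module (cyc_klr Q i ?\<delta>) Y"
    unfolding Y_def by (rule left_module_relabel(1)[OF pi(1) inj])
  then have Y_group: "abelian_group Y" by (rule left_module.axioms(2))
  obtain p where p: "generating_map (klr Q ?\<delta>) (cyc_class Q i ?\<delta>) (cyc_klr Q i ?\<delta>) ?T ?W p"
    using pi(2) by blast
  have "generating_map (klr Q \<beta>) (id \<circ> (cyc_class Q i ?\<delta> \<circ> ?\<phi>)) (cyc_klr Q i ?\<delta>) (inflate Q i \<beta> X) Y
      (encode \<circ> (p \<circ> (\<lambda>x. q (frag_of (?\<phi> \<one>\<^bsub>klr Q \<beta>\<^esub>, x)))))"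
    by (intro generating_map_comp[OF generating_map_comp[OF T_gen p T_module left_module.axioms(2)[OF pi(1)]]
          left_module_relabel(2)[OF pi(1) inj, folded Y_def] pi(1) Y_group])
  then show "\<exists>\<iota>. generating_map (klr Q \<beta>) (cyc_class Q i ?\<delta> \<circ> ?\<phi>) (cyc_klr Q i ?\<delta>) (inflate Q i \<beta> X) Y \<iota>"
    unfolding id_comp by blast
qed

section \<open>Generation by vectors fixed by idempotents\<close>

text \<open>The invariant of the iteration: n counts the applications of \<open>ad_E\<close>, and
  \<open>W\<close> is one set of words for all weights, from which the condition on \<gamma>
  selects.\<close>

definition idem_generated :: "('i \<Rightarrow> 'i \<Rightarrow> 'k::comm_ring_1 poly2) \<Rightarrow> 'i \<Rightarrow> nat \<Rightarrow> 'i list set \<Rightarrow>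
    'i multiset \<Rightarrow> (('i, 'k) cyc_elem, 'm) gmodule \<Rightarrow> bool" where
  "idem_generated Q i n W \<gamma> X \<longleftrightarrow> (\<forall>G. submodule G (cyc_klr Q i \<gamma>) X \<longrightarrow>
     {v \<in> carrier X. \<exists>\<nu> \<in> W. replicate n i @ \<nu> \<in> seqs \<gamma> \<and>
        cyc_class Q i \<gamma> (klr_class Q \<gamma> (egen (replicate n i @ \<nu>))) \<odot>\<^bsub>X\<^esub> v = v} \<subseteq> G \<longrightarrow> carrier X \<subseteq> G)"

lemma idem_generated_zero:
  assumes "carrier X = {\<zero>\<^bsub>X\<^esub>}"
  shows "idem_generated Q i n W \<gamma> X"
  using assms subgroup.one_closed[OF submodule.axioms(1)] by (fastforce simp: idem_generated_def)

text \<open>A vector is the sum of its components \<open>1_\<nu> v\<close>, and each of them is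
  fixed by its idempotent.\<close>

lemma idem_generated_0:
  assumes X: "left_module (cyc_klr Q i \<gamma>) X" and W: "seqs \<gamma> \<subseteq> W"
  shows "idem_generated Q i 0 W \<gamma> X"
  unfolding idem_generated_def
proof (intro allI impI subsetI)
  interpret X: left_module "cyc_klr Q i \<gamma>" X by fact
  interpret klr_congruence \<gamma> "klr_ideal Q \<gamma>" Q by (rule klr_congruence_ideal)
  note hom = cyc_class_hom[of Q i \<gamma>]
  let ?c = "\<lambda>f. cyc_class Q i \<gamma> (klr_class Q \<gamma> f)"
  have c_closed: "?c f \<in> carrier (cyc_klr Q i \<gamma>)" if "f \<in> S" for f
    using that by (intro ring_hom_closed[OF hom] klr_class_closed)
  have c_add: "?c (f + g) = ?c f \<oplus>\<^bsub>cyc_klr Q i \<gamma>\<^esub> ?c g" if "f \<in> S" "g \<in> S" for f g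
    using that by (simp add: klr_class_add ring_hom_add[OF hom] klr_class_closed)
  have c_mult: "?c (f * g) = ?c f \<otimes>\<^bsub>cyc_klr Q i \<gamma>\<^esub> ?c g" if "f \<in> S" "g \<in> S" for f g
    using that by (simp add: klr_class_mult ring_hom_mult[OF hom] klr_class_closed)
  have c_one: "?c 1 = \<one>\<^bsub>cyc_klr Q i \<gamma>\<^esub>" by (simp add: klr_class_1 ring_hom_one[OF hom])
  have c_eq: "?c f = ?c g" if "f \<in> S" "g \<in> S" "f - g \<in> klr_ideal Q \<gamma>" for f g
    using klr_class_eqI[of f \<gamma> g Q] that by simp
  fix G v assume G: "submodule G (cyc_klr Q i \<gamma>) X"
    and sub: "{v \<in> carrier X. \<exists>\<nu> \<in> W. replicate 0 i @ \<nu> \<in> seqs \<gamma> \<and> ?c (egen (replicate 0 i @ \<nu>)) \<odot>\<^bsub>X\<^esub> v = v} \<subseteq> G"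
    and v: "v \<in> carrier X"
  have sg: "subgroup G (add_monoid X)" using G by (rule submodule.axioms)
  have "?c (sum egen A) \<odot>\<^bsub>X\<^esub> v \<in> G" if "finite A" "A \<subseteq> seqs \<gamma>" for A
    using that
  proof (induction A rule: finite_induct)
    case empty
    have "?c 0 \<oplus>\<^bsub>cyc_klr Q i \<gamma>\<^esub> ?c 0 = ?c 0" using c_add[OF fa_0 fa_0] by simp
    then have "?c 0 = \<zero>\<^bsub>cyc_klr Q i \<gamma>\<^esub>"
      using X.R.add.l_cancel_one[OF c_closed[OF fa_0] c_closed[OF fa_0]] by simp
    then show ?case using X.smult_l_zero[OF v] subgroup.one_closed[OF sg] by simp
  next
    case (insert \<nu> A)
    have S: "egen \<nu> \<in> S" "sum egen A \<in> S" using insert.prems by (auto intro!: fa_sum e_S)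
    have "?c (egen \<nu>) \<odot>\<^bsub>X\<^esub> (?c (egen \<nu>) \<odot>\<^bsub>X\<^esub> v) = ?c (egen \<nu>) \<odot>\<^bsub>X\<^esub> v"
      using c_eq[OF fa_mult[OF S(1) S(1)] S(1)] rel_idem_orth[of \<nu> \<nu>, unfolded cong_def] insert.prems
      by (simp add: v c_closed S c_mult flip: X.smult_assoc)
    then have "?c (egen \<nu>) \<odot>\<^bsub>X\<^esub> v \<in> G"
      using sub insert.prems W X.smult_closed[OF c_closed[OF S(1)] v] by auto
    then show ?case
      using insert subgroup.m_closed[OF sg] by (simp add: c_add S X.smult_l_distr c_closed v)
  qed
  from this[OF finite_seqs order.refl] have "?c (sum egen (seqs \<gamma>)) \<odot>\<^bsub>X\<^esub> v \<in> G" .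
  also have "?c (sum egen (seqs \<gamma>)) = ?c 1"
    by (intro c_eq fa_sum e_S fa_1 rel_idem_sum[unfolded cong_def])
  finally show "v \<in> G" using v by (simp add: c_one X.smult_one)
qed

text \<open>By semilinearity a vector fixed by the idempotent of \<open>i^n \<nu>\<close> is mapped
  to one fixed by that of \<open>i^{n+1} \<nu>\<close>. A test submodule is pulled back to the
  previous module, where the hypothesis applies.\<close>

lemma idem_generated_Suc:
  fixes ip :: "'i \<Rightarrow> 'i \<Rightarrow> int" and Q :: "'i \<Rightarrow> 'i \<Rightarrow> 'k::comm_ring_1 poly2"
    and X :: "(('i, 'k) cyc_elem, (('i, 'k) klr_elem, 'm) univ) gmodule"
  assumes X: "left_module (cyc_klr Q i \<beta>) X" and gen: "idem_generated Q i n W \<beta> X"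
  defines "Y \<equiv> relabel encode (pi_functor Q i ({#i#} + \<beta>) (E_functor ip Q i \<beta> (inflate Q i \<beta> X)))"
  shows "idem_generated Q i (Suc n) W ({#i#} + \<beta>) Y"
  unfolding idem_generated_def
proof (intro allI impI)
  let ?\<delta> = "{#i#} + \<beta>" and ?\<phi> = "klr_diamond Q {#i#} \<beta> \<one>\<^bsub>klr Q {#i#}\<^esub>"
  let ?c = "\<lambda>\<gamma> f. cyc_class Q i \<gamma> (klr_class Q \<gamma> f)"
  fix G assume G: "submodule G (cyc_klr Q i ?\<delta>) Y"
    and sub: "{v \<in> carrier Y. \<exists>\<nu> \<in> W. replicate (Suc n) i @ \<nu> \<in> seqs ?\<delta> \<and>
        ?c ?\<delta> (egen (replicate (Suc n) i @ \<nu>)) \<odot>\<^bsub>Y\<^esub> v = v} \<subseteq> G"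
  obtain \<iota> where \<iota>: "generating_map (klr Q \<beta>) (cyc_class Q i ?\<delta> \<circ> ?\<phi>) (cyc_klr Q i ?\<delta>) (inflate Q i \<beta> X) Y \<iota>"
    using ad_E_generating(2)[OF X, of ip] unfolding Y_def by blast
  let ?G' = "{x \<in> carrier (inflate Q i \<beta> X). \<iota> x \<in> G}"
  have "submodule ?G' (klr Q \<beta>) (inflate Q i \<beta> X)"
    using ad_E_generating(1)[OF X, of ip] unfolding Y_def[symmetric]
    by (intro generating_map_vimage[OF \<iota> left_module_inflate[OF X] _ G]) (rule left_module.axioms(2))
  then have "submodule ?G' (cyc_klr Q i \<beta>) X" by (rule submodule_inflate)
  moreover have "{v \<in> carrier X. \<exists>\<nu> \<in> W. replicate n i @ \<nu> \<in> seqs \<beta> \<and>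
        ?c \<beta> (egen (replicate n i @ \<nu>)) \<odot>\<^bsub>X\<^esub> v = v} \<subseteq> ?G'"
  proof clarify
    fix v \<nu> assume v: "v \<in> carrier X" and \<nu>: "\<nu> \<in> W" "replicate n i @ \<nu> \<in> seqs \<beta>"
      and fixed: "?c \<beta> (egen (replicate n i @ \<nu>)) \<odot>\<^bsub>X\<^esub> v = v"
    interpret klr_congruence \<beta> "klr_ideal Q \<beta>" Q by (rule klr_congruence_ideal)
    have v': "v \<in> carrier (inflate Q i \<beta> X)" using v by (simp add: inflate_def)
    have "klr_class Q \<beta> (egen (replicate n i @ \<nu>)) \<odot>\<^bsub>inflate Q i \<beta> X\<^esub> v = v"
      using fixed by (simp add: inflate_def)
    moreover have "klr_class Q \<beta> (egen (replicate n i @ \<nu>)) \<in> carrier (klr Q \<beta>)"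
      by (intro klr_class_closed e_S \<nu>)
    ultimately have "\<iota> v = ?c ?\<delta> (egen (replicate (Suc n) i @ \<nu>)) \<odot>\<^bsub>Y\<^esub> \<iota> v"
      using \<iota> v' klr_diamond_idem[OF \<nu>(2), of Q i] unfolding generating_map_def
      by (metis append_Cons comp_apply replicate_Suc)
    moreover have "\<iota> v \<in> carrier Y" using \<iota> v' by (simp add: generating_map_def)
    moreover have "replicate (Suc n) i @ \<nu> \<in> seqs ?\<delta>" using \<nu>(2) by (auto simp: seqs_def)
    ultimately have "\<iota> v \<in> G"
      by (intro subsetD[OF sub] CollectI conjI bexI[OF _ \<nu>(1)]) (simp_all only:)
    with v' show "v \<in> carrier (inflate Q i \<beta> X) \<and> \<iota> v \<in> G" ..
  qed
  ultimately have "carrier X \<subseteq> ?G'" using gen unfolding idem_generated_def by blast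
  then have "\<iota> ` carrier (inflate Q i \<beta> X) \<subseteq> G" by (auto simp: inflate_def)
  then show "carrier Y \<subseteq> G" using \<iota> G unfolding generating_map_def by blast
qed

lemma trivial_left_module:
  assumes "ring R"
  shows "left_module R (trivial_module z)"
proof -
  have "abelian_group (trivial_module z)"
    by (rule abelian_groupI) (simp_all add: trivial_module_def)
  then show ?thesis
    by (intro left_module.intro left_module_axioms.intro assms) (simp_all add: trivial_module_def)
qed

theorem corollary4p25:
  fixes ip :: "'i \<Rightarrow> 'i \<Rightarrow> int"
    and t :: "'i \<Rightarrow> 'i \<Rightarrow> 'k::comm_ring_1"
    and Q :: "'i \<Rightarrow> 'i \<Rightarrow> 'k poly2"
    and i :: 'i
    and M :: "'i multiset \<Rightarrow> (('i, 'k) cyc_elem, 'm) gmodule"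
  assumes "klr_datum ip t Q"
    and "M \<in> cyc_cat ip Q i"
  shows "\<exists>n. \<forall>\<beta>. zero_module ((ad_E ip Q i ^^ n) (\<lambda>\<beta>. relabel Base (M \<beta>)) \<beta>)"
proof -
  \<comment> \<open>Finitely many weights occur in \<open>M\<close>, each with finitely many words,
    so the degrees of the words in \<open>W\<close> have a common bound.\<close>
  define W where "W = (\<Union>\<beta>\<in>{\<beta>. \<not> zero_module (M \<beta>)}. seqs \<beta>)"
  have "finite W" using assms(2) by (auto simp: W_def cyc_cat_def finite_seqs)
  then obtain b where b: "annihilator_degree ip i \<nu> \<le> b" if "\<nu> \<in> W" for \<nu>
    using finite_nat_set_iff_bounded_le[of "annihilator_degree ip i ` W"] by auto
  have M: "left_module (cyc_klr Q i \<beta>) (M \<beta>)" for \<beta>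
    using assms(2) by (auto simp: cyc_cat_def dest: graded_left_module.axioms(1))
  let ?N = "\<lambda>n. (ad_E ip Q i ^^ n) (\<lambda>\<beta>. relabel Base (M \<beta>))"
  have inv: "left_module (cyc_klr Q i \<gamma>) (?N n \<gamma>) \<and> idem_generated Q i n W \<gamma> (?N n \<gamma>)" for n \<gamma>
  proof (induction n arbitrary: \<gamma>)
    case 0
    have "left_module (cyc_klr Q i \<gamma>) (relabel Base (M \<gamma>))"
      by (rule left_module_relabel(1)[OF M]) (simp add: inj_on_def)
    moreover have "idem_generated Q i 0 W \<gamma> (relabel Base (M \<gamma>))"
    \<comment> \<open>Outside the support of \<open>M\<close> the set \<open>W\<close> has no words
      of weight \<gamma>, but there the module is zero.\<close>
    proof (cases "zero_module (M \<gamma>)")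
      case True
      then show ?thesis by (intro idem_generated_zero) (simp add: zero_module_def relabel_def Let_def)
    next
      case False
      then have "seqs \<gamma> \<subseteq> W" by (auto simp: W_def)
      then show ?thesis by (intro idem_generated_0 calculation)
    qed
    ultimately show ?case by simp
  next
    case (Suc n)
    show ?case
    proof (cases "i \<in># \<gamma>")
      case True
      then obtain \<beta> where \<gamma>: "\<gamma> = {#i#} + \<beta>" by (metis add_mset_add_single insert_DiffM union_commute)
      have "?N (Suc n) \<gamma> = relabel encode (pi_functor Q i ({#i#} + \<beta>) (E_functor ip Q i \<beta> (inflate Q i \<beta> (?N n \<beta>))))"
        by (simp add: ad_E_def \<gamma>)
      then show ?thesis
        using ad_E_generating(1)[of Q i \<beta> "?N n \<beta>" ip] idem_generated_Suc[of Q i \<beta> "?N n \<beta>" n W ip] Suc.IH[of \<beta>]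
        unfolding \<gamma> by simp
    next
      case False
      then have "?N (Suc n) \<gamma> = trivial_module (Comb [])" by (simp add: ad_E_def)
      then show ?thesis using trivial_left_module[OF ring_cyc]
        by (auto intro!: idem_generated_zero simp: trivial_module_def)
    qed
  qed
  \<comment> \<open>\<open>Suc b\<close>, because \<open>idem_vanishes\<close> asks for more letters
    \<open>i\<close> than the degree.\<close>
  have "zero_module (?N (Suc b) \<gamma>)" for \<gamma>
  proof -
    define X where "X = ?N (Suc b) \<gamma>"
    have gen: "idem_generated Q i (Suc b) W \<gamma> X" and "left_module (cyc_klr Q i \<gamma>) X"
      using inv[of \<gamma> "Suc b"] unfolding X_def by auto
    then interpret X: left_module "cyc_klr Q i \<gamma>" X by simp
    interpret C: ideal "cyc_ideal Q i \<gamma>" "klr Q \<gamma>" by (rule ideal_cyc)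
    \<comment> \<open>The zero submodule is the test submodule: each generator is fixed by an
      idempotent that acts as zero.\<close>
    have "submodule {\<zero>\<^bsub>X\<^esub>} (cyc_klr Q i \<gamma>) X"
      by (intro submodule.intro submodule_axioms.intro X.M.add.subgroupI)
        (auto simp: X.smult_r_zero)
    moreover have "v = \<zero>\<^bsub>X\<^esub>" if v: "v \<in> carrier X" and \<nu>: "\<nu> \<in> W" "replicate (Suc b) i @ \<nu> \<in> seqs \<gamma>"
      and fixed: "cyc_class Q i \<gamma> (klr_class Q \<gamma> (egen (replicate (Suc b) i @ \<nu>))) \<odot>\<^bsub>X\<^esub> v = v" for v \<nu>
    proof -
      have "klr_class Q \<gamma> (egen (replicate (Suc b) i @ \<nu>)) \<in> cyc_ideal Q i \<gamma>"
        using b[OF \<nu>(1)] by (intro idem_vanishes[OF assms(1) _ \<nu>(2)]) simp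
      then have "cyc_class Q i \<gamma> (klr_class Q \<gamma> (egen (replicate (Suc b) i @ \<nu>))) = \<zero>\<^bsub>cyc_klr Q i \<gamma>\<^esub>"
        by (simp add: cyc_class_def cyc_klr_def FactRing_def C.a_rcos_const)
      then show ?thesis using fixed X.smult_l_zero[OF v] by simp
    qed
    ultimately have "carrier X \<subseteq> {\<zero>\<^bsub>X\<^esub>}"
      using gen unfolding idem_generated_def by blast
    then show ?thesis unfolding zero_module_def X_def[symmetric] using X.M.zero_closed by blast
  qed
  then show ?thesis by blast
qed

end
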